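(* For any given integer $m$ with $0\le m\le M-1$, the GMRES method for the two-sided preconditioned linear system $$P_{\alpha}^{-1/2}\tilde A_{\alpha}^{(m)}P_{\alpha}^{-1/2}\,\tilde{\mathbf u}=P_{\alpha}^{-1/2}\tilde{\mathbf b}^{(m)}$$ has a convergence rate independent of the grid size $N^d$, in the following sense. Let $\tilde{\mathbf u}_*^{(0)}\in\mathbb{R}^{N^d}$ be an arbitrary initial guess, let $\tilde{\mathbf u}_*^{(k)}$ denote the $k$-th GMRES iterate, and let $\mathbf r_k=P_{\alpha}^{-1/2}\tilde{\mathbf b}^{(m)}-P_{\alpha}^{-1/2}\tilde A_{\alpha}^{(m)}P_{\alpha}^{-1/2}\tilde{\mathbf u}_*^{(k)}$ (with $\mathbf r_0\neq 0$). Then for every $k\ge 1$ $$\frac{\|\mathbf r_k\|_2}{\|\mathbf r_0\|_2}\le (2+c)\,c^k,$$ where $$c=\max\left\{\sqrt{1-\frac{\check e^2}{\hat e^2}},\ \sqrt{\frac{16\sqrt6}{(4+\sqrt6)^2}},\ \sqrt{1-\frac{(\hat e+\check e)^2(11-4\sqrt6)}{32\,\hat e^2}},\ \sqrt{1-\frac{32\,\check e^2}{(11+4\sqrt6)(\hat e+\check e)^2}}\right\}.$$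
   Context: Data. $d,N,M$ are positive integers, $1<\alpha_i<2$, $\kappa_i\ge 0$ ($1\le i\le d$) with $\sum_i\kappa_i\ne 0$, $\Omega=\prod_{i=1}^d(L_i,R_i)$, $T>0$, $\Delta t=T/M$, $h_i=(R_i-L_i)/(N+1)$, $\eta_i=\kappa_i\Delta t/(2h_i^{\alpha_i})$. The function $e(\bm x,t)$ is bounded and positive-valued with positive minimum; $f(\bm x,t)$ is a source term and $\psi(\bm x)$ an initial condition. (These come from the Riesz space fractional diffusion problem $e\,\partial_t u=\sum_i\kappa_i\partial_{x_i}^{\alpha_i}u+f$ in $\Omega\times(0,T]$, with $u=0$ on $\partial\Omega$ and $u(\cdot,0)=\psi$.) Grid. $t_{m}=m\Delta t$, $t_{m+1/2}=(m+\tfrac12)\Delta t$, $x_{i,j}=L_i+jh_i$. $\mathbb G$ is the set of interior grid points $(x_{1,j_1},\dots,x_{d,j_d})$, $1\le j_i\le N$, ordered lexicographically with $j_1$ varying fastest. For a function $g$, $g(\mathbb G)$ is the vector of its values. $E^{(m+1/2)}=\mathrm{diag}(e(\mathbb G,t_{m+1/2}))$. $$\hat e=\max_{\mathbb G,\,0\le m\le M-1}e(\mathbb G,t_{m+1/2}),\quad \check e=\min_{\mathbb G,\,0\le m\le M-1}e(\mathbb G,t_{m+1/2}),\quad \bar e=\tfrac12(\hat e+\check e).$$ Matrices. $I_n$ is the $n\times n$ identity and $\otimes$ is the Kronecker product. $B_{\alpha_i}=I_N+\frac{\alpha_i}{24}\mathrm{tridiag}(1,-2,1)\in\mathbb R^{N\times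 N}$ and $B_\alpha=B_{\alpha_d}\otimes\cdots\otimes B_{\alpha_1}$ (symmetric positive definite). $S_{\alpha_i}=[s^{(\alpha_i)}_{|j-k|}]_{j,k=1}^N$ is the symmetric Toeplitz matrix with $s_0^{(\alpha)}=\Gamma(\alpha+1)/\Gamma(\alpha/2+1)^2$ and $s_k^{(\alpha)}=\left(1-\frac{\alpha+1}{\alpha/2+k}\right)s_{k-1}^{(\alpha)}$ for $k\ge1$. Put $$S_\alpha=\eta_1(B_{\alpha_d}\otimes\cdots\otimes B_{\alpha_2}\otimes S_{\alpha_1})+\cdots+\eta_d(S_{\alpha_d}\otimes B_{\alpha_{d-1}}\otimes\cdots\otimes B_{\alpha_1}),$$ where the $i$-th term has $S_{\alpha_i}$ in the position of $B_{\alpha_i}$ and $B_{\alpha_l}$ in all other positions. For a symmetric Toeplitz matrix $T\in\mathbb R^{N\times N}$ with first column $[t_0,\dots,t_{N-1}]^\top$, $\tau(T)=T-H(T)$, where $H(T)$ is the Hankel matrix with $(i,j)$ entry ($1\le i,j\le N$) equal to $t_{i+j}$ if $i+j\le N-1$, to $0$ if $N\le i+j\le N+2$, and to $t_{2N+2-i-j}$ if $i+j\ge N+3$. Put $$\tau(S_\alpha)=\eta_1(B_{\alpha_d}\otimes\cdots\otimes B_{\alpha_2}\otimes\tau(S_{\alpha_1}))+\cdots+\eta_d(\tau(S_{\alpha_d})\otimes B_{\alpha_{d-1}}\otimes\cdots\otimes B_{\alpha_1}).$$ Preconditioner: $P_\alpha=\bar e\,I_{N^d}+B_\alpha^{-1/2}\tau(S_\alpha)B_\alpha^{-1/2}$,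 which is symmetric positive definite; $P_\alpha^{\pm1/2}$ and $B_\alpha^{\pm1/2}$ are symmetric positive definite (inverse) square roots. Linear systems. For $0\le m\le M-1$, $\tilde A_\alpha^{(m)}=E^{(m+1/2)}+B_\alpha^{-1}S_\alpha$ and $\tilde{\mathbf b}^{(m)}=B_\alpha^{-1}\mathbf b^{(m)}$, $\mathbf b^{(m)}=(B_\alpha E^{(m+1/2)}-S_\alpha)\mathbf u^{(m)}+\Delta t\,\mathbf F^{(m+1/2)}$, with $\mathbf u^{(0)}=\psi(\mathbb G)$ and $\mathbf u^{(m+1)}$ the solution of $\tilde A_\alpha^{(m)}\mathbf u^{(m+1)}=\tilde{\mathbf b}^{(m)}$. Here $\mathbf F^{(m+1/2)}\in\mathbb R^{N^d}$ is the vector of values at the interior grid points of $\mathscr H_{\alpha_1}\cdots\mathscr H_{\alpha_d}f(\cdot,t_{m+1/2})$, where $\mathscr H_{\alpha_l}$ acts on grid functions (including boundary values) in the $l$-th index by $w_{j_l}\mapsto\frac{\alpha_l}{24}w_{j_l-1}+(1-\frac{\alpha_l}{12})w_{j_l}+\frac{\alpha_l}{24}w_{j_l+1}$ for $1\le j_l\le N$. GMRES. For a nonsingular system $A\mathbf y=\mathbf b$ with initial guess $\mathbf y^{(0)}$ and $\mathbf r_0=\mathbf b-A\mathbf y^{(0)}$, the $k$-th GMRES iterate ($k\ge1$) minimizes $\|\mathbf b-A\mathbf q\|_2$ over $\mathbf q\in\mathbf y^{(0)}+\mathrm{span}\{\mathbf r_0,A\mathbf r_0,\dots,A^{k-1}\mathbf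 r_0\}$. *)

theory Defs
  imports
    "HOL-Analysis.Gamma_Function"
    "Jordan_Normal_Form.Gauss_Jordan_Elimination"
    "Jordan_Normal_Form.VS_Connect"
begin

hide_type (open) Finite_Cartesian_Product.vec
hide_const (open) Finite_Cartesian_Product.vec Finite_Cartesian_Product.mat
  Finite_Cartesian_Product.row Finite_Cartesian_Product.rows
no_notation vec_nth (infixl \<open>$\<close> 90)
no_notation inner (infix \<open>\<bullet>\<close> 70)

text \<open>
  Coordinate directions are numbered from 0: direction \<open>i < d\<close> is the direction \<open>i + 1\<close> of the
  mathematical text. Points of d-dimensional space are elements of \<open>carrier_vec d\<close>.
\<close>

subsection \<open>Linear algebra\<close>

definition l2_norm_vec :: "real vec \<Rightarrow> real" where
  "l2_norm_vec v = sqrt (v \<bullet> v)"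

definition sym_pos_def :: "real mat \<Rightarrow> bool" where
  "sym_pos_def A \<longleftrightarrow> square_mat A \<and> transpose_mat A = A \<and>
     (\<forall>v \<in> carrier_vec (dim_row A). v \<noteq> 0\<^sub>v (dim_row A) \<longrightarrow> 0 < v \<bullet> (A *\<^sub>v v))"

text \<open>The next two are meaningful only for an invertible matrix and for a symmetric positive definite
  matrix, respectively; in the latter case the square root is unique, so the choice is immaterial.\<close>

definition inv_mat :: "real mat \<Rightarrow> real mat" where
  "inv_mat A = the (mat_inverse A)"

definition spd_sqrt :: "real mat \<Rightarrow> real mat" where
  "spd_sqrt A = (SOME S. S \<in> carrier_mat (dim_row A) (dim_row A) \<and> sym_pos_def S \<and> S * S = A)"

definition kronecker :: "real mat \<Rightarrow> real mat \<Rightarrow> real mat" (infixr \<open>\<otimes>\<^sub>K\<close> 72) where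
  "A \<otimes>\<^sub>K B = Matrix.mat (dim_row A * dim_row B) (dim_col A * dim_col B)
     (\<lambda>(i, j). A $$ (i div dim_row B, j div dim_col B) * B $$ (i mod dim_row B, j mod dim_col B))"

text \<open>\<open>kron_prod A d\<close> is the product of \<open>A (d - 1), \<dots>, A 1, A 0\<close> in this order: the last
  direction comes first, in accordance with direction 0 varying fastest in the grid ordering.\<close>

primrec kron_prod :: "(nat \<Rightarrow> real mat) \<Rightarrow> nat \<Rightarrow> real mat" where
  "kron_prod A 0 = 1\<^sub>m 1"
| "kron_prod A (Suc d) = A d \<otimes>\<^sub>K kron_prod A d"

definition tridiag :: "nat \<Rightarrow> real \<Rightarrow> real \<Rightarrow> real \<Rightarrow> real mat" where
  "tridiag n a b c = Matrix.mat n n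
     (\<lambda>(i, j). if i = j + 1 then a else if i = j then b else if j = i + 1 then c else 0)"

definition sym_toeplitz :: "nat \<Rightarrow> (nat \<Rightarrow> real) \<Rightarrow> real mat" where
  "sym_toeplitz n t = Matrix.mat n n (\<lambda>(j, k). t (nat \<bar>int j - int k\<bar>))"

text \<open>Here \<open>s = i + j\<close> for the 1-based row and column numbers \<open>i\<close>, \<open>j\<close>, whereas the entry
  \<open>t\<^sub>k\<close> of the first column is \<open>A $$ (k, 0)\<close>.\<close>

definition tau_hankel :: "real mat \<Rightarrow> real mat" where
  "tau_hankel A = (let n = dim_row A in Matrix.mat n n (\<lambda>(i, j).
     let s = (i + 1) + (j + 1) in
       if s + 1 \<le> n then A $$ (s, 0)
       else if s \<le> n + 2 then 0
       else A $$ (2 * n + 2 - s, 0)))"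

definition tau_mat :: "real mat \<Rightarrow> real mat" where
  "tau_mat A = A - tau_hankel A"

subsection \<open>GMRES\<close>

definition krylov :: "real mat \<Rightarrow> real vec \<Rightarrow> nat \<Rightarrow> real vec set" where
  "krylov A r k = LinearCombinations.module.span class_ring (module_vec TYPE(real) (dim_vec r))
     ((\<lambda>i. (A ^\<^sub>m i) *\<^sub>v r) ` {..<k})"

definition gmres_iterate :: "real mat \<Rightarrow> real vec \<Rightarrow> real vec \<Rightarrow> nat \<Rightarrow> real vec \<Rightarrow> bool" where
  "gmres_iterate A b y0 k y \<longleftrightarrow>
     is_arg_min (\<lambda>q. l2_norm_vec (b - A *\<^sub>v q))
       (\<lambda>q. q \<in> (\<lambda>z. y0 + z) ` krylov A (b - A *\<^sub>v y0) k) y"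

subsection \<open>Problem data and grid\<close>

text \<open>The fields stand for \<open>d\<close>, \<open>N\<close>, \<open>M\<close>, \<open>\<alpha>\<close>, \<open>\<kappa>\<close>, \<open>L\<close>, \<open>R\<close>, \<open>T\<close>, \<open>e\<close>, \<open>f\<close>, \<open>\<psi>\<close>, in this order.\<close>

record riesz_problem =
  ndirs :: nat
  npts :: nat
  nsteps :: nat
  frac_ord :: "nat \<Rightarrow> real"
  diff_coef :: "nat \<Rightarrow> real"
  left_end :: "nat \<Rightarrow> real"
  right_end :: "nat \<Rightarrow> real"
  final_time :: real
  e_fun :: "real vec \<Rightarrow> real \<Rightarrow> real"
  f_src :: "real vec \<Rightarrow> real \<Rightarrow> real"
  psi_init :: "real vec \<Rightarrow> real"

definition Omega :: "riesz_problem \<Rightarrow> real vec set" where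
  "Omega D = {x \<in> carrier_vec (ndirs D). \<forall>i < ndirs D. left_end D i < x $ i \<and> x $ i < right_end D i}"

definition ndof :: "riesz_problem \<Rightarrow> nat" where
  "ndof D = npts D ^ ndirs D"

definition dt :: "riesz_problem \<Rightarrow> real" where
  "dt D = final_time D / real (nsteps D)"

definition hstep :: "riesz_problem \<Rightarrow> nat \<Rightarrow> real" where
  "hstep D i = (right_end D i - left_end D i) / (real (npts D) + 1)"

definition eta :: "riesz_problem \<Rightarrow> nat \<Rightarrow> real" where
  "eta D i = diff_coef D i * dt D / (2 * hstep D i powr frac_ord D i)"

definition t_half :: "riesz_problem \<Rightarrow> nat \<Rightarrow> real" where
  "t_half D m = (real m + 1 / 2) * dt D"

definition grid_point :: "riesz_problem \<Rightarrow> (nat \<Rightarrow> nat) \<Rightarrow> real vec" where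
  "grid_point D j = Matrix.vec (ndirs D) (\<lambda>i. left_end D i + real (j i) * hstep D i)"

text \<open>The multi-index (with components in \<open>{1..N}\<close>) of the interior grid point at position
  \<open>p < N ^ d\<close> of the lexicographic ordering in which direction 0 varies fastest.\<close>

definition multi_index :: "riesz_problem \<Rightarrow> nat \<Rightarrow> nat \<Rightarrow> nat" where
  "multi_index D p = (\<lambda>i. (p div npts D ^ i) mod npts D + 1)"

definition on_grid :: "riesz_problem \<Rightarrow> (real vec \<Rightarrow> real) \<Rightarrow> real vec" where
  "on_grid D g = Matrix.vec (ndof D) (\<lambda>p. g (grid_point D (multi_index D p)))"

definition E_mat :: "riesz_problem \<Rightarrow> nat \<Rightarrow> real mat" where
  "E_mat D m = mat_diag (ndof D) (\<lambda>p. on_grid D (\<lambda>x. e_fun D x (t_half D m)) $ p)"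

definition e_values :: "riesz_problem \<Rightarrow> real set" where
  "e_values D = {e_fun D (grid_point D (multi_index D p)) (t_half D m) | p m. p < ndof D \<and> m < nsteps D}"

definition e_max :: "riesz_problem \<Rightarrow> real" where "e_max D = Max (e_values D)"
definition e_min :: "riesz_problem \<Rightarrow> real" where "e_min D = Min (e_values D)"
definition e_bar :: "riesz_problem \<Rightarrow> real" where "e_bar D = (e_max D + e_min D) / 2"

subsection \<open>Matrices of the scheme\<close>

primrec s_coef :: "real \<Rightarrow> nat \<Rightarrow> real" where
  "s_coef a 0 = Gamma (a + 1) / (Gamma (a / 2 + 1))\<^sup>2"
| "s_coef a (Suc k) = (1 - (a + 1) / (a / 2 + real (Suc k))) * s_coef a k"

definition B1_mat :: "riesz_problem \<Rightarrow> nat \<Rightarrow> real mat" where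
  "B1_mat D i = 1\<^sub>m (npts D) + (frac_ord D i / 24) \<cdot>\<^sub>m tridiag (npts D) 1 (- 2) 1"

definition S1_mat :: "riesz_problem \<Rightarrow> nat \<Rightarrow> real mat" where
  "S1_mat D i = sym_toeplitz (npts D) (s_coef (frac_ord D i))"

definition B_mat :: "riesz_problem \<Rightarrow> real mat" where
  "B_mat D = kron_prod (B1_mat D) (ndirs D)"

text \<open>The sum over \<open>i\<close> of \<open>\<eta>\<^sub>i\<close> times the Kronecker product with \<open>X i\<close> in position \<open>i\<close> and the
  one-dimensional B-matrices elsewhere.\<close>

definition kron_sum :: "riesz_problem \<Rightarrow> (nat \<Rightarrow> real mat) \<Rightarrow> real mat" where
  "kron_sum D X = Matrix.mat (ndof D) (ndof D)
     (\<lambda>pq. \<Sum>i<ndirs D. eta D i * kron_prod ((B1_mat D)(i := X i)) (ndirs D) $$ pq)"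

definition S_mat :: "riesz_problem \<Rightarrow> real mat" where
  "S_mat D = kron_sum D (S1_mat D)"

definition tau_S_mat :: "riesz_problem \<Rightarrow> real mat" where
  "tau_S_mat D = kron_sum D (\<lambda>i. tau_mat (S1_mat D i))"

definition B_inv_sqrt :: "riesz_problem \<Rightarrow> real mat" where
  "B_inv_sqrt D = inv_mat (spd_sqrt (B_mat D))"

definition P_mat :: "riesz_problem \<Rightarrow> real mat" where
  "P_mat D = e_bar D \<cdot>\<^sub>m 1\<^sub>m (ndof D) + B_inv_sqrt D * tau_S_mat D * B_inv_sqrt D"

definition P_inv_sqrt :: "riesz_problem \<Rightarrow> real mat" where
  "P_inv_sqrt D = inv_mat (spd_sqrt (P_mat D))"

subsection \<open>Linear systems\<close>

text \<open>Grid functions are functions of the multi-index, boundary indices 0 and \<open>N + 1\<close> included.\<close>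

definition avg_op :: "riesz_problem \<Rightarrow> nat \<Rightarrow> ((nat \<Rightarrow> nat) \<Rightarrow> real) \<Rightarrow> (nat \<Rightarrow> nat) \<Rightarrow> real" where
  "avg_op D l w = (\<lambda>j. frac_ord D l / 24 * w (j(l := j l - 1)) + (1 - frac_ord D l / 12) * w j
     + frac_ord D l / 24 * w (j(l := j l + 1)))"

definition F_vec :: "riesz_problem \<Rightarrow> nat \<Rightarrow> real vec" where
  "F_vec D m = Matrix.vec (ndof D) (\<lambda>p. foldr (avg_op D) [0..<ndirs D]
     (\<lambda>j. f_src D (grid_point D j) (t_half D m)) (multi_index D p))"

definition A_tilde :: "riesz_problem \<Rightarrow> nat \<Rightarrow> real mat" where
  "A_tilde D m = E_mat D m + inv_mat (B_mat D) * S_mat D"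

definition b_tilde :: "riesz_problem \<Rightarrow> nat \<Rightarrow> real vec \<Rightarrow> real vec" where
  "b_tilde D m v = inv_mat (B_mat D) *\<^sub>v
     ((B_mat D * E_mat D m - S_mat D) *\<^sub>v v + dt D \<cdot>\<^sub>v F_vec D m)"

definition scheme_solution :: "riesz_problem \<Rightarrow> (nat \<Rightarrow> real vec) \<Rightarrow> bool" where
  "scheme_solution D u \<longleftrightarrow> u 0 = on_grid D (psi_init D) \<and>
     (\<forall>m < nsteps D. u (Suc m) \<in> carrier_vec (ndof D) \<and>
        A_tilde D m *\<^sub>v u (Suc m) = b_tilde D m (u m))"

end

(* Each direction contributes B^-1 S = B^-1 tau(S) + B^-1 H, where H = S - tau(S) is a Hankel matrix.
   Diagonal dominance of tau(S) + 2 H and tau(S) - 2 H bounds H by tau(S) / 2 in the sense of quadratic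
   forms. Since tau(S) commutes with B and 2/3 <= B <= 1, the form of B^-1 H is at most sqrt 6 / 4 times
   that of B^-1 tau(S); this survives Kronecker products because it is a consequence of the positivity
   of matrices. Hence the preconditioned matrix A satisfies gamma |v|^2 <= v . A v and
   |A v| <= Gamma |v|, with gamma = min (e_min / e_bar) (1 - sqrt 6 / 4) and
   Gamma = max (e_max / e_bar) (1 + sqrt 6 / 4). Comparing GMRES with the Richardson iteration gives
   the factor sqrt (1 - gamma^2 / Gamma^2) per step, and the four entries of the maximum c are the
   four possible values of this factor. *)

theory Submission
  imports Defs
begin

section \<open>Quadratic forms\<close>

text \<open>The obstacle is that C H, with C = B^-1, is not symmetric, since H does not commute with
  B in general. So H enters through a Cauchy-Schwarz inequality in two vectors: with T = tau(S), (C
  x . H y)^2 <= 1/4 (C x . T C x) (y . T y). From C T C <= 3/2 C T and T <= C T the constant becomes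
  1/4 * 3/2 = 3/8 = (sqrt 6 / 4)^2. Two vectors are also what yields |A v| <= Gamma |v|: for a
  nonsymmetric A, bounds on v . A v alone do not control the norm. The preconditioner takes the same
  shape as the system matrix: tau(S) commutes with B, so B^(-1/2) tau(S) B^(-1/2) = B^-1 tau(S), and
  B^-1 cancels every Kronecker factor except the one in direction i. The two matrices can then be
  compared summand by summand, with the eta_i as mere nonnegative weights; this is why the constants
  depend neither on the grid nor on d. No eigenvalues appear: every ordering is positivity of a
  form, and products of commuting positive matrices are handled by square roots obtained from the
  binomial series of (1 - X)^a.\<close>

definition psd :: "nat \<Rightarrow> real mat \<Rightarrow> bool" where
  "psd n A \<longleftrightarrow> A \<in> carrier_mat n n \<and> transpose_mat A = A \<and>
     (\<forall>v \<in> carrier_vec n. 0 \<le> v \<bullet> (A *\<^sub>v v))"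

definition spd :: "nat \<Rightarrow> real mat \<Rightarrow> bool" where
  "spd n A \<longleftrightarrow> A \<in> carrier_mat n n \<and> sym_pos_def A"

lemma psdD:
  assumes "psd n A"
  shows "A \<in> carrier_mat n n" "transpose_mat A = A" "v \<in> carrier_vec n \<Longrightarrow> 0 \<le> v \<bullet> (A *\<^sub>v v)"
  using assms by (auto simp: psd_def)

lemma spd_iff:
  "spd n A \<longleftrightarrow> A \<in> carrier_mat n n \<and> transpose_mat A = A \<and>
     (\<forall>v \<in> carrier_vec n. v \<noteq> 0\<^sub>v n \<longrightarrow> 0 < v \<bullet> (A *\<^sub>v v))"
  by (auto simp: spd_def sym_pos_def_def)

lemma spdD:
  assumes "spd n A"
  shows "A \<in> carrier_mat n n" "transpose_mat A = A"
    "v \<in> carrier_vec n \<Longrightarrow> v \<noteq> 0\<^sub>v n \<Longrightarrow> 0 < v \<bullet> (A *\<^sub>v v)"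
  using assms by (auto simp: spd_iff)

lemma spd_imp_psd: "spd n A \<Longrightarrow> psd n A"
  unfolding spd_iff psd_def
  by (metis carrier_matD(1) carrier_vecI dim_mult_mat_vec order_less_imp_le order_refl
      scalar_prod_left_zero)

lemma scalar_prod_self_nonneg: "0 \<le> v \<bullet> (v :: real vec)"
  by (auto simp: scalar_prod_def intro!: sum_nonneg)

lemma scalar_prod_self_eq_0:
  assumes "v \<in> carrier_vec n" "v \<bullet> (v :: real vec) = 0"
  shows "v = 0\<^sub>v n"
  using assms by (auto simp: scalar_prod_def sum_nonneg_eq_0_iff intro!: eq_vecI)

lemma scalar_prod_self_pos:
  assumes "v \<in> carrier_vec n" "v \<noteq> 0\<^sub>v n"
  shows "0 < v \<bullet> (v :: real vec)"
  using scalar_prod_self_nonneg[of v] scalar_prod_self_eq_0 assms by fastforce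

lemma transpose_form:
  fixes A :: "real mat"
  assumes "A \<in> carrier_mat n n" "transpose_mat A = A" "x \<in> carrier_vec n" "y \<in> carrier_vec n"
  shows "(A *\<^sub>v x) \<bullet> y = x \<bullet> (A *\<^sub>v y)"
  using transpose_vec_mult_scalar[of A n n y x] assms by simp

lemma form_sym:
  fixes A :: "real mat"
  assumes "A \<in> carrier_mat n n" "transpose_mat A = A" "x \<in> carrier_vec n" "y \<in> carrier_vec n"
  shows "x \<bullet> (A *\<^sub>v y) = y \<bullet> (A *\<^sub>v x)"
  using transpose_form[OF assms] assms by (metis comm_scalar_prod mult_mat_vec_carrier)

lemma form_bilinear:
  fixes A :: "real mat"
  assumes "A \<in> carrier_mat n n" "x \<in> carrier_vec n" "y \<in> carrier_vec n" "z \<in> carrier_vec n"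
  shows "x \<bullet> (A *\<^sub>v (y + z)) = x \<bullet> (A *\<^sub>v y) + x \<bullet> (A *\<^sub>v z)"
    "x \<bullet> (A *\<^sub>v (y - z)) = x \<bullet> (A *\<^sub>v y) - x \<bullet> (A *\<^sub>v z)"
    "x \<bullet> (A *\<^sub>v (t \<cdot>\<^sub>v y)) = t * (x \<bullet> (A *\<^sub>v y))"
    "(y + z) \<bullet> (A *\<^sub>v x) = y \<bullet> (A *\<^sub>v x) + z \<bullet> (A *\<^sub>v x)"
    "(y - z) \<bullet> (A *\<^sub>v x) = y \<bullet> (A *\<^sub>v x) - z \<bullet> (A *\<^sub>v x)"
    "(t \<cdot>\<^sub>v y) \<bullet> (A *\<^sub>v x) = t * (y \<bullet> (A *\<^sub>v x))"
  using assms
  by (simp_all add: mult_add_distrib_mat_vec[of A n n] mult_minus_distrib_mat_vec[of A n n]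
      mult_mat_vec[of A n n] scalar_prod_add_distrib[of x n] scalar_prod_minus_distrib[of x n]
      add_scalar_prod_distrib[of y n] minus_scalar_prod_distrib[of y n])

lemma form_mat_add:
  fixes A B :: "real mat"
  assumes "A \<in> carrier_mat n n" "B \<in> carrier_mat n n" "x \<in> carrier_vec n" "y \<in> carrier_vec n"
  shows "x \<bullet> ((A + B) *\<^sub>v y) = x \<bullet> (A *\<^sub>v y) + x \<bullet> (B *\<^sub>v y)"
    "x \<bullet> ((A - B) *\<^sub>v y) = x \<bullet> (A *\<^sub>v y) - x \<bullet> (B *\<^sub>v y)"
  using assms
  by (simp_all add: add_mult_distrib_mat_vec[of A n n] minus_mult_distrib_mat_vec[of A n n]
      scalar_prod_add_distrib[of x n] scalar_prod_minus_distrib[of x n])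

lemma smult_mat_mult_vec:
  fixes A :: "real mat"
  assumes "A \<in> carrier_mat n m" "y \<in> carrier_vec m"
  shows "(t \<cdot>\<^sub>m A) *\<^sub>v y = t \<cdot>\<^sub>v (A *\<^sub>v y)"
  using assms by (intro eq_vecI) (auto simp: scalar_prod_def sum_distrib_left mult.assoc)

lemma form_mat_smult:
  fixes A :: "real mat"
  assumes "A \<in> carrier_mat n n" "x \<in> carrier_vec n" "y \<in> carrier_vec n"
  shows "x \<bullet> ((t \<cdot>\<^sub>m A) *\<^sub>v y) = t * (x \<bullet> (A *\<^sub>v y))"
  using assms by (simp add: smult_mat_mult_vec[of A n n])

lemma form_sum:
  fixes A :: "real mat"
  assumes "A \<in> carrier_mat n n" "x \<in> carrier_vec n" "y \<in> carrier_vec n"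
  shows "x \<bullet> (A *\<^sub>v y) = (\<Sum>i<n. \<Sum>j<n. A $$ (i, j) * x $ i * y $ j)"
  using assms
  by (auto simp: scalar_prod_def sum_distrib_left atLeast0LessThan mult_ac intro!: sum.cong)

text \<open>The discriminant criterion. For b > 0 the choice s = b, t = h and division by b suffice;
  for a > 0 the roles are exchanged; for a = b = 0 the choice s = h, t = 1 leaves 2 h^2 <=
  0.\<close>

lemma sq_le_mult_if_quadratic:
  fixes a b h :: real
  assumes "0 \<le> a" "0 \<le> b" and q: "\<And>s t. 2 * s * t * h \<le> s\<^sup>2 * a + t\<^sup>2 * b"
  shows "h\<^sup>2 \<le> a * b"
proof -
  consider "b > 0" | "a > 0" | "a = 0" "b = 0" using assms by linarith
  then show ?thesis
  proof cases
    case 1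
    have "b * (2 * h\<^sup>2) \<le> b * (b * a + h\<^sup>2)"
      using q[of b h] by (simp add: power2_eq_square algebra_simps)
    then show ?thesis using 1 by (simp add: mult.commute)
  next
    case 2
    have "a * (2 * h\<^sup>2) \<le> a * (b * a + h\<^sup>2)"
      using q[of h a] by (simp add: power2_eq_square algebra_simps)
    then show ?thesis using 2 by (simp add: mult.commute)
  next
    case 3
    then show ?thesis using q[of h 1] by (simp add: power2_eq_square)
  qed
qed

text \<open>Polarization: \<open>T - H\<close> is nonnegative at s x + t y and \<open>T + H\<close>
  at s x - t y. In the sum of the two, the cross terms of T and the squares of H cancel, which
  leaves the quadratic inequality in s and t. T may be semidefinite and H indefinite.\<close>

lemma form_cauchy_schwarz:
  fixes H T :: "real mat"
  assumes H: "H \<in> carrier_mat n n" "transpose_mat H = H"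
    and T: "T \<in> carrier_mat n n" "transpose_mat T = T"
    and dom: "\<And>z. z \<in> carrier_vec n \<Longrightarrow> \<bar>z \<bullet> (H *\<^sub>v z)\<bar> \<le> z \<bullet> (T *\<^sub>v z)"
    and x: "x \<in> carrier_vec n" and y: "y \<in> carrier_vec n"
  shows "(x \<bullet> (H *\<^sub>v y))\<^sup>2 \<le> (x \<bullet> (T *\<^sub>v x)) * (y \<bullet> (T *\<^sub>v y))"
proof (rule sq_le_mult_if_quadratic)
  show "0 \<le> x \<bullet> (T *\<^sub>v x)" "0 \<le> y \<bullet> (T *\<^sub>v y)"
    using dom[OF x] dom[OF y] by linarith+
  fix s t :: real
  let ?p = "s \<cdot>\<^sub>v x + t \<cdot>\<^sub>v y" and ?m = "s \<cdot>\<^sub>v x - t \<cdot>\<^sub>v y"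
  have c: "?p \<in> carrier_vec n" "?m \<in> carrier_vec n"
    "s \<cdot>\<^sub>v x \<in> carrier_vec n" "t \<cdot>\<^sub>v y \<in> carrier_vec n" using x y by auto
  have expand: "?p \<bullet> (A *\<^sub>v ?p) = s\<^sup>2 * (x \<bullet> (A *\<^sub>v x)) + t\<^sup>2 * (y \<bullet> (A *\<^sub>v y)) + 2 * s * t * (x \<bullet> (A *\<^sub>v y))"
     "?m \<bullet> (A *\<^sub>v ?m) = s\<^sup>2 * (x \<bullet> (A *\<^sub>v x)) + t\<^sup>2 * (y \<bullet> (A *\<^sub>v y)) - 2 * s * t * (x \<bullet> (A *\<^sub>v y))"
    if A: "A \<in> carrier_mat n n" "transpose_mat A = A" for A
    using form_sym[OF A y x] A(1) c x y
    by (simp_all add: form_bilinear[OF A(1)] power2_eq_square distrib_left left_diff_distrib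
        right_diff_distrib mult_ac)
  have "?p \<bullet> (H *\<^sub>v ?p) \<le> ?p \<bullet> (T *\<^sub>v ?p)" "- (?m \<bullet> (H *\<^sub>v ?m)) \<le> ?m \<bullet> (T *\<^sub>v ?m)"
    using dom[OF c(1)] dom[OF c(2)] by linarith+
  then show "2 * s * t * (x \<bullet> (H *\<^sub>v y)) \<le> s\<^sup>2 * (x \<bullet> (T *\<^sub>v x)) + t\<^sup>2 * (y \<bullet> (T *\<^sub>v y))"
    unfolding expand[OF H] expand[OF T] by linarith
qed

lemma psd_cauchy_schwarz:
  assumes "psd n A" "x \<in> carrier_vec n" "y \<in> carrier_vec n"
  shows "(x \<bullet> (A *\<^sub>v y))\<^sup>2 \<le> (x \<bullet> (A *\<^sub>v x)) * (y \<bullet> (A *\<^sub>v y))"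
  using assms by (intro form_cauchy_schwarz[of A n A]) (auto simp: psd_def)

lemma spd_one: "spd n (1\<^sub>m n)"
  using scalar_prod_self_pos by (auto simp: spd_iff)

lemma scalar_prod_cauchy_schwarz:
  fixes x y :: "real vec"
  assumes "x \<in> carrier_vec n" "y \<in> carrier_vec n"
  shows "(x \<bullet> y)\<^sup>2 \<le> (x \<bullet> x) * (y \<bullet> y)"
  using psd_cauchy_schwarz[OF spd_imp_psd[OF spd_one] assms] assms by simp

lemma form_bounded:
  fixes A :: "real mat"
  assumes A: "A \<in> carrier_mat n n"
  obtains K where "K > 0" "\<And>x. x \<in> carrier_vec n \<Longrightarrow> \<bar>x \<bullet> (A *\<^sub>v x)\<bar> \<le> K * (x \<bullet> x)"
proof
  let ?K = "\<Sum>i<n. \<Sum>j<n. \<bar>A $$ (i, j)\<bar>"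
  show "?K + 1 > 0" by (intro add_nonneg_pos sum_nonneg) auto
  fix x :: "real vec" assume x: "x \<in> carrier_vec n"
  have sq: "(x $ i)\<^sup>2 \<le> x \<bullet> x" if "i < n" for i
    using x that by (auto simp: scalar_prod_def power2_eq_square intro!: member_le_sum[of i "{0..<n}" "\<lambda>i. x $ i * x $ i"])
  have "\<bar>A $$ (i, j) * x $ i * x $ j\<bar> \<le> \<bar>A $$ (i, j)\<bar> * (x \<bullet> x)" if ij: "i < n" "j < n" for i j
  proof -
    have "0 \<le> (\<bar>x $ i\<bar> - \<bar>x $ j\<bar>)\<^sup>2" by simp
    then have "2 * \<bar>x $ i * x $ j\<bar> \<le> (x $ i)\<^sup>2 + (x $ j)\<^sup>2"
      by (simp add: power2_diff abs_mult)
    then have "\<bar>x $ i * x $ j\<bar> \<le> x \<bullet> x" using sq[OF ij(1)] sq[OF ij(2)] by linarith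
    then have "\<bar>A $$ (i, j)\<bar> * \<bar>x $ i * x $ j\<bar> \<le> \<bar>A $$ (i, j)\<bar> * (x \<bullet> x)"
      by (rule mult_left_mono) simp
    then show ?thesis by (simp add: abs_mult mult.assoc)
  qed
  then have "\<bar>x \<bullet> (A *\<^sub>v x)\<bar> \<le> (\<Sum>i<n. \<Sum>j<n. \<bar>A $$ (i, j)\<bar> * (x \<bullet> x))"
    unfolding form_sum[OF A x x]
    by (intro order_trans[OF sum_abs] sum_mono) auto
  also have "\<dots> = ?K * (x \<bullet> x)" by (simp add: sum_distrib_right)
  also have "\<dots> \<le> (?K + 1) * (x \<bullet> x)"
    using scalar_prod_self_nonneg[of x] by (intro mult_right_mono) auto
  finally show "\<bar>x \<bullet> (A *\<^sub>v x)\<bar> \<le> (?K + 1) * (x \<bullet> x)" .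
qed

section \<open>Inverses, coercivity, and commutation with a square root\<close>

lemma inv_mat:
  assumes A: "A \<in> carrier_mat n n"
    and inj: "\<And>v. v \<in> carrier_vec n \<Longrightarrow> A *\<^sub>v v = 0\<^sub>v n \<Longrightarrow> v = 0\<^sub>v n"
  shows "inv_mat A \<in> carrier_mat n n" "A * inv_mat A = 1\<^sub>m n" "inv_mat A * A = 1\<^sub>m n"
proof -
  have "det A \<noteq> 0" using det_0_iff_vec_prod_zero[OF A] inj by blast
  \<comment> \<open>Invertibility is phrased through the units of the ring of matrices;
    \<open>()\<close> fills the arbitrary extra argument of that ring.\<close>
  then have "mat_inverse A \<noteq> None"
    using mat_inverse(1)[OF A, of "()"] det_non_zero_imp_unit[OF A, of "()"] by blast
  then have "mat_inverse A = Some (inv_mat A)" by (auto simp: inv_mat_def)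
  from mat_inverse(2)[OF A this]
  show "inv_mat A \<in> carrier_mat n n" "A * inv_mat A = 1\<^sub>m n" "inv_mat A * A = 1\<^sub>m n" by auto
qed

lemma mat_inverse_unique:
  fixes A :: "real mat"
  assumes "A \<in> carrier_mat n n" "X \<in> carrier_mat n n" "Y \<in> carrier_mat n n"
    and "X * A = 1\<^sub>m n" "A * Y = 1\<^sub>m n"
  shows "X = Y"
proof -
  have "X = X * (A * Y)" using assms by simp
  also have "\<dots> = (X * A) * Y" using assms(1-3) by simp
  also have "\<dots> = Y" using assms by (simp del: assoc_mult_mat)
  finally show ?thesis .
qed

lemma inv_mat_eqI:
  assumes A: "A \<in> carrier_mat n n" and X: "X \<in> carrier_mat n n" and XA: "X * A = 1\<^sub>m n"
  shows "inv_mat A = X"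
proof -
  have inj: "v = 0\<^sub>v n" if "v \<in> carrier_vec n" "A *\<^sub>v v = 0\<^sub>v n" for v
  proof -
    have "v = (X * A) *\<^sub>v v" using XA that by simp
    also have "\<dots> = X *\<^sub>v (A *\<^sub>v v)" using A X that(1) by simp
    also have "\<dots> = 0\<^sub>v n" unfolding that(2) using X by auto
    finally show ?thesis .
  qed
  show ?thesis
    by (rule mat_inverse_unique[OF A X inv_mat(1)[OF A inj] XA inv_mat(2)[OF A inj], symmetric])
qed

lemma spd_inv_mat:
  assumes "spd n A"
  shows "inv_mat A \<in> carrier_mat n n" "A * inv_mat A = 1\<^sub>m n" "inv_mat A * A = 1\<^sub>m n"
proof -
  have inj: "v = 0\<^sub>v n" if "v \<in> carrier_vec n" "A *\<^sub>v v = 0\<^sub>v n" for v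
    using spdD(3)[OF assms that(1)] that by fastforce
  show "inv_mat A \<in> carrier_mat n n" "A * inv_mat A = 1\<^sub>m n" "inv_mat A * A = 1\<^sub>m n"
    using inv_mat[OF spdD(1)[OF assms] inj] by auto
qed

lemma sym_inv_mat:
  assumes "spd n A"
  shows "transpose_mat (inv_mat A) = inv_mat A"
proof -
  note A = spdD[OF assms] and I = spd_inv_mat[OF assms]
  have "transpose_mat (inv_mat A) * A = transpose_mat (A * inv_mat A)"
    using transpose_mult[OF A(1) I(1)] A(2) by simp
  then have "transpose_mat (inv_mat A) * A = 1\<^sub>m n" using I by simp
  then show ?thesis using I(1) by (intro mat_inverse_unique[OF A(1) _ I(1) _ I(2)]) auto
qed

lemma mult_inv_mat_cancel:
  assumes "spd n A" "v \<in> carrier_vec n"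
  shows "A *\<^sub>v (inv_mat A *\<^sub>v v) = v" "inv_mat A *\<^sub>v (A *\<^sub>v v) = v"
  using spd_inv_mat[OF assms(1)] spdD(1)[OF assms(1)] assms(2)
  by (metis assoc_mult_mat_vec one_mult_mat_vec)+

text \<open>Cauchy-Schwarz for A at the pair v, A^-1 v gives (v . v)^2 <= (v . A v) (v . A^-1 v).
  Any bound K on the form of A^-1 then yields \<delta> = 1 / K, without compactness or
  eigenvalues.\<close>

lemma spd_coercive:
  assumes A: "spd n A"
  obtains \<delta> where "\<delta> > 0" "\<And>v. v \<in> carrier_vec n \<Longrightarrow> \<delta> * (v \<bullet> v) \<le> v \<bullet> (A *\<^sub>v v)"
proof -
  note I = spd_inv_mat[OF A]
  obtain K where K: "K > 0" "\<And>x. x \<in> carrier_vec n \<Longrightarrow> \<bar>x \<bullet> (inv_mat A *\<^sub>v x)\<bar> \<le> K * (x \<bullet> x)"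
    using form_bounded[OF I(1)] by blast
  have "1 / K * (v \<bullet> v) \<le> v \<bullet> (A *\<^sub>v v)" if v: "v \<in> carrier_vec n" for v
  proof (cases "v = 0\<^sub>v n")
    case True then show ?thesis using spdD(1)[OF A] by simp
  next
    case False
    let ?w = "inv_mat A *\<^sub>v v"
    have w: "?w \<in> carrier_vec n" "A *\<^sub>v ?w = v" using I v mult_inv_mat_cancel[OF A v] by auto
    note pos = scalar_prod_self_pos[OF v False]
    have "(v \<bullet> v)\<^sup>2 \<le> (v \<bullet> (A *\<^sub>v v)) * (?w \<bullet> v)"
      using psd_cauchy_schwarz[OF spd_imp_psd[OF A] v w(1)] w by simp
    also have "\<dots> \<le> (v \<bullet> (A *\<^sub>v v)) * (K * (v \<bullet> v))"
      using K(2)[OF v] comm_scalar_prod[OF v w(1)] spdD(3)[OF A v False]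
      by (intro mult_left_mono) auto
    finally have "v \<bullet> v \<le> (v \<bullet> (A *\<^sub>v v)) * K" using pos by (simp add: power2_eq_square)
    then show ?thesis using K(1) by (simp add: field_simps)
  qed
  then show ?thesis using that[of "1 / K"] K(1) by simp
qed

text \<open>The commutator Z = X R - R X satisfies R Z + Z R = 0 because X commutes with R^2.
  Pairing this with Z entrywise, that is, taking the trace of Z^T (R Z + Z R), gives the form of R
  summed over all columns of Z plus the same over all rows. These are nonnegative with total 0, so
  positive definiteness of R makes every column vanish.\<close>

lemma commute_sqrt_if_commute:
  assumes R: "spd n R" and X: "X \<in> carrier_mat n n" and comm: "X * (R * R) = (R * R) * X"
  shows "X * R = R * X"
proof -
  note Rd = spdD[OF R]
  define Z where "Z = X * R - R * X"
  have Z: "Z \<in> carrier_mat n n" unfolding Z_def using X Rd by auto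
  have c: "X * R \<in> carrier_mat n n" "R * X \<in> carrier_mat n n" "R * R \<in> carrier_mat n n"
    using X Rd by auto
  have RZ: "R * Z = R * (X * R) - R * (R * X)" unfolding Z_def
    using c Rd(1) by (intro mult_minus_distrib_mat) auto
  have ZR: "Z * R = X * R * R - R * X * R" unfolding Z_def
    using c Rd(1) by (intro minus_mult_distrib_mat) auto
  have anti: "(R * Z) $$ (i, j) + (Z * R) $$ (i, j) = 0" if ij: "i < n" "j < n" for i j
  proof -
    have eq: "X * R * R = R * (R * X)" "R * X * R = R * (X * R)"
      using comm X Rd(1) by simp_all
    have c': "R * (X * R) \<in> carrier_mat n n" "R * (R * X) \<in> carrier_mat n n"
      using X Rd(1) by auto
    have "(A - B) $$ (i, j) + (B - A) $$ (i, j) = 0"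
      if "A \<in> carrier_mat n n" "B \<in> carrier_mat n n" for A B :: "real mat"
      using that ij by simp
    from this[OF c'] show ?thesis unfolding RZ ZR eq .
  qed
  have "Z $$ (i, j) * (R * Z) $$ (i, j) + Z $$ (i, j) * (Z * R) $$ (i, j) = 0"
    if "i < n" "j < n" for i j
    using anti[OF that] by (metis distrib_left mult_zero_right)
  then have sum0: "(\<Sum>i<n. \<Sum>j<n. Z $$ (i, j) * (R * Z) $$ (i, j)) +
      (\<Sum>i<n. \<Sum>j<n. Z $$ (i, j) * (Z * R) $$ (i, j)) = 0"
    unfolding sum.distrib[symmetric] by (intro sum.neutral ballI) (simp del: index_mult_mat)
  have "(\<Sum>i<n. \<Sum>j<n. Z $$ (i, j) * (R * Z) $$ (i, j)) = (\<Sum>j<n. col Z j \<bullet> (R *\<^sub>v col Z j))"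
    using Z Rd(1) by (subst sum.swap, intro sum.cong) (auto simp: scalar_prod_def atLeast0LessThan)
  then have cols: "(\<Sum>i<n. \<Sum>j<n. Z $$ (i, j) * (R * Z) $$ (i, j)) = (\<Sum>j<n. col Z j \<bullet> (R *\<^sub>v col Z j))" .
  have sym: "R $$ (i, j) = R $$ (j, i)" if "i < n" "j < n" for i j
    using Rd(1,2) that by (metis carrier_matD index_transpose_mat(1))
  have "(\<Sum>i<n. \<Sum>j<n. Z $$ (i, j) * (Z * R) $$ (i, j)) = (\<Sum>i<n. row Z i \<bullet> (R *\<^sub>v row Z i))"
  proof (intro sum.cong refl)
    fix i assume i: "i \<in> {..<n}"
    have "(Z * R) $$ (i, j) = (R *\<^sub>v row Z i) $ j" if "j < n" for j
      using Z Rd(1) i that sym[OF _ that]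
      by (auto simp: scalar_prod_def mult.commute intro!: sum.cong)
    then show "(\<Sum>j<n. Z $$ (i, j) * (Z * R) $$ (i, j)) = row Z i \<bullet> (R *\<^sub>v row Z i)"
      using Z Rd(1) i by (simp add: scalar_prod_def[of "row Z i" "R *\<^sub>v row Z i"] atLeast0LessThan)
  qed
  moreover have "0 \<le> row Z i \<bullet> (R *\<^sub>v row Z i)" if "i < n" for i
    using psdD(3)[OF spd_imp_psd[OF R]] Z that by auto
  ultimately have "(\<Sum>j<n. col Z j \<bullet> (R *\<^sub>v col Z j)) \<le> 0"
    using sum0 cols by (metis (no_types, lifting) add.commute le_add_same_cancel1 lessThan_iff sum_nonneg)
  moreover have nn: "0 \<le> col Z j \<bullet> (R *\<^sub>v col Z j)" if "j < n" for j
    using psdD(3)[OF spd_imp_psd[OF R]] Z that by auto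
  ultimately have "col Z j \<bullet> (R *\<^sub>v col Z j) = 0" if "j < n" for j
    using that sum_nonneg_eq_0_iff[of "{..<n}" "\<lambda>j. col Z j \<bullet> (R *\<^sub>v col Z j)"]
    by (metis (no_types, lifting) antisym finite_lessThan lessThan_iff sum_nonneg)
  then have z: "col Z j = 0\<^sub>v n" if "j < n" for j
    using Rd(3)[of "col Z j"] Z that by fastforce
  show ?thesis
  proof (rule eq_matI)
    fix i j assume "i < dim_row (R * X)" "j < dim_col (R * X)"
    then have ij: "i < n" "j < n" using X Rd by auto
    have "Z $$ (i, j) = 0" using z[OF ij(2)] ij Z by (metis carrier_matD index_col index_zero_vec(1))
    then show "(X * R) $$ (i, j) = (R * X) $$ (i, j)"
      unfolding Z_def using ij c by (simp del: index_mult_mat add: carrier_matD)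
  qed (use X Rd in auto)
qed

section \<open>Square roots of positive definite matrices\<close>

lemma transpose_smult_mat: "transpose_mat (t \<cdot>\<^sub>m A) = t \<cdot>\<^sub>m transpose_mat A"
  by (intro eq_matI) auto

lemma mat_entry_form:
  fixes A :: "real mat"
  assumes "A \<in> carrier_mat n n" "i < n" "j < n"
  shows "A $$ (i, j) = unit_vec n i \<bullet> (A *\<^sub>v unit_vec n j)"
  using assms by (subst scalar_prod_left_unit[of _ n]) auto

text \<open>Cauchy-Schwarz against q times the identity, at the pair X v and v, gives |X v|^4 <= q^2
  |X v|^2 |v|^2. Symmetry of X is what lets a bound on the form control the norm.\<close>

lemma sq_norm_mult_le:
  fixes q :: real
  assumes X: "X \<in> carrier_mat n n" "transpose_mat X = X"
    and q: "0 \<le> q" "\<And>v. v \<in> carrier_vec n \<Longrightarrow> \<bar>v \<bullet> (X *\<^sub>v v)\<bar> \<le> q * (v \<bullet> v)"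
    and v: "v \<in> carrier_vec n"
  shows "(X *\<^sub>v v) \<bullet> (X *\<^sub>v v) \<le> q\<^sup>2 * (v \<bullet> v)"
proof -
  let ?w = "X *\<^sub>v v" and ?Q = "q \<cdot>\<^sub>m (1\<^sub>m n :: real mat)"
  have w: "?w \<in> carrier_vec n" using X v by simp
  have Q: "z \<bullet> (?Q *\<^sub>v z) = q * (z \<bullet> z)" if "z \<in> carrier_vec n" for z
    using that by (simp add: form_mat_smult[of _ n])
  have "(?w \<bullet> ?w)\<^sup>2 \<le> (q * (?w \<bullet> ?w)) * (q * (v \<bullet> v))"
    using form_cauchy_schwarz[OF X, of ?Q ?w v] q w v
    by (simp add: Q transpose_smult_mat del: assoc_mult_mat_vec)
  then have "(?w \<bullet> ?w) * (?w \<bullet> ?w) \<le> (?w \<bullet> ?w) * (q\<^sup>2 * (v \<bullet> v))"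
    by (simp add: power2_eq_square mult_ac)
  moreover have "0 \<le> q\<^sup>2 * (v \<bullet> v)" using scalar_prod_self_nonneg[of v] by simp
  ultimately show ?thesis using scalar_prod_self_nonneg[of ?w]
    by (cases "?w \<bullet> ?w = 0") (auto simp: mult_le_cancel_left)
qed

text \<open>Supplies the geometric majorant that makes the entries of the binomial series converge
  absolutely when q < 1.\<close>

lemma pow_mat_entry_le:
  fixes q :: real
  assumes X: "X \<in> carrier_mat n n" "transpose_mat X = X"
    and q: "0 \<le> q" "\<And>v. v \<in> carrier_vec n \<Longrightarrow> \<bar>v \<bullet> (X *\<^sub>v v)\<bar> \<le> q * (v \<bullet> v)"
    and ij: "i < n" "j < n"
  shows "\<bar>(X ^\<^sub>m k) $$ (i, j)\<bar> \<le> q ^ k"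
proof -
  have norm: "(X ^\<^sub>m k *\<^sub>v v) \<bullet> (X ^\<^sub>m k *\<^sub>v v) \<le> (q ^ k)\<^sup>2 * (v \<bullet> v)" if "v \<in> carrier_vec n" for v
    using that
  proof (induction k arbitrary: v)
    case 0
    then show ?case using X by simp
  next
    case (Suc k)
    have Xv: "X *\<^sub>v v \<in> carrier_vec n" using X Suc.prems by simp
    have "X ^\<^sub>m Suc k *\<^sub>v v = X ^\<^sub>m k *\<^sub>v (X *\<^sub>v v)"
      using X(1) Suc.prems by (simp add: assoc_mult_mat_vec[of _ n n _ n])
    then have "(X ^\<^sub>m Suc k *\<^sub>v v) \<bullet> (X ^\<^sub>m Suc k *\<^sub>v v) \<le> (q ^ k)\<^sup>2 * ((X *\<^sub>v v) \<bullet> (X *\<^sub>v v))"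
      using Suc.IH[OF Xv] by simp
    also have "\<dots> \<le> (q ^ k)\<^sup>2 * (q\<^sup>2 * (v \<bullet> v))"
      using sq_norm_mult_le[OF X q Suc.prems] by (intro mult_left_mono) auto
    finally show ?case by (simp add: power_mult_distrib mult_ac)
  qed
  let ?u = "unit_vec n :: nat \<Rightarrow> real vec"
  have e: "(X ^\<^sub>m k) $$ (i, j) = ?u i \<bullet> (X ^\<^sub>m k *\<^sub>v ?u j)"
    using mat_entry_form[OF pow_carrier_mat[OF X(1)] ij] .
  have "((X ^\<^sub>m k) $$ (i, j))\<^sup>2 \<le> (?u i \<bullet> ?u i) * ((X ^\<^sub>m k *\<^sub>v ?u j) \<bullet> (X ^\<^sub>m k *\<^sub>v ?u j))"
    unfolding e using pow_carrier_mat[OF X(1)]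
    by (intro scalar_prod_cauchy_schwarz[of _ n] mult_mat_vec_carrier[of _ n n]) auto
  also have "\<dots> \<le> (q ^ k)\<^sup>2" using norm[of "?u j"] ij by simp
  finally show ?thesis using q(1) by (simp add: abs_le_square_iff[symmetric])
qed

section \<open>The binomial series of a matrix\<close>

lemma abs_gbinomial_le_1:
  fixes a :: real
  assumes "0 \<le> a" "a \<le> 1"
  shows "\<bar>a gchoose k\<bar> \<le> 1"
proof (induction k)
  case (Suc k)
  have "\<bar>a - real k\<bar> / real (Suc k) \<le> 1" using assms by (simp add: field_simps)
  then have "\<bar>a gchoose k\<bar> * (\<bar>a - real k\<bar> / real (Suc k)) \<le> 1 * 1"
    using Suc by (intro mult_mono) auto
  moreover have "a gchoose Suc k = (a gchoose k) * ((a - real k) / real (Suc k))"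
    by (simp add: gbinomial_prod_rev)
  ultimately show ?case by (simp add: abs_mult)
qed simp

text \<open>\<open>binomial_mat n a X\<close> is \<open>(1 - X)\<^sup>a\<close>.\<close>

definition binomial_mat :: "nat \<Rightarrow> real \<Rightarrow> real mat \<Rightarrow> real mat" where
  "binomial_mat n a X = Matrix.mat n n
     (\<lambda>(i, j). \<Sum>k. ((- 1) ^ k * (a gchoose k)) * (X ^\<^sub>m k) $$ (i, j))"

lemma binomial_mat_carrier: "binomial_mat n a X \<in> carrier_mat n n"
  by (simp add: binomial_mat_def)

lemma transpose_pow_mat:
  fixes X :: "real mat"
  assumes "X \<in> carrier_mat n n" "transpose_mat X = X"
  shows "transpose_mat (X ^\<^sub>m k) = X ^\<^sub>m k"
proof (induction k)
  case (Suc k)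
  have "transpose_mat (X ^\<^sub>m Suc k) = X * X ^\<^sub>m k"
    using transpose_mult[of "X ^\<^sub>m k" n n X n] assms Suc by simp
  also have "\<dots> = X ^\<^sub>m Suc k"
  proof (induction k)
    case (Suc k)
    have "X * X ^\<^sub>m Suc k = (X * X ^\<^sub>m k) * X"
      using assms(1) by (simp add: assoc_mult_mat[of _ n n _ n _ n])
    then show ?case using Suc by simp
  qed (use assms in auto)
  finally show ?case .
qed (use assms in auto)

lemma binomial_mat_sym:
  assumes "X \<in> carrier_mat n n" "transpose_mat X = X"
  shows "transpose_mat (binomial_mat n a X) = binomial_mat n a X"
proof (rule eq_matI)
  fix i j assume "i < dim_row (binomial_mat n a X)" "j < dim_col (binomial_mat n a X)"
  then have ij: "i < n" "j < n" by (auto simp: binomial_mat_def)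
  have "(X ^\<^sub>m k) $$ (j, i) = (X ^\<^sub>m k) $$ (i, j)" for k
    using transpose_pow_mat[OF assms, of k] ij assms(1)
    by (metis carrier_matD index_transpose_mat(1) pow_carrier_mat)
  then show "transpose_mat (binomial_mat n a X) $$ (i, j) = binomial_mat n a X $$ (i, j)"
    using ij by (simp add: binomial_mat_def)
qed (auto simp: binomial_mat_def)

lemma pow_mat_add:
  fixes X :: "real mat"
  assumes "X \<in> carrier_mat n n"
  shows "X ^\<^sub>m k * X ^\<^sub>m l = X ^\<^sub>m (k + l)"
proof (induction l)
  case (Suc l)
  have "X ^\<^sub>m k * X ^\<^sub>m Suc l = (X ^\<^sub>m k * X ^\<^sub>m l) * X"
    using assms by (simp add: assoc_mult_mat[of _ n n _ n _ n])
  then show ?case using Suc by simp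
qed (use assms in auto)

text \<open>The law of exponents for powers of 1 - X. Each entry of the product is a finite sum of
  Cauchy products of absolutely convergent series; powers of X combine, and Vandermonde's identity
  combines the coefficients. Exponents in [0, 1] keep the coefficients of both factors bounded by 1;
  convergence for a + b comes out of the product.\<close>

lemma binomial_mat_mult:
  fixes q :: real
  assumes X: "X \<in> carrier_mat n n" "transpose_mat X = X"
    and q: "0 \<le> q" "q < 1" "\<And>v. v \<in> carrier_vec n \<Longrightarrow> \<bar>v \<bullet> (X *\<^sub>v v)\<bar> \<le> q * (v \<bullet> v)"
    and ab: "0 \<le> a" "a \<le> 1" "0 \<le> b" "b \<le> 1"
  shows "binomial_mat n a X * binomial_mat n b X = binomial_mat n (a + b) X"
proof (rule eq_matI)
  fix i j assume "i < dim_row (binomial_mat n (a + b) X)" "j < dim_col (binomial_mat n (a + b) X)"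
  then have ij: "i < n" "j < n" by (auto simp: binomial_mat_def)
  define c where "c a k = (- 1) ^ k * (a gchoose k)" for a :: real and k
  have summ: "summable (\<lambda>k. norm (c a k * (X ^\<^sub>m k) $$ (i, j)))"
    if "0 \<le> a" "a \<le> 1" "i < n" "j < n" for a i j
  proof (rule summable_comparison_test'[of "\<lambda>k. q ^ k"])
    show "summable ((^) q)" using q by (simp add: summable_geometric)
    fix k
    have "\<bar>c a k\<bar> * \<bar>(X ^\<^sub>m k) $$ (i, j)\<bar> \<le> 1 * q ^ k"
      using abs_gbinomial_le_1[OF that(1,2)] pow_mat_entry_le[OF X q(1,3) that(3,4)]
      by (intro mult_mono) (auto simp: c_def abs_mult)
    then show "norm (norm (c a k * (X ^\<^sub>m k) $$ (i, j))) \<le> q ^ k" by (simp add: abs_mult)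
  qed
  have conv: "(\<Sum>k\<le>m. c a k * c b (m - k)) = c (a + b) m" for m
  proof -
    have "(\<Sum>k\<le>m. c a k * c b (m - k)) = (\<Sum>k\<le>m. (- 1) ^ m * ((a gchoose k) * (b gchoose (m - k))))"
      by (intro sum.cong) (auto simp: c_def power_add[symmetric])
    also have "\<dots> = c (a + b) m"
      by (simp add: c_def sum_distrib_left[symmetric] gbinomial_Vandermonde[symmetric] atLeast0AtMost)
    finally show ?thesis .
  qed
  have "(\<lambda>m. \<Sum>l<n. \<Sum>k\<le>m. (c a k * (X ^\<^sub>m k) $$ (i, l)) * (c b (m - k) * (X ^\<^sub>m (m - k)) $$ (l, j)))
    sums (\<Sum>l<n. (\<Sum>k. c a k * (X ^\<^sub>m k) $$ (i, l)) * (\<Sum>k. c b k * (X ^\<^sub>m k) $$ (l, j)))"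
    using ij ab by (intro sums_sum Cauchy_product_sums summ) auto
  moreover have "(\<Sum>l<n. \<Sum>k\<le>m. (c a k * (X ^\<^sub>m k) $$ (i, l)) * (c b (m - k) * (X ^\<^sub>m (m - k)) $$ (l, j)))
    = c (a + b) m * (X ^\<^sub>m m) $$ (i, j)" for m
  proof -
    have "(\<Sum>l<n. \<Sum>k\<le>m. (c a k * (X ^\<^sub>m k) $$ (i, l)) * (c b (m - k) * (X ^\<^sub>m (m - k)) $$ (l, j)))
      = (\<Sum>k\<le>m. c a k * c b (m - k) * (\<Sum>l<n. (X ^\<^sub>m k) $$ (i, l) * (X ^\<^sub>m (m - k)) $$ (l, j)))"
      by (subst sum.swap) (auto simp: sum_distrib_left mult_ac intro!: sum.cong)
    also have "\<dots> = (\<Sum>k\<le>m. c a k * c b (m - k) * (X ^\<^sub>m m) $$ (i, j))"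
    proof (intro sum.cong refl)
      fix k assume "k \<in> {..m}"
      then have "X ^\<^sub>m m = X ^\<^sub>m k * X ^\<^sub>m (m - k)" using pow_mat_add[OF X(1)] by simp
      then have "(X ^\<^sub>m m) $$ (i, j) = (\<Sum>l<n. (X ^\<^sub>m k) $$ (i, l) * (X ^\<^sub>m (m - k)) $$ (l, j))"
        using ij X(1) by (simp add: scalar_prod_def atLeast0LessThan carrier_matD)
      then show "c a k * c b (m - k) * (\<Sum>l<n. (X ^\<^sub>m k) $$ (i, l) * (X ^\<^sub>m (m - k)) $$ (l, j))
          = c a k * c b (m - k) * (X ^\<^sub>m m) $$ (i, j)" by simp
    qed
    finally show ?thesis by (simp add: sum_distrib_right[symmetric] conv)
  qed
  ultimately have "(\<Sum>l<n. (\<Sum>k. c a k * (X ^\<^sub>m k) $$ (i, l)) * (\<Sum>k. c b k * (X ^\<^sub>m k) $$ (l, j)))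
    = (\<Sum>m. c (a + b) m * (X ^\<^sub>m m) $$ (i, j))"
    by (simp add: sums_iff)
  then show "(binomial_mat n a X * binomial_mat n b X) $$ (i, j) = binomial_mat n (a + b) X $$ (i, j)"
    using ij by (simp add: binomial_mat_def scalar_prod_def atLeast0LessThan c_def)
qed (auto simp: binomial_mat_def)

lemma binomial_mat_1:
  assumes X: "X \<in> carrier_mat n n"
  shows "binomial_mat n 1 X = 1\<^sub>m n - X"
proof (rule eq_matI)
  fix i j assume "i < dim_row (1\<^sub>m n - X)" "j < dim_col (1\<^sub>m n - X)"
  then have ij: "i < n" "j < n" using X by auto
  have "(1 :: real) gchoose k = 0" if "k \<notin> {..1}" for k
    using that binomial_gbinomial[of 1 k, where ?'a = real] by (simp add: binomial_eq_0)
  then have "(\<Sum>k. ((- 1) ^ k * (1 gchoose k)) * (X ^\<^sub>m k) $$ (i, j))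
     = (\<Sum>k\<le>1. ((- 1) ^ k * (1 gchoose k)) * (X ^\<^sub>m k) $$ (i, j))"
    by (intro suminf_finite) auto
  then show "binomial_mat n 1 X $$ (i, j) = (1\<^sub>m n - X) $$ (i, j)"
    using ij X by (simp add: binomial_mat_def)
qed (use X in \<open>auto simp: binomial_mat_def\<close>)

text \<open>The fourth root shows that the square root is positive semidefinite.\<close>

lemma spd_sqrt_exists:
  assumes A: "spd n A"
  obtains R where "spd n R" "R * R = A"
proof -
  note Ad = spdD[OF A]
  obtain \<delta> where \<delta>: "\<delta> > 0" "\<And>v. v \<in> carrier_vec n \<Longrightarrow> \<delta> * (v \<bullet> v) \<le> v \<bullet> (A *\<^sub>v v)"
    using spd_coercive[OF A] by blast
  obtain K where K: "K > 0" "\<And>x. x \<in> carrier_vec n \<Longrightarrow> \<bar>x \<bullet> (A *\<^sub>v x)\<bar> \<le> K * (x \<bullet> x)"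
    using form_bounded[OF Ad(1)] by blast
  \<comment> \<open>Scaling by L turns A into L (1 - X), where the form of X lies between 0 and q =
    1 - \<delta> / L times v . v. The maximum with \<delta> ensures that q is nonnegative.\<close>
  define L where "L = max K \<delta>"
  have L: "L > 0" "K \<le> L" "\<delta> \<le> L" using K \<delta> by (auto simp: L_def)
  define X where "X = 1\<^sub>m n - (1 / L) \<cdot>\<^sub>m A"
  define q where "q = 1 - \<delta> / L"
  have X: "X \<in> carrier_mat n n" "transpose_mat X = X"
    unfolding X_def using Ad(1,2)
    by (auto simp: transpose_minus[of _ n n] transpose_smult_mat)
  have q: "0 \<le> q" "q < 1" using L \<delta> by (auto simp: q_def field_simps)
  have form: "v \<bullet> (X *\<^sub>v v) = v \<bullet> v - (v \<bullet> (A *\<^sub>v v)) / L" if v: "v \<in> carrier_vec n" for v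
    unfolding X_def using v Ad(1) by (simp add: form_mat_add[of _ n] form_mat_smult[of _ n])
  have bound: "\<bar>v \<bullet> (X *\<^sub>v v)\<bar> \<le> q * (v \<bullet> v)" if v: "v \<in> carrier_vec n" for v
  proof -
    have "v \<bullet> (A *\<^sub>v v) \<le> L * (v \<bullet> v)"
      using K(2)[OF v] mult_right_mono[OF L(2) scalar_prod_self_nonneg[of v]] by linarith
    then have "(v \<bullet> (A *\<^sub>v v)) / L \<le> v \<bullet> v" using L by (simp add: field_simps)
    moreover have "\<delta> / L * (v \<bullet> v) \<le> (v \<bullet> (A *\<^sub>v v)) / L"
      using \<delta>(2)[OF v] L by (simp add: divide_right_mono)
    ultimately show ?thesis unfolding form[OF v] q_def by (simp add: left_diff_distrib)
  qed
  define Z where "Z = binomial_mat n (1/4) X"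
  define Y where "Y = binomial_mat n (1/2) X"
  have c: "Z \<in> carrier_mat n n" "Y \<in> carrier_mat n n"
    unfolding Z_def Y_def by (auto intro: binomial_mat_carrier)
  have s: "transpose_mat Z = Z" "transpose_mat Y = Y"
    unfolding Z_def Y_def by (auto intro: binomial_mat_sym[OF X])
  have ZZ: "Z * Z = Y" unfolding Z_def Y_def
    using binomial_mat_mult[OF X q bound, of "1/4" "1/4"] by simp
  have YY: "Y * Y = (1 / L) \<cdot>\<^sub>m A"
  proof -
    have "Y * Y = 1\<^sub>m n - X" unfolding Y_def
      using binomial_mat_mult[OF X q bound, of "1/2" "1/2"] binomial_mat_1[OF X(1)] by simp
    also have "\<dots> = (1 / L) \<cdot>\<^sub>m A" unfolding X_def using Ad(1) by (intro eq_matI) auto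
    finally show ?thesis .
  qed
  have pos: "0 < v \<bullet> (Y *\<^sub>v v)" if v: "v \<in> carrier_vec n" "v \<noteq> 0\<^sub>v n" for v
  proof -
    have "v \<bullet> (Y *\<^sub>v v) = (Z *\<^sub>v v) \<bullet> (Z *\<^sub>v v)"
      unfolding ZZ[symmetric] using c v transpose_form[OF c(1) s(1) v(1), of "Z *\<^sub>v v"]
      by (simp add: assoc_mult_mat_vec[of _ n n _ n])
    moreover have "Z *\<^sub>v v \<noteq> 0\<^sub>v n"
    proof
      assume z: "Z *\<^sub>v v = 0\<^sub>v n"
      have "Y *\<^sub>v v = Z *\<^sub>v (Z *\<^sub>v v)" unfolding ZZ[symmetric] using c v by simp
      then have "Y *\<^sub>v v = 0\<^sub>v n" unfolding z using c by auto
      moreover have "(Y * Y) *\<^sub>v v = Y *\<^sub>v (Y *\<^sub>v v)" using c v by simp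
      ultimately have "(Y * Y) *\<^sub>v v = 0\<^sub>v n" using c by auto
      then have "v \<bullet> (((1 / L) \<cdot>\<^sub>m A) *\<^sub>v v) = 0" using v YY by simp
      then show False using Ad(3)[OF v] Ad(1) v L by (simp add: form_mat_smult[of _ n])
    qed
    ultimately show ?thesis using scalar_prod_self_pos[of "Z *\<^sub>v v" n] c v by simp
  qed
  define R where "R = sqrt L \<cdot>\<^sub>m Y"
  have "spd n R" unfolding spd_iff R_def
    using c s pos L by (auto simp: transpose_smult_mat form_mat_smult[of _ n])
  moreover have "R * R = A"
  proof -
    have "R * R = sqrt L \<cdot>\<^sub>m (sqrt L \<cdot>\<^sub>m (Y * Y))" unfolding R_def
      using c by (simp add: mult_smult_distrib[of _ n n] mult_smult_assoc_mat[of _ n n])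
    also have "\<dots> = A" unfolding YY using L Ad(1)
      by (intro eq_matI) (auto simp: mult.assoc[symmetric])
    finally show ?thesis .
  qed
  ultimately show ?thesis using that by blast
qed

lemma spd_sqrt:
  assumes "spd n A"
  shows "spd n (spd_sqrt A)" "spd_sqrt A * spd_sqrt A = A"
proof -
  let ?P = "\<lambda>S. S \<in> carrier_mat (dim_row A) (dim_row A) \<and> sym_pos_def S \<and> S * S = A"
  obtain R where "spd n R" "R * R = A" using spd_sqrt_exists[OF assms] by blast
  then have "?P R" using spdD(1)[OF assms] by (auto simp: spd_def)
  then have "?P (spd_sqrt A)" unfolding spd_sqrt_def by (rule someI)
  then show "spd n (spd_sqrt A)" "spd_sqrt A * spd_sqrt A = A"
    using spdD(1)[OF assms] by (auto simp: spd_def)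
qed

text \<open>A also commutes with the square root R of T, so A T = R A R is a congruence of
  A.\<close>

lemma psd_mult_spd_if_commute:
  assumes A: "psd n A" and T: "spd n T" and comm: "A * T = T * A"
  shows "psd n (A * T)"
proof -
  obtain R where R: "spd n R" "R * R = T" using spd_sqrt_exists[OF T] by blast
  note Ad = psdD[OF A] and Rd = spdD[OF R(1)]
  have AR: "A * R = R * A"
    using commute_sqrt_if_commute[OF R(1) Ad(1)] comm R(2) by simp
  have AT: "A * T = R * (A * R)"
  proof -
    have "A * T = (A * R) * R" using Ad(1) Rd(1) unfolding R(2)[symmetric] by simp
    also have "\<dots> = R * (A * R)" unfolding AR using Ad(1) Rd(1) AR by simp
    finally show ?thesis .
  qed
  have "0 \<le> v \<bullet> ((A * T) *\<^sub>v v)" if v: "v \<in> carrier_vec n" for v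
  proof -
    have "(A * T) *\<^sub>v v = R *\<^sub>v (A *\<^sub>v (R *\<^sub>v v))"
      unfolding AT using Ad(1) Rd(1) v by (simp add: assoc_mult_mat_vec[of _ n n _ n])
    then have "v \<bullet> ((A * T) *\<^sub>v v) = (R *\<^sub>v v) \<bullet> (A *\<^sub>v (R *\<^sub>v v))"
      using transpose_form[OF Rd(1,2) v, of "A *\<^sub>v (R *\<^sub>v v)"] Ad(1) Rd(1) v by simp
    then show ?thesis using Ad(3) Rd(1) v by simp
  qed
  moreover have "transpose_mat (A * T) = A * T"
    using transpose_mult[of A n n T n] Ad spdD[OF T] comm by simp
  ultimately show ?thesis using Ad spdD(1)[OF T] by (auto simp: psd_def)
qed

section \<open>Diagonal dominance\<close>

lemma sym_matI:
  assumes "A \<in> carrier_mat n n" "\<And>i j. i < n \<Longrightarrow> j < n \<Longrightarrow> A $$ (i, j) = A $$ (j, i)"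
  shows "transpose_mat A = A"
  using assms by (intro eq_matI) auto

text \<open>Gershgorin's estimate at the level of forms: an off-diagonal term is at least -|A_ij|
  (x_i^2 + x_j^2) / 2, and by symmetry of A the half attached to x_j can be collected in row
  j.\<close>

lemma form_ge_diag_dominant:
  fixes A :: "real mat"
  assumes A: "A \<in> carrier_mat n n" "transpose_mat A = A" and x: "x \<in> carrier_vec n"
  shows "(\<Sum>i<n. (A $$ (i, i) - (\<Sum>j\<in>{..<n} - {i}. \<bar>A $$ (i, j)\<bar>)) * (x $ i)\<^sup>2) \<le> x \<bullet> (A *\<^sub>v x)"
proof -
  define d where "d i j = (if i = j then 0 else \<bar>A $$ (i, j)\<bar>)" for i j
  have dsym: "d i j = d j i" if "i < n" "j < n" for i j
    using A that unfolding d_def by (metis carrier_matD index_transpose_mat(1))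
  have dsum: "(\<Sum>j\<in>{..<n} - {i}. \<bar>A $$ (i, j)\<bar>) = (\<Sum>j<n. d i j)" if "i < n" for i
    using that by (simp add: d_def sum.remove[of "{..<n}" i])
  have swap: "(\<Sum>i<n. \<Sum>j<n. d i j * (x $ j)\<^sup>2) = (\<Sum>i<n. \<Sum>j<n. d i j * (x $ i)\<^sup>2)"
    by (subst sum.swap) (auto intro!: sum.cong simp: dsym)
  have "(\<Sum>i<n. (A $$ (i, i) - (\<Sum>j\<in>{..<n} - {i}. \<bar>A $$ (i, j)\<bar>)) * (x $ i)\<^sup>2)
      = (\<Sum>i<n. A $$ (i, i) * (x $ i)\<^sup>2) - (\<Sum>i<n. \<Sum>j<n. d i j * (x $ i)\<^sup>2)"
    by (simp add: dsum left_diff_distrib sum_subtractf sum_distrib_right)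
  also have "\<dots> = (\<Sum>i<n. \<Sum>j<n. (if i = j then A $$ (i, i) * (x $ i)\<^sup>2 else 0))
      - ((\<Sum>i<n. \<Sum>j<n. d i j * (x $ i)\<^sup>2) + (\<Sum>i<n. \<Sum>j<n. d i j * (x $ j)\<^sup>2)) / 2"
    unfolding swap by simp
  also have "\<dots> = (\<Sum>i<n. \<Sum>j<n. (if i = j then A $$ (i, i) * (x $ i)\<^sup>2 else 0)
      - (d i j * (x $ i)\<^sup>2 + d i j * (x $ j)\<^sup>2) / 2)"
    by (simp add: sum_subtractf sum.distrib sum_divide_distrib add_divide_distrib)
  also have "\<dots> \<le> (\<Sum>i<n. \<Sum>j<n. A $$ (i, j) * x $ i * x $ j)"
  proof (intro sum_mono)
    fix i j
    have "0 \<le> (\<bar>x $ i\<bar> - \<bar>x $ j\<bar>)\<^sup>2" by simp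
    then have "\<bar>x $ i * x $ j\<bar> \<le> ((x $ i)\<^sup>2 + (x $ j)\<^sup>2) / 2"
      by (simp add: power2_diff abs_mult)
    then have "\<bar>A $$ (i, j)\<bar> * \<bar>x $ i * x $ j\<bar> \<le> \<bar>A $$ (i, j)\<bar> * (((x $ i)\<^sup>2 + (x $ j)\<^sup>2) / 2)"
      by (rule mult_left_mono) simp
    moreover have "- (\<bar>A $$ (i, j)\<bar> * \<bar>x $ i * x $ j\<bar>) \<le> A $$ (i, j) * x $ i * x $ j"
      by (metis abs_ge_minus_self abs_mult minus_le_iff mult.assoc)
    ultimately show "(if i = j then A $$ (i, i) * (x $ i)\<^sup>2 else 0)
        - (d i j * (x $ i)\<^sup>2 + d i j * (x $ j)\<^sup>2) / 2 \<le> A $$ (i, j) * x $ i * x $ j"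
      by (auto simp: d_def power2_eq_square distrib_left field_simps)
  qed
  also have "\<dots> = x \<bullet> (A *\<^sub>v x)" using form_sum[OF A(1) x x] by simp
  finally show ?thesis .
qed

lemma diag_dominant_psd:
  fixes A :: "real mat"
  assumes A: "A \<in> carrier_mat n n" "transpose_mat A = A"
    and dom: "\<And>i. i < n \<Longrightarrow> (\<Sum>j\<in>{..<n} - {i}. \<bar>A $$ (i, j)\<bar>) \<le> A $$ (i, i)"
  shows "psd n A"
proof -
  have "0 \<le> x \<bullet> (A *\<^sub>v x)" if "x \<in> carrier_vec n" for x
    using dom by (intro order_trans[OF _ form_ge_diag_dominant[OF A that]] sum_nonneg) simp
  then show ?thesis using A by (auto simp: psd_def)
qed

lemma diag_dominant_spd:
  fixes A :: "real mat"
  assumes A: "A \<in> carrier_mat n n" "transpose_mat A = A"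
    and dom: "\<And>i. i < n \<Longrightarrow> (\<Sum>j\<in>{..<n} - {i}. \<bar>A $$ (i, j)\<bar>) < A $$ (i, i)"
  shows "spd n A"
proof -
  have "0 < x \<bullet> (A *\<^sub>v x)" if x: "x \<in> carrier_vec n" "x \<noteq> 0\<^sub>v n" for x
  proof -
    obtain i where i: "i < n" "x $ i \<noteq> 0" using x by (metis carrier_vecD eq_vecI index_zero_vec)
    have "0 < (\<Sum>i<n. (A $$ (i, i) - (\<Sum>j\<in>{..<n} - {i}. \<bar>A $$ (i, j)\<bar>)) * (x $ i)\<^sup>2)"
      using i dom by (intro sum_pos2[of _ i]) (auto simp: less_imp_le)
    then show ?thesis using form_ge_diag_dominant[OF A x(1)] by linarith
  qed
  then show ?thesis using A by (auto simp: spd_iff)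
qed

section \<open>The Toeplitz matrix and its tau matrix\<close>

text \<open>\<open>hankel_coef a n s\<close> is the entry of the Hankel correction on the antidiagonal where the
  1-based row and column numbers add up to \<open>s\<close>.\<close>

definition hankel_coef :: "real \<Rightarrow> nat \<Rightarrow> nat \<Rightarrow> real" where
  "hankel_coef a n s = (if s + 1 \<le> n then s_coef a s else if s \<le> n + 2 then 0
     else s_coef a (2 * n + 2 - s))"

lemma hankel_entry:
  assumes "i < n" "j < n"
  shows "tau_hankel (sym_toeplitz n (s_coef a)) $$ (i, j) = hankel_coef a n (i + j + 2)"
proof -
  have col: "sym_toeplitz n (s_coef a) $$ (k, 0) = s_coef a k" if "k < n" for k
    using that by (simp add: sym_toeplitz_def del: s_coef.simps)
  have dim: "dim_row (sym_toeplitz n (s_coef a)) = n" by (simp add: sym_toeplitz_def)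
  have "i + 1 + (j + 1) = i + j + 2" by simp
  then show ?thesis using assms
    by (simp add: tau_hankel_def hankel_coef_def Let_def dim col del: s_coef.simps)
qed

lemma toeplitz_entry:
  assumes "i < n" "j < n"
  shows "sym_toeplitz n (s_coef a) $$ (i, j) = s_coef a (nat \<bar>int i - int j\<bar>)"
  using assms by (simp add: sym_toeplitz_def)

lemma toeplitz_carrier:
  "sym_toeplitz n t \<in> carrier_mat n n" "tau_hankel (sym_toeplitz n t) \<in> carrier_mat n n"
  by (auto simp: sym_toeplitz_def tau_hankel_def Let_def)

text \<open>F is indexed by 1-based positions. Its zero boundary values at 0 and n + 1 let the
  three-term formula hold in the first and the last row as well.\<close>

lemma tridiag_sum:
  fixes F :: "nat \<Rightarrow> real"
  assumes "i < n" "F 0 = 0" "F (n + 1) = 0"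
  shows "(\<Sum>k<n. tridiag n b e b $$ (i, k) * F (k + 1)) = b * F i + e * F (i + 1) + b * F (i + 2)"
proof -
  have "(\<Sum>k<n. tridiag n b e b $$ (i, k) * F (k + 1)) =
     (\<Sum>k<n. (if Suc k = i then b * F i else 0) + (if k = i then e * F (i + 1) else 0)
       + (if k = i + 1 then b * F (i + 2) else 0))"
    using assms(1) by (intro sum.cong) (auto simp: tridiag_def)
  also have "\<dots> = (\<Sum>k<n. (if Suc k = i then b * F i else 0)) + e * F (i + 1) +
      (if i + 1 < n then b * F (i + 2) else 0)"
    using assms(1) by (simp add: sum.distrib)
  also have "(\<Sum>k<n. (if Suc k = i then b * F i else 0)) = b * F i"
    using assms(1,2) by (cases i) auto
  also have "(if i + 1 < n then b * F (i + 2) else 0) = b * F (i + 2)"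
    using assms(1,3) by (auto simp: not_less dest: le_antisym)
  finally show ?thesis .
qed

context
  fixes a :: real
  assumes a: "1 < a" "a < 2"
begin

lemma s_coef_0_pos: "0 < s_coef a 0"
  using a Gamma_real_pos[of "a + 1"] Gamma_real_pos[of "a / 2 + 1"]
  by (simp add: zero_less_divide_iff less_imp_neq[symmetric])

text \<open>The k-th factor of the recurrence is (2 k - 2 - a) / (2 k + a): negative for k = 1 and
  positive for every k >= 2 because a < 2. So the sign changes once, after the positive zeroth
  coefficient.\<close>

lemma s_coef_neg: "s_coef a (Suc k) < 0"
proof (induction k)
  case 0
  have "1 - (a + 1) / (a / 2 + 1) < 0" using a by (simp add: field_simps)
  then have "(1 - (a + 1) / (a / 2 + 1)) * s_coef a 0 < 0"
    using s_coef_0_pos by (rule mult_neg_pos)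
  then show ?case by (simp del: s_coef.simps(1))
next
  case (Suc k)
  have "0 < 1 - (a + 1) / (a / 2 + real (Suc (Suc k)))" using a by (simp add: field_simps)
  then show ?case using Suc by (simp only: s_coef.simps(2)[of a "Suc k"] mult_pos_neg)
qed

lemma s_coef_Suc_mono: "s_coef a (Suc k) \<le> s_coef a (Suc (Suc k))"
proof -
  have "1 - (a + 1) / (a / 2 + real (Suc (Suc k))) \<le> 1" using a by (simp add: field_simps)
  then have "1 * s_coef a (Suc k) \<le> s_coef a (Suc (Suc k))"
    unfolding s_coef.simps(2)[of a "Suc k"] using s_coef_neg[of k]
    by (intro mult_right_mono_neg) auto
  then show ?thesis by simp
qed

lemma s_coef_mono: "1 \<le> j \<Longrightarrow> j \<le> k \<Longrightarrow> s_coef a j \<le> s_coef a k"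
proof (induction k)
  case (Suc k)
  show ?case
  proof (cases "j = Suc k")
    case False
    then have "s_coef a j \<le> s_coef a k" "k = Suc (k - 1)" using Suc by auto
    then show ?thesis using s_coef_Suc_mono[of "k - 1"] by (metis order_trans)
  qed simp
qed simp

text \<open>The symbol of the infinite Toeplitz matrix vanishes at the origin, so its partial sums have
  the closed form below.\<close>

lemma s_coef_sum:
  "s_coef a 0 + 2 * (\<Sum>k=1..n. s_coef a k) = - s_coef a n * (2 * real n - a) / a"
proof (induction n)
  case 0
  then show ?case using a by simp
next
  case (Suc n)
  have nz: "a + 2 * real n + 2 \<noteq> 0" using a by auto
  have "s_coef a (Suc n) = (2 * real n - a) / (a + 2 * real n + 2) * s_coef a n"
    using nz a by (simp add: field_simps)
  then have "s_coef a n * (2 * real n - a) = s_coef a (Suc n) * (a + 2 * real n + 2)"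
    using nz by (simp add: field_simps del: s_coef.simps)
  then have "s_coef a 0 + 2 * (\<Sum>k=1..Suc n. s_coef a k)
      = - (s_coef a (Suc n) * (a + 2 * real n + 2)) / a + 2 * s_coef a (Suc n)"
    using Suc by (simp add: algebra_simps del: s_coef.simps)
  also have "\<dots> = - s_coef a (Suc n) * (2 * real (Suc n) - a) / a"
    using a by (simp add: field_simps del: s_coef.simps)
  finally show ?case .
qed

text \<open>For n >= 1 the closed form is positive because s_n < 0 and 2 n > a. This is the source
  of strictness in the diagonal dominance below.\<close>

lemma s_coef_sum_pos: "0 < s_coef a 0 + 2 * (\<Sum>k=1..n. s_coef a k)"
proof (cases n)
  case 0
  then show ?thesis using s_coef_0_pos by simp
next
  case (Suc k)
  have "0 < - s_coef a n * (2 * real n - a)"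
    using s_coef_neg[of k] a Suc by (intro mult_pos_pos) auto
  then show ?thesis unfolding s_coef_sum using a by (intro divide_pos_pos) auto
qed

text \<open>Both i + j + 2 and its mirror image 2 n - i - j exceed |i - j|, and from index 1 on the
  coefficients are negative and nondecreasing. As the Hankel entries are nonpositive too, off the
  diagonal they are at most as large in modulus as the Toeplitz entries.\<close>

lemma toeplitz_le_hankel_coef:
  assumes "i < n" "j < n" "i \<noteq> j"
  shows "s_coef a (nat \<bar>int i - int j\<bar>) \<le> hankel_coef a n (i + j + 2)"
proof -
  have neg: "s_coef a k \<le> 0" if "1 \<le> k" for k
    using s_coef_neg[of "k - 1"] that by (simp del: s_coef.simps)
  have "1 \<le> nat \<bar>int i - int j\<bar>" using assms by linarith
  then show "s_coef a (nat \<bar>int i - int j\<bar>) \<le> hankel_coef a n (i + j + 2)"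
    using assms neg unfolding hankel_coef_def
    by (auto simp del: s_coef.simps intro!: s_coef_mono)
qed

lemma hankel_coef_nonpos:
  assumes "i < n" "j < n"
  shows "hankel_coef a n (i + j + 2) \<le> 0"
proof -
  have "s_coef a k \<le> 0" if "1 \<le> k" for k
    using s_coef_neg[of "k - 1"] that by (simp del: s_coef.simps)
  then show ?thesis using assms unfolding hankel_coef_def by (auto simp del: s_coef.simps)
qed

text \<open>In moduli, the Toeplitz row runs over the index ranges 1..i and 1..n-1-i, the Hankel row
  over i+2..n-1 and n+1-i..n-1. Paired in this order they form two disjoint unions inside 1..n-1, so
  the total is at most twice the sum over 1..n-1, which is less than s_0. Note that the Hankel sum
  includes the diagonal position j = i.\<close>

lemma toeplitz_hankel_row_sum:
  assumes i: "i < n"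
  shows "(\<Sum>j\<in>{..<n} - {i}. - s_coef a (nat \<bar>int i - int j\<bar>)) +
    (\<Sum>j<n. - hankel_coef a n (i + j + 2)) < s_coef a 0"
proof -
  define t where "t k = - s_coef a k" for k
  have t: "0 \<le> t k" if "1 \<le> k" for k
    using s_coef_neg[of "k - 1"] that by (simp add: t_def del: s_coef.simps)
  have left: "(\<Sum>j\<in>{..<i}. t (nat \<bar>int i - int j\<bar>)) = sum t {1..i}"
    by (rule sum.reindex_bij_witness[of _ "\<lambda>k. i - k" "\<lambda>j. i - j"])
      (auto simp: nat_diff_distrib)
  have right: "(\<Sum>j\<in>{i<..<n}. t (nat \<bar>int i - int j\<bar>)) = sum t {1..n - 1 - i}"
    by (rule sum.reindex_bij_witness[of _ "\<lambda>k. i + k" "\<lambda>j. j - i"])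
      (auto simp: nat_diff_distrib)
  have up: "(\<Sum>j | j < n \<and> i + j + 3 \<le> n. t (i + j + 2)) = sum t {i + 2..n - 1}"
    by (rule sum.reindex_bij_witness[of _ "\<lambda>k. k - i - 2" "\<lambda>j. i + j + 2"]) auto
  have down: "(\<Sum>j | j < n \<and> n + 1 \<le> i + j. t (2 * n - i - j)) = sum t {n + 1 - i..n - 1}"
    using i by (intro sum.reindex_bij_witness[of _ "\<lambda>k. 2 * n - i - k" "\<lambda>j. 2 * n - i - j"]) auto
  have "(\<Sum>j<n. - hankel_coef a n (i + j + 2)) =
      (\<Sum>j<n. (if i + j + 3 \<le> n then t (i + j + 2) else 0) + (if n + 1 \<le> i + j then t (2 * n - i - j) else 0))"
    by (intro sum.cong) (auto simp: hankel_coef_def t_def simp del: s_coef.simps)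
  also have "\<dots> = sum t {i + 2..n - 1} + sum t {n + 1 - i..n - 1}"
    unfolding up[symmetric] down[symmetric]
    by (simp add: sum.distrib sum.If_cases Int_def)
  finally have hankel: "(\<Sum>j<n. - hankel_coef a n (i + j + 2))
      = sum t {i + 2..n - 1} + sum t {n + 1 - i..n - 1}" .
  have "{..<n} - {i} = {..<i} \<union> {i<..<n}" using i by auto
  then have toeplitz: "(\<Sum>j\<in>{..<n} - {i}. t (nat \<bar>int i - int j\<bar>)) = sum t {1..i} + sum t {1..n - 1 - i}"
    using sum.union_disjoint[of "{..<i}" "{i<..<n}" "\<lambda>j. t (nat \<bar>int i - int j\<bar>)"]
    unfolding left right by fastforce
  have "sum t {1..i} + sum t {i + 2..n - 1} = sum t ({1..i} \<union> {i + 2..n - 1})"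
    by (rule sum.union_disjoint[symmetric]) auto
  also have "\<dots> \<le> sum t {1..n - 1}" using i t by (intro sum_mono2) auto
  finally have 1: "sum t {1..i} + sum t {i + 2..n - 1} \<le> sum t {1..n - 1}" .
  have "sum t {1..n - 1 - i} + sum t {n + 1 - i..n - 1} = sum t ({1..n - 1 - i} \<union> {n + 1 - i..n - 1})"
    by (rule sum.union_disjoint[symmetric]) auto
  also have "\<dots> \<le> sum t {1..n - 1}" using i t by (intro sum_mono2) auto
  finally have 2: "sum t {1..n - 1 - i} + sum t {n + 1 - i..n - 1} \<le> sum t {1..n - 1}" .
  have "sum t {1..n - 1} = - (\<Sum>k=1..n - 1. s_coef a k)" by (simp add: t_def sum_negf)
  then have "2 * sum t {1..n - 1} < s_coef a 0" using s_coef_sum_pos[of "n - 1"] by linarith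
  then show ?thesis using 1 2 toeplitz hankel by (simp add: t_def del: s_coef.simps)
qed

text \<open>With \<open>S\<close> the Toeplitz matrix and \<open>H\<close> its Hankel correction, \<open>c = - 1\<close> gives \<open>\<tau>(S)\<close>, and
  \<open>c = 1\<close>, \<open>c = - 3\<close> give \<open>\<tau>(S) + 2 H\<close>, \<open>\<tau>(S) - 2 H\<close>.\<close>

lemma toeplitz_hankel_spd:
  assumes c: "- 3 \<le> c" "c \<le> 1"
  shows "spd n (sym_toeplitz n (s_coef a) + c \<cdot>\<^sub>m tau_hankel (sym_toeplitz n (s_coef a)))"
    (is "spd n ?A")
proof (rule diag_dominant_spd)
  show car: "?A \<in> carrier_mat n n" using toeplitz_carrier by auto
  have entry: "?A $$ (i, j) = s_coef a (nat \<bar>int i - int j\<bar>) + c * hankel_coef a n (i + j + 2)"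
    if "i < n" "j < n" for i j
    using toeplitz_entry[OF that] hankel_entry[OF that] that
    by (simp add: carrier_matD[OF toeplitz_carrier(1)] carrier_matD[OF toeplitz_carrier(2)])
  show "transpose_mat ?A = ?A"
    by (rule sym_matI[OF car]) (simp only: entry abs_minus_commute add.commute[of _ "_ :: nat"])
  fix i assume i: "i < n"
  define t where "t j = - s_coef a (nat \<bar>int i - int j\<bar>)" for j
  define h where "h j = - hankel_coef a n (i + j + 2)" for j
  have h: "0 \<le> h j" if "j < n" for j using hankel_coef_nonpos[OF i that] by (simp add: h_def)
  have off: "\<bar>?A $$ (i, j)\<bar> \<le> t j + h j" if j: "j < n" "j \<noteq> i" for j
  proof -
    \<comment> \<open>This permits c down to -3: the estimate -(t + c h) <= 3 h - t <= t + h
      requires h <= t.\<close>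
    have ht: "h j \<le> t j" using toeplitz_le_hankel_coef[OF i j(1)] j(2) by (auto simp: h_def t_def)
    have "c * h j \<le> 1 * h j" "- 3 * h j \<le> c * h j"
      using mult_right_mono[OF c(2) h[OF j(1)]] mult_right_mono[OF c(1) h[OF j(1)]] by simp_all
    moreover have "?A $$ (i, j) = - (t j + c * h j)" using entry[OF i j(1)] by (simp add: t_def h_def)
    ultimately show ?thesis using ht h[OF j(1)] by (simp add: abs_le_iff)
  qed
  have "(\<Sum>j\<in>{..<n} - {i}. \<bar>?A $$ (i, j)\<bar>) \<le> (\<Sum>j\<in>{..<n} - {i}. t j + h j)"
    using off by (intro sum_mono) auto
  \<comment> \<open>The row-sum estimate counts the Hankel entry at j = i. Splitting it off leaves
    s_0 - h_i, exactly what the diagonal entry s_0 - c h_i still dominates for c <= 1.\<close>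
  also have "\<dots> = (\<Sum>j\<in>{..<n} - {i}. t j) + (\<Sum>j<n. h j) - h i"
    using i by (simp add: sum.distrib sum.remove[of "{..<n}" i])
  also have "\<dots> < s_coef a 0 - h i"
    using toeplitz_hankel_row_sum[OF i] by (simp add: t_def h_def)
  also have "\<dots> \<le> ?A $$ (i, i)"
  proof -
    have "c * h i \<le> 1 * h i" using c h[OF i] by (intro mult_right_mono) auto
    then show ?thesis using entry[OF i i] by (simp add: h_def)
  qed
  finally show "(\<Sum>j\<in>{..<n} - {i}. \<bar>?A $$ (i, j)\<bar>) < ?A $$ (i, i)" .
qed

text \<open>Extending the entries of a tau matrix by zero rows and columns preserves the formula
  \<open>g \<bar>i - j\<bar> - g (i + j)\<close>, because \<open>g\<close> is symmetric about \<open>n + 1\<close>.\<close>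

lemma tau_tridiag_commute:
  "tau_mat (sym_toeplitz n (s_coef a)) * tridiag n b e b = tridiag n b e b * tau_mat (sym_toeplitz n (s_coef a))"
    (is "?T * ?W = ?W * ?T")
proof (rule eq_matI)
  have T: "?T \<in> carrier_mat n n" unfolding tau_mat_def by (intro minus_carrier_mat toeplitz_carrier)
  have W: "?W \<in> carrier_mat n n" by (simp add: tridiag_def)
  show "dim_row (?T * ?W) = dim_row (?W * ?T)" "dim_col (?T * ?W) = dim_col (?W * ?T)"
    using T W by auto
  fix i j assume "i < dim_row (?W * ?T)" "j < dim_col (?W * ?T)"
  then have ij: "i < n" "j < n" using T W by auto
  define p where "p i j = hankel_coef a n (nat \<bar>int i - int j\<bar>) - hankel_coef a n (i + j)" for i j
  have psym: "p i j = p j i" for i j by (simp add: p_def abs_minus_commute add.commute)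
  have p0: "p 0 j = 0" for j by (simp add: p_def)
  \<comment> \<open>The two arguments n - j and n + j + 2 are mirror images with respect to n +
    1.\<close>
  have pn: "p (n + 1) (j + 1) = 0" if "j < n" for j
  proof -
    have "nat \<bar>int (n + 1) - int (j + 1)\<bar> = n - j" using that by linarith
    then show ?thesis using that unfolding p_def hankel_coef_def
      by (auto simp del: s_coef.simps)
  qed
  have Tp: "?T $$ (i, j) = p (i + 1) (j + 1)" if "i < n" "j < n" for i j
  proof -
    have "nat \<bar>int i - int j\<bar> + 1 \<le> n" using that by linarith
    then have "hankel_coef a n (nat \<bar>int i - int j\<bar>) = s_coef a (nat \<bar>int i - int j\<bar>)"
      by (simp add: hankel_coef_def del: s_coef.simps)
    then show ?thesis
      using toeplitz_entry[OF that] hankel_entry[OF that] that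
      by (simp add: carrier_matD[OF toeplitz_carrier(1)] carrier_matD[OF toeplitz_carrier(2)]
          p_def tau_mat_def add_ac del: s_coef.simps)
  qed
  have Wsym: "?W $$ (k, j) = ?W $$ (j, k)" if "k < n" for k using that ij by (simp add: tridiag_def)
  have "(?W * ?T) $$ (i, j) = (\<Sum>k<n. ?W $$ (i, k) * p (k + 1) (j + 1))"
    using T W ij by (simp add: scalar_prod_def atLeast0LessThan Tp)
  also have "\<dots> = b * p i (j + 1) + e * p (i + 1) (j + 1) + b * p (i + 2) (j + 1)"
    using ij by (intro tridiag_sum) (auto simp: p0 pn[simplified])
  finally have WT: "(?W * ?T) $$ (i, j) = b * p i (j + 1) + e * p (i + 1) (j + 1) + b * p (i + 2) (j + 1)" .
  have "(?T * ?W) $$ (i, j) = (\<Sum>k<n. ?W $$ (j, k) * p (k + 1) (i + 1))"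
    using T W ij by (simp add: scalar_prod_def atLeast0LessThan Tp Wsym psym[of "Suc i"] mult.commute)
  also have "\<dots> = b * p j (i + 1) + e * p (j + 1) (i + 1) + b * p (j + 2) (i + 1)"
    using ij by (intro tridiag_sum) (auto simp: p0 pn[simplified])
  finally have TW: "(?T * ?W) $$ (i, j) = b * p j (i + 1) + e * p (j + 1) (i + 1) + b * p (j + 2) (i + 1)" .
  \<comment> \<open>The sums of the indices agree term by term, whereas their absolute differences
    agree crosswise.\<close>
  have "p i (j + 1) + p (i + 2) (j + 1) = p j (i + 1) + p (j + 2) (i + 1)"
  proof -
    have "nat \<bar>int i - int (j + 1)\<bar> = nat \<bar>int (j + 2) - int (i + 1)\<bar>"
      "nat \<bar>int (i + 2) - int (j + 1)\<bar> = nat \<bar>int j - int (i + 1)\<bar>" by linarith+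
    then show ?thesis by (simp add: p_def add_ac)
  qed
  then have "b * (p i (j + 1) + p (i + 2) (j + 1)) = b * (p j (i + 1) + p (j + 2) (i + 1))" by simp
  then show "(?T * ?W) $$ (i, j) = (?W * ?T) $$ (i, j)"
    unfolding TW WT psym[of "j + 1" "i + 1"] distrib_left by linarith
qed

end

section \<open>Positivity of symmetric tridiagonal Toeplitz matrices\<close>

lemma tridiag_carrier: "tridiag n b e b' \<in> carrier_mat n n"
  by (simp add: tridiag_def)

lemma tridiag_sym: "transpose_mat (tridiag n b e b) = tridiag n b e b"
  by (rule sym_matI[OF tridiag_carrier]) (auto simp: tridiag_def)

lemma tridiag_off_diag_sum:
  assumes "i < n"
  shows "(\<Sum>j\<in>{..<n} - {i}. \<bar>tridiag n b e b $$ (i, j)\<bar>) \<le> 2 * \<bar>b\<bar>"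
proof -
  have "(\<Sum>j\<in>{..<n} - {i}. \<bar>tridiag n b e b $$ (i, j)\<bar>)
      \<le> (\<Sum>j\<in>{..<n} - {i}. (if Suc j = i then \<bar>b\<bar> else 0) + (if j = Suc i then \<bar>b\<bar> else 0))"
    using assms by (intro sum_mono) (auto simp: tridiag_def)
  also have "\<dots> \<le> (\<Sum>j<n. (if Suc j = i then \<bar>b\<bar> else 0) + (if j = Suc i then \<bar>b\<bar> else 0))"
    by (intro sum_mono2) auto
  also have "\<dots> \<le> 2 * \<bar>b\<bar>" by (cases i) (auto simp: sum.distrib)
  finally show ?thesis .
qed

lemma tridiag_psd:
  assumes "2 * \<bar>b\<bar> \<le> e"
  shows "psd n (tridiag n b e b)"
proof (rule diag_dominant_psd[OF tridiag_carrier tridiag_sym])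
  fix i assume i: "i < n"
  then have "tridiag n b e b $$ (i, i) = e" by (simp add: tridiag_def)
  then show "(\<Sum>j\<in>{..<n} - {i}. \<bar>tridiag n b e b $$ (i, j)\<bar>) \<le> tridiag n b e b $$ (i, i)"
    using tridiag_off_diag_sum[OF i, of b e] assms by linarith
qed

lemma tridiag_spd:
  assumes "2 * \<bar>b\<bar> < e"
  shows "spd n (tridiag n b e b)"
proof (rule diag_dominant_spd[OF tridiag_carrier tridiag_sym])
  fix i assume i: "i < n"
  then have "tridiag n b e b $$ (i, i) = e" by (simp add: tridiag_def)
  then show "(\<Sum>j\<in>{..<n} - {i}. \<bar>tridiag n b e b $$ (i, j)\<bar>) < tridiag n b e b $$ (i, i)"
    using tridiag_off_diag_sum[OF i, of b e] assms by linarith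
qed

section \<open>Comparison of the one-dimensional operators\<close>

text \<open>Here \<open>C\<close> stands for the inverse of a matrix between \<open>2/3\<close> and \<open>1\<close> commuting with \<open>T\<close>, and
  \<open>H\<close> for a perturbation of \<open>T\<close> dominated by \<open>T / 2\<close>. All conditions are stated as positivity of
  matrices, since in this form they carry over to Kronecker products.\<close>

definition perturbed :: "nat \<Rightarrow> real mat \<Rightarrow> real mat \<Rightarrow> real mat \<Rightarrow> bool" where
  "perturbed n C T H \<longleftrightarrow>
     C \<in> carrier_mat n n \<and> transpose_mat C = C \<and> H \<in> carrier_mat n n \<and> transpose_mat H = H \<and>
     psd n T \<and> psd n (T + 2 \<cdot>\<^sub>m H) \<and> psd n (T - 2 \<cdot>\<^sub>m H) \<and> psd n (C * T - T) \<and>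
     psd n ((3 / 2) \<cdot>\<^sub>m (C * T) - C * (T * C))"

text \<open>C T is the sum of the positive semidefinite matrices C T - T and T. Its symmetry, that
  is, the commutation of C and T, is encoded in \<open>psd n (C * T - T)\<close>.\<close>

lemma perturbed_psd:
  assumes "perturbed n C T H"
  shows "psd n (C * T)"
proof -
  have T: "psd n T" and CT: "psd n (C * T - T)" and C: "C \<in> carrier_mat n n"
    using assms by (auto simp: perturbed_def)
  have c: "C * T \<in> carrier_mat n n" using C psdD(1)[OF T] by simp
  have "K = (K - T) + T" if "K \<in> carrier_mat n n" for K
    using that psdD(1)[OF T] by (intro eq_matI) auto
  from this[OF c]
  have "transpose_mat (C * T) = C * T"
    using transpose_add[OF psdD(1)[OF CT] psdD(1)[OF T]] psdD(2)[OF CT] psdD(2)[OF T] by argo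
  moreover have "0 \<le> v \<bullet> (C * T *\<^sub>v v)" if v: "v \<in> carrier_vec n" for v
    using psdD(3)[OF CT v] psdD(3)[OF T v] form_mat_add(2)[OF c psdD(1)[OF T] v v] by simp
  ultimately show ?thesis using c by (auto simp: psd_def)
qed

text \<open>Moving C to the left vector gives x . C H y = (C x) . H y, and 2 H is dominated by T, so
  Cauchy-Schwarz bounds 4 times the square by (C x . T C x) (y . T y). The first factor is at most
  3/2 (x . C T x), the second at most y . C T y, and 1/4 * 3/2 = 3/8.\<close>

lemma perturbed_form_le:
  assumes p: "perturbed n C T H" and x: "x \<in> carrier_vec n" and y: "y \<in> carrier_vec n"
  shows "(x \<bullet> (C * H *\<^sub>v y))\<^sup>2 \<le> 3 / 8 * ((x \<bullet> (C * T *\<^sub>v x)) * (y \<bullet> (C * T *\<^sub>v y)))"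
proof -
  have C: "C \<in> carrier_mat n n" "transpose_mat C = C" and H: "H \<in> carrier_mat n n" "transpose_mat H = H"
    and T: "psd n T" and plus: "psd n (T + 2 \<cdot>\<^sub>m H)" and minus: "psd n (T - 2 \<cdot>\<^sub>m H)"
    and lower: "psd n (C * T - T)" and upper: "psd n ((3 / 2) \<cdot>\<^sub>m (C * T) - C * (T * C))"
    using p by (auto simp: perturbed_def)
  note Tc = psdD(1)[OF T]
  have H2: "2 \<cdot>\<^sub>m H \<in> carrier_mat n n" "transpose_mat (2 \<cdot>\<^sub>m H) = 2 \<cdot>\<^sub>m H"
    using H by (auto simp: transpose_smult_mat)
  have CT: "C * T \<in> carrier_mat n n" "C * (T * C) \<in> carrier_mat n n" using C Tc by auto
  let ?w = "C *\<^sub>v x"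
  have w: "?w \<in> carrier_vec n" using C x by simp
  have "\<bar>z \<bullet> ((2 \<cdot>\<^sub>m H) *\<^sub>v z)\<bar> \<le> z \<bullet> (T *\<^sub>v z)" if z: "z \<in> carrier_vec n" for z
    using psdD(3)[OF plus z] psdD(3)[OF minus z] form_mat_add[OF Tc H2(1) z z] by simp
  then have "(?w \<bullet> ((2 \<cdot>\<^sub>m H) *\<^sub>v y))\<^sup>2 \<le> (?w \<bullet> (T *\<^sub>v ?w)) * (y \<bullet> (T *\<^sub>v y))"
    by (intro form_cauchy_schwarz[OF H2 Tc psdD(2)[OF T] _ w y])
  moreover have "?w \<bullet> ((2 \<cdot>\<^sub>m H) *\<^sub>v y) = 2 * (x \<bullet> (C * H *\<^sub>v y))"
  proof -
    have "?w \<bullet> ((2 \<cdot>\<^sub>m H) *\<^sub>v y) = 2 * (?w \<bullet> (H *\<^sub>v y))" by (rule form_mat_smult[OF H(1) w y])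
    also have "?w \<bullet> (H *\<^sub>v y) = x \<bullet> (C *\<^sub>v (H *\<^sub>v y))"
      using H(1) y by (intro transpose_form[OF C x]) simp
    also have "C *\<^sub>v (H *\<^sub>v y) = C * H *\<^sub>v y" using C H y by simp
    finally show ?thesis .
  qed
  moreover have "?w \<bullet> (T *\<^sub>v ?w) \<le> 3 / 2 * (x \<bullet> (C * T *\<^sub>v x))"
  proof -
    have "?w \<bullet> (T *\<^sub>v ?w) = x \<bullet> (C *\<^sub>v (T *\<^sub>v ?w))"
      using Tc w by (intro transpose_form[OF C x]) simp
    also have "C *\<^sub>v (T *\<^sub>v ?w) = C * (T * C) *\<^sub>v x"
      using C Tc x by (simp add: assoc_mult_mat_vec[of _ n n _ n])
    finally show ?thesis
      using psdD(3)[OF upper x] form_mat_add(2)[OF smult_carrier_mat[OF CT(1)] CT(2) x x, of "3/2"]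
        form_mat_smult[OF CT(1) x x, of "3/2"] by linarith
  qed
  moreover have "y \<bullet> (T *\<^sub>v y) \<le> y \<bullet> (C * T *\<^sub>v y)"
    using psdD(3)[OF lower y] form_mat_add(2)[OF CT(1) Tc y y] by linarith
  moreover have "0 \<le> ?w \<bullet> (T *\<^sub>v ?w)" "0 \<le> y \<bullet> (T *\<^sub>v y)"
    using psdD(3)[OF T w] psdD(3)[OF T y] by auto
  ultimately have "(2 * (x \<bullet> (C * H *\<^sub>v y)))\<^sup>2 \<le> (3 / 2 * (x \<bullet> (C * T *\<^sub>v x))) * (y \<bullet> (C * T *\<^sub>v y))"
    by (smt (verit) mult_mono)
  then show ?thesis by (simp add: power2_eq_square)
qed

text \<open>Substituting x = B w removes the inverse: the form of C T - T at x is that of (1 - B) B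
  T at w, and the form of 3/2 C T - C T C is 3/2 times that of (B - 2/3) T. Both are products of
  commuting positive matrices.\<close>

lemma perturbedI:
  assumes B: "spd n B" and T: "spd n T" and comm: "T * B = B * T"
    and H: "H \<in> carrier_mat n n" "transpose_mat H = H"
    and plus: "psd n (T + 2 \<cdot>\<^sub>m H)" and minus: "psd n (T - 2 \<cdot>\<^sub>m H)"
    and lower: "psd n (1\<^sub>m n - B)" and upper: "psd n (B - (2 / 3) \<cdot>\<^sub>m 1\<^sub>m n)"
  shows "perturbed n (inv_mat B) T H"
proof -
  let ?C = "inv_mat B"
  note Bd = spdD[OF B] and Td = spdD[OF T] and C = spd_inv_mat[OF B] and Cs = sym_inv_mat[OF B]
  have CT: "?C * T = T * ?C"
  proof -
    have "?C * T = ?C * (T * (B * ?C))" using C Td by simp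
    also have "\<dots> = ?C * ((T * B) * ?C)" using C(1) Td(1) Bd(1) by simp
    also have "\<dots> = (?C * B) * (T * ?C)" unfolding comm using C(1) Td(1) Bd(1) by (simp add: assoc_mult_mat[of _ n n _ n _ n])
    also have "\<dots> = T * ?C" using C Td(1) by (simp del: assoc_mult_mat)
    finally show ?thesis .
  qed
  have car: "?C * T \<in> carrier_mat n n" "T * ?C \<in> carrier_mat n n" "?C * (T * ?C) \<in> carrier_mat n n"
    using C(1) Td(1) by auto
  have CTs: "transpose_mat (?C * T) = ?C * T"
    using transpose_mult[OF C(1) Td(1)] Cs Td(2) CT by simp
  have CTCs: "transpose_mat (?C * (T * ?C)) = ?C * (T * ?C)"
    using transpose_mult[OF C(1) car(2)] transpose_mult[OF Td(1) C(1)] Cs Td C(1) by simp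
  have BT: "psd n ((B - (2 / 3) \<cdot>\<^sub>m 1\<^sub>m n) * T)"
  proof (rule psd_mult_spd_if_commute[OF upper T])
    show "(B - (2 / 3) \<cdot>\<^sub>m 1\<^sub>m n) * T = T * (B - (2 / 3) \<cdot>\<^sub>m 1\<^sub>m n)"
      using Bd(1) Td(1) comm
      by (simp add: minus_mult_distrib_mat[of _ n n _ _ n] mult_minus_distrib_mat[of _ n n _ n]
          mult_smult_distrib[of _ n n _ n] mult_smult_assoc_mat[of _ n n])
  qed
  have BB: "psd n ((1\<^sub>m n - B) * B)"
  proof (rule psd_mult_spd_if_commute[OF lower B])
    show "(1\<^sub>m n - B) * B = B * (1\<^sub>m n - B)"
      using Bd(1) by (simp add: minus_mult_distrib_mat[of _ n n _ _ n] mult_minus_distrib_mat[of _ n n _ n])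
  qed
  have BBT: "psd n (((1\<^sub>m n - B) * B) * T)"
  proof (rule psd_mult_spd_if_commute[OF BB T])
    have "(B * B) * T = T * (B * B)"
    proof -
      have "(B * B) * T = B * (T * B)" unfolding comm using Bd(1) Td(1) by simp
      also have "\<dots> = (T * B) * B" unfolding comm using Bd(1) Td(1) by (simp add: comm)
      finally show ?thesis using Bd(1) Td(1) by simp
    qed
    then show "(1\<^sub>m n - B) * B * T = T * ((1\<^sub>m n - B) * B)"
      using Bd(1) Td(1) comm
      by (simp add: minus_mult_distrib_mat[of _ n n _ _ n] mult_minus_distrib_mat[of _ n n _ n])
  qed
  have forms: "0 \<le> x \<bullet> ((?C * T - T) *\<^sub>v x)"
      "0 \<le> x \<bullet> (((3 / 2) \<cdot>\<^sub>m (?C * T) - ?C * (T * ?C)) *\<^sub>v x)" if x: "x \<in> carrier_vec n" for x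
  proof -
    let ?w = "?C *\<^sub>v x"
    have w: "?w \<in> carrier_vec n" and xw: "x = B *\<^sub>v ?w"
      using C(1) x mult_inv_mat_cancel(1)[OF B x] by auto
    have v: "T *\<^sub>v x \<in> carrier_vec n" "T *\<^sub>v ?w \<in> carrier_vec n" "B *\<^sub>v ?w \<in> carrier_vec n"
      using Td(1) Bd(1) x w by auto
    have TBw: "T *\<^sub>v x = B *\<^sub>v (T *\<^sub>v ?w)"
    proof -
      have "T *\<^sub>v x = (T * B) *\<^sub>v ?w" using Td(1) Bd(1) w xw by simp
      then show ?thesis unfolding comm using Td(1) Bd(1) w by simp
    qed
    have f1: "x \<bullet> (?C * T *\<^sub>v x) = ?w \<bullet> (T *\<^sub>v x)"
      using transpose_form[OF C(1) Cs x v(1)] C(1) Td(1) x by simp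
    have f2: "x \<bullet> (?C * (T * ?C) *\<^sub>v x) = ?w \<bullet> (T *\<^sub>v ?w)"
      using transpose_form[OF C(1) Cs x v(2)] C(1) Td(1) x by (simp add: assoc_mult_mat_vec[of _ n n _ n])
    have f3: "x \<bullet> (T *\<^sub>v x) = ?w \<bullet> (B *\<^sub>v (T *\<^sub>v x))"
      using transpose_form[OF Bd(1,2) w v(1)] xw by simp
    have g1: "?w \<bullet> (((1\<^sub>m n - B) * B) * T *\<^sub>v ?w) = ?w \<bullet> (T *\<^sub>v x) - ?w \<bullet> (B *\<^sub>v (T *\<^sub>v x))"
    proof -
      have "((1\<^sub>m n - B) * B) * T *\<^sub>v ?w = (1\<^sub>m n - B) *\<^sub>v (T *\<^sub>v x)"
      proof -
        have "(D * B) * T *\<^sub>v ?w = D *\<^sub>v (B *\<^sub>v (T *\<^sub>v ?w))" if "D \<in> carrier_mat n n" for D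
          using that Bd(1) Td(1) w by (simp add: assoc_mult_mat_vec[of _ n n _ n])
        from this[OF minus_carrier_mat[OF Bd(1)]] show ?thesis unfolding TBw .
      qed
      then show ?thesis using form_mat_add(2)[OF one_carrier_mat Bd(1) w v(1)] v by simp
    qed
    have g2: "?w \<bullet> ((B - (2 / 3) \<cdot>\<^sub>m 1\<^sub>m n) * T *\<^sub>v ?w) = ?w \<bullet> (T *\<^sub>v x) - 2 / 3 * (?w \<bullet> (T *\<^sub>v ?w))"
    proof -
      have "(B - (2 / 3) \<cdot>\<^sub>m 1\<^sub>m n) * T *\<^sub>v ?w = (B - (2 / 3) \<cdot>\<^sub>m 1\<^sub>m n) *\<^sub>v (T *\<^sub>v ?w)"
        by (rule assoc_mult_mat_vec[OF minus_carrier_mat[OF smult_carrier_mat[OF one_carrier_mat]] Td(1) w])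
      then show ?thesis
        using form_mat_add(2)[OF Bd(1) smult_carrier_mat[OF one_carrier_mat] w v(2), of "2/3"]
          form_mat_smult[OF one_carrier_mat w v(2), of "2/3"] v TBw by simp
    qed
    show "0 \<le> x \<bullet> ((?C * T - T) *\<^sub>v x)"
      using psdD(3)[OF BBT w] form_mat_add(2)[OF car(1) Td(1) x x] unfolding g1 f1 f3 by simp
    show "0 \<le> x \<bullet> (((3 / 2) \<cdot>\<^sub>m (?C * T) - ?C * (T * ?C)) *\<^sub>v x)"
      using psdD(3)[OF BT w] form_mat_add(2)[OF smult_carrier_mat[OF car(1)] car(3) x x, of "3/2"]
        form_mat_smult[OF car(1) x x, of "3/2"] unfolding g2 f1 f2 by simp
  qed
  have "psd n (?C * T - T)"
    using forms(1) minus_carrier_mat[OF Td(1)] transpose_minus[OF car(1) Td(1)]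
    unfolding psd_def CTs Td(2) by blast
  moreover have "psd n ((3 / 2) \<cdot>\<^sub>m (?C * T) - ?C * (T * ?C))"
    using forms(2) minus_carrier_mat[OF car(3)]
      transpose_minus[OF smult_carrier_mat[OF car(1)] car(3), of "3/2"]
    unfolding psd_def CTCs transpose_smult_mat CTs by blast
  ultimately show ?thesis
    unfolding perturbed_def using C(1) Cs H spd_imp_psd[OF T] plus minus by blast
qed

lemma averaging_mat_eq:
  "1\<^sub>m n + (a / 24) \<cdot>\<^sub>m tridiag n 1 (- 2) 1 = tridiag n (a / 24) (1 - a / 12) (a / 24)"
  by (intro eq_matI) (auto simp: tridiag_def)

lemma averaging_mat_spd:
  assumes "0 < a" "a < 2"
  shows "spd n (1\<^sub>m n + (a / 24) \<cdot>\<^sub>m tridiag n 1 (- 2) 1)"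
  unfolding averaging_mat_eq using assms by (intro tridiag_spd) auto

lemma perturbed_tau:
  fixes a :: real and n :: nat
  assumes a: "1 < a" "a < 2"
  defines "S \<equiv> sym_toeplitz n (s_coef a)"
  shows "perturbed n (inv_mat (1\<^sub>m n + (a / 24) \<cdot>\<^sub>m tridiag n 1 (- 2) 1)) (tau_mat S) (tau_hankel S)"
proof (rule perturbedI)
  let ?B = "1\<^sub>m n + (a / 24) \<cdot>\<^sub>m tridiag n 1 (- 2) 1"
  have c: "S \<in> carrier_mat n n" "tau_hankel S \<in> carrier_mat n n"
    unfolding S_def by (rule toeplitz_carrier)+
  have eqs: "tau_mat S = S + (- 1) \<cdot>\<^sub>m tau_hankel S"
    "tau_mat S + 2 \<cdot>\<^sub>m tau_hankel S = S + 1 \<cdot>\<^sub>m tau_hankel S"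
    "tau_mat S - 2 \<cdot>\<^sub>m tau_hankel S = S + (- 3) \<cdot>\<^sub>m tau_hankel S"
    unfolding tau_mat_def using c by (intro eq_matI; auto)+
  show "spd n ?B" using a by (intro averaging_mat_spd) auto
  show "spd n (tau_mat S)" unfolding eqs(1) unfolding S_def by (rule toeplitz_hankel_spd[OF a]) auto
  show "tau_mat S * ?B = ?B * tau_mat S"
    unfolding averaging_mat_eq S_def by (rule tau_tridiag_commute[OF a])
  show "tau_hankel S \<in> carrier_mat n n" by (rule c)
  show "transpose_mat (tau_hankel S) = tau_hankel S"
    unfolding S_def
    by (rule sym_matI[OF toeplitz_carrier(2)]) (simp add: hankel_entry add.commute)
  show "psd n (tau_mat S + 2 \<cdot>\<^sub>m tau_hankel S)" "psd n (tau_mat S - 2 \<cdot>\<^sub>m tau_hankel S)"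
    unfolding eqs(2,3) unfolding S_def by (rule spd_imp_psd, rule toeplitz_hankel_spd[OF a], simp, simp)+
  \<comment> \<open>Both bounds on B are weak diagonal dominance. For the lower one, 2 (a / 24) <=
    1/3 - a / 12 holds precisely when a <= 2, which explains the constant 2/3.\<close>
  have "1\<^sub>m n - ?B = tridiag n (- (a / 24)) (a / 12) (- (a / 24))"
    by (intro eq_matI) (auto simp: tridiag_def)
  then show "psd n (1\<^sub>m n - ?B)" using a by (simp add: tridiag_psd)
  have "?B - (2 / 3) \<cdot>\<^sub>m 1\<^sub>m n = tridiag n (a / 24) (1 / 3 - a / 12) (a / 24)"
    by (intro eq_matI) (auto simp: tridiag_def)
  then show "psd n (?B - (2 / 3) \<cdot>\<^sub>m 1\<^sub>m n)" using a by (simp add: tridiag_psd)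
qed

section \<open>Kronecker products\<close>

lemma kronecker_carrier:
  "A \<in> carrier_mat n m \<Longrightarrow> B \<in> carrier_mat k l \<Longrightarrow> A \<otimes>\<^sub>K B \<in> carrier_mat (n * k) (m * l)"
  by (auto simp: kronecker_def)

lemma kronecker_entry:
  assumes "A \<in> carrier_mat n m" "B \<in> carrier_mat k l" "i < n * k" "j < m * l"
  shows "(A \<otimes>\<^sub>K B) $$ (i, j) = A $$ (i div k, j div l) * B $$ (i mod k, j mod l)"
  using assms by (auto simp: kronecker_def)

lemma div_mod_less_mult:
  fixes i n k :: nat
  assumes "i < n * k"
  shows "i div k < n" "i mod k < k"
proof -
  show "i div k < n" using assms by (rule less_mult_imp_div_less)
  have "0 < k" using assms by (cases k) auto
  then show "i mod k < k" by simp
qed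

lemma kronecker_mult:
  assumes A: "A \<in> carrier_mat n m" and B: "B \<in> carrier_mat k l"
    and C: "C \<in> carrier_mat m p" and D: "D \<in> carrier_mat l q"
  shows "(A \<otimes>\<^sub>K B) * (C \<otimes>\<^sub>K D) = (A * C) \<otimes>\<^sub>K (B * D)"
proof (rule eq_matI)
  have car: "A \<otimes>\<^sub>K B \<in> carrier_mat (n * k) (m * l)" "C \<otimes>\<^sub>K D \<in> carrier_mat (m * l) (p * q)"
    "(A * C) \<otimes>\<^sub>K (B * D) \<in> carrier_mat (n * k) (p * q)" "A * C \<in> carrier_mat n p" "B * D \<in> carrier_mat k q"
    using A B C D by (auto intro!: kronecker_carrier)
  show "dim_row ((A \<otimes>\<^sub>K B) * (C \<otimes>\<^sub>K D)) = dim_row ((A * C) \<otimes>\<^sub>K (B * D))"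
    "dim_col ((A \<otimes>\<^sub>K B) * (C \<otimes>\<^sub>K D)) = dim_col ((A * C) \<otimes>\<^sub>K (B * D))"
    using car(1-3) by auto
  fix i j assume "i < dim_row ((A * C) \<otimes>\<^sub>K (B * D))" "j < dim_col ((A * C) \<otimes>\<^sub>K (B * D))"
  then have ij: "i < n * k" "j < p * q" using car(3) by auto
  note i = div_mod_less_mult[OF ij(1)] and j = div_mod_less_mult[OF ij(2)]
  have idx: "v + u * l < m * l" if "u < m" "v < l" for u v
  proof -
    have "v + u * l < (u + 1) * l" using that by simp
    also have "\<dots> \<le> m * l" using that by (intro mult_right_mono) auto
    finally show ?thesis .
  qed
  have "((A \<otimes>\<^sub>K B) * (C \<otimes>\<^sub>K D)) $$ (i, j) = (\<Sum>h<m * l. (A \<otimes>\<^sub>K B) $$ (i, h) * (C \<otimes>\<^sub>K D) $$ (h, j))"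
    using car(1,2) ij by (simp add: scalar_prod_def atLeast0LessThan)
  also have "\<dots> = (\<Sum>u<m. \<Sum>v<l. (A \<otimes>\<^sub>K B) $$ (i, v + u * l) * (C \<otimes>\<^sub>K D) $$ (v + u * l, j))"
    by (rule sum_mult_product)
  also have "\<dots> = (\<Sum>u<m. \<Sum>v<l. (A $$ (i div k, u) * C $$ (u, j div q)) * (B $$ (i mod k, v) * D $$ (v, j mod q)))"
    by (intro sum.cong refl)
      (simp add: kronecker_entry[OF A B ij(1)] kronecker_entry[OF C D _ ij(2)] idx)
  also have "\<dots> = (\<Sum>u<m. A $$ (i div k, u) * C $$ (u, j div q)) * (\<Sum>v<l. B $$ (i mod k, v) * D $$ (v, j mod q))"
    by (simp add: sum_product)
  also have "\<dots> = (A * C) $$ (i div k, j div q) * (B * D) $$ (i mod k, j mod q)"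
    using A B C D i j by (simp add: scalar_prod_def atLeast0LessThan)
  also have "\<dots> = ((A * C) \<otimes>\<^sub>K (B * D)) $$ (i, j)"
    using kronecker_entry[OF car(4,5) ij] by simp
  finally show "((A \<otimes>\<^sub>K B) * (C \<otimes>\<^sub>K D)) $$ (i, j) = ((A * C) \<otimes>\<^sub>K (B * D)) $$ (i, j)" .
qed

lemma kronecker_transpose:
  assumes A: "A \<in> carrier_mat n m" and B: "B \<in> carrier_mat k l"
  shows "transpose_mat (A \<otimes>\<^sub>K B) = transpose_mat A \<otimes>\<^sub>K transpose_mat B"
proof (rule eq_matI)
  have A': "transpose_mat A \<in> carrier_mat m n" and B': "transpose_mat B \<in> carrier_mat l k"
    using A B by auto
  note car = kronecker_carrier[OF A B] kronecker_carrier[OF A' B']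
  show "dim_row (transpose_mat (A \<otimes>\<^sub>K B)) = dim_row (transpose_mat A \<otimes>\<^sub>K transpose_mat B)"
    "dim_col (transpose_mat (A \<otimes>\<^sub>K B)) = dim_col (transpose_mat A \<otimes>\<^sub>K transpose_mat B)"
    using car by auto
  fix i j assume "i < dim_row (transpose_mat A \<otimes>\<^sub>K transpose_mat B)" "j < dim_col (transpose_mat A \<otimes>\<^sub>K transpose_mat B)"
  then have ij: "i < m * l" "j < n * k" using car(2) by auto
  note ij' = div_mod_less_mult[OF ij(1)] div_mod_less_mult[OF ij(2)]
  have "transpose_mat (A \<otimes>\<^sub>K B) $$ (i, j) = (A \<otimes>\<^sub>K B) $$ (j, i)" using car(1) ij by auto
  then show "transpose_mat (A \<otimes>\<^sub>K B) $$ (i, j) = (transpose_mat A \<otimes>\<^sub>K transpose_mat B) $$ (i, j)"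
    using kronecker_entry[OF A B ij(2,1)] kronecker_entry[OF A' B' ij] ij' A B by simp
qed

lemma kronecker_one: "1\<^sub>m n \<otimes>\<^sub>K 1\<^sub>m k = (1\<^sub>m (n * k) :: real mat)"
proof (rule eq_matI)
  fix i j assume "i < dim_row (1\<^sub>m (n * k) :: real mat)" "j < dim_col (1\<^sub>m (n * k) :: real mat)"
  then have ij: "i < n * k" "j < n * k" by auto
  have "i = j \<longleftrightarrow> i div k = j div k \<and> i mod k = j mod k" by (metis div_mult_mod_eq)
  then show "(1\<^sub>m n \<otimes>\<^sub>K 1\<^sub>m k) $$ (i, j) = (1\<^sub>m (n * k) :: real mat) $$ (i, j)"
    using kronecker_entry[OF one_carrier_mat one_carrier_mat ij]
      div_mod_less_mult[OF ij(1)] div_mod_less_mult[OF ij(2)] ij by auto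
qed (auto simp: kronecker_def)

lemma kronecker_linear:
  assumes A: "A \<in> carrier_mat n m" "A' \<in> carrier_mat n m" and B: "B \<in> carrier_mat k l" "B' \<in> carrier_mat k l"
  shows "(s \<cdot>\<^sub>m A + t \<cdot>\<^sub>m A') \<otimes>\<^sub>K B = s \<cdot>\<^sub>m (A \<otimes>\<^sub>K B) + t \<cdot>\<^sub>m (A' \<otimes>\<^sub>K B)" (is "?lhs1 = ?rhs1")
    and "A \<otimes>\<^sub>K (s \<cdot>\<^sub>m B + t \<cdot>\<^sub>m B') = s \<cdot>\<^sub>m (A \<otimes>\<^sub>K B) + t \<cdot>\<^sub>m (A \<otimes>\<^sub>K B')" (is "?lhs2 = ?rhs2")
proof -
  show "?lhs1 = ?rhs1"
  proof (rule eq_matI)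
    fix i j assume "i < dim_row ?rhs1" "j < dim_col ?rhs1"
    then have ij: "i < n * k" "j < m * l" using A B by (auto simp: kronecker_def)
    note ij' = div_mod_less_mult[OF ij(1)] div_mod_less_mult[OF ij(2)]
    have "s \<cdot>\<^sub>m A + t \<cdot>\<^sub>m A' \<in> carrier_mat n m" using A by simp
    from kronecker_entry[OF this B(1) ij] show "?lhs1 $$ (i, j) = ?rhs1 $$ (i, j)"
      using kronecker_entry[OF A(1) B(1) ij] kronecker_entry[OF A(2) B(1) ij] ij ij' A
        kronecker_carrier[OF A(1) B(1)] kronecker_carrier[OF A(2) B(1)]
      by (simp add: algebra_simps)
  qed (use A B in \<open>auto simp: kronecker_def\<close>)
  show "?lhs2 = ?rhs2"
  proof (rule eq_matI)
    fix i j assume "i < dim_row ?rhs2" "j < dim_col ?rhs2"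
    then have ij: "i < n * k" "j < m * l" using A B by (auto simp: kronecker_def)
    note ij' = div_mod_less_mult[OF ij(1)] div_mod_less_mult[OF ij(2)]
    have "s \<cdot>\<^sub>m B + t \<cdot>\<^sub>m B' \<in> carrier_mat k l" using B by simp
    from kronecker_entry[OF A(1) this ij] show "?lhs2 $$ (i, j) = ?rhs2 $$ (i, j)"
      using kronecker_entry[OF A(1) B(1) ij] kronecker_entry[OF A(1) B(2) ij] ij ij' B
        kronecker_carrier[OF A(1) B(1)] kronecker_carrier[OF A(1) B(2)]
      by (simp add: algebra_simps)
  qed (use A B in \<open>auto simp: kronecker_def\<close>)
qed

lemma kron_prod_carrier:
  "(\<And>l. l < d \<Longrightarrow> A l \<in> carrier_mat N N) \<Longrightarrow> kron_prod A d \<in> carrier_mat (N ^ d) (N ^ d)"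
  by (induction d) (auto intro: kronecker_carrier)

lemma kron_prod_cong: "(\<And>l. l < d \<Longrightarrow> A l = A' l) \<Longrightarrow> kron_prod A d = kron_prod A' d"
  by (induction d) auto

lemma kron_prod_mult:
  assumes "\<And>l. l < d \<Longrightarrow> A l \<in> carrier_mat N N" "\<And>l. l < d \<Longrightarrow> A' l \<in> carrier_mat N N"
  shows "kron_prod A d * kron_prod A' d = kron_prod (\<lambda>l. A l * A' l) d"
  using assms
proof (induction d)
  case (Suc d)
  have "kron_prod A d \<in> carrier_mat (N ^ d) (N ^ d)" "kron_prod A' d \<in> carrier_mat (N ^ d) (N ^ d)"
    using Suc.prems by (auto intro!: kron_prod_carrier)
  from kronecker_mult[OF Suc.prems(1)[of d] this(1) Suc.prems(2)[of d] this(2)]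
  show ?case using Suc by simp
qed simp

lemma kron_prod_transpose:
  assumes "\<And>l. l < d \<Longrightarrow> A l \<in> carrier_mat N N"
  shows "transpose_mat (kron_prod A d) = kron_prod (\<lambda>l. transpose_mat (A l)) d"
  using assms
proof (induction d)
  case (Suc d)
  have "kron_prod A d \<in> carrier_mat (N ^ d) (N ^ d)"
    using Suc.prems by (auto intro!: kron_prod_carrier)
  from kronecker_transpose[OF Suc.prems[of d] this] show ?case using Suc by simp
qed simp

lemma kron_prod_one: "kron_prod (\<lambda>_. 1\<^sub>m N) d = 1\<^sub>m (N ^ d)"
  by (induction d) (auto simp: kronecker_one)

text \<open>The shape left by the i-th summand of the scheme after multiplication by B^-1, which
  turns all other Kronecker factors into identities.\<close>

definition lift :: "nat \<Rightarrow> nat \<Rightarrow> nat \<Rightarrow> real mat \<Rightarrow> real mat" where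
  "lift N d i X = kron_prod ((\<lambda>_. 1\<^sub>m N)(i := X)) d"

lemma lift_carrier: "X \<in> carrier_mat N N \<Longrightarrow> lift N d i X \<in> carrier_mat (N ^ d) (N ^ d)"
  unfolding lift_def by (rule kron_prod_carrier) auto

lemma lift_mult:
  assumes "X \<in> carrier_mat N N" "Y \<in> carrier_mat N N"
  shows "lift N d i X * lift N d i Y = lift N d i (X * Y)"
proof -
  have "lift N d i X * lift N d i Y = kron_prod (\<lambda>l. ((\<lambda>_. 1\<^sub>m N)(i := X)) l * ((\<lambda>_. 1\<^sub>m N)(i := Y)) l) d"
    unfolding lift_def using assms by (intro kron_prod_mult) auto
  also have "\<dots> = lift N d i (X * Y)"
    unfolding lift_def by (intro kron_prod_cong) auto
  finally show ?thesis .
qed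

lemma lift_transpose:
  assumes "X \<in> carrier_mat N N"
  shows "transpose_mat (lift N d i X) = lift N d i (transpose_mat X)"
proof -
  have "transpose_mat (lift N d i X) = kron_prod (\<lambda>l. transpose_mat (((\<lambda>_. 1\<^sub>m N)(i := X)) l)) d"
    unfolding lift_def using assms by (intro kron_prod_transpose) auto
  also have "\<dots> = lift N d i (transpose_mat X)"
    unfolding lift_def by (intro kron_prod_cong) auto
  finally show ?thesis .
qed

lemma lift_one: "lift N d i (1\<^sub>m N) = 1\<^sub>m (N ^ d)"
proof -
  have "(\<lambda>_. 1\<^sub>m N)(i := 1\<^sub>m N) = (\<lambda>_. 1\<^sub>m N :: real mat)" by auto
  then show ?thesis by (simp add: lift_def kron_prod_one)
qed

lemma lift_linear:
  assumes "i < d" "X \<in> carrier_mat N N" "Y \<in> carrier_mat N N"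
  shows "lift N d i (s \<cdot>\<^sub>m X + t \<cdot>\<^sub>m Y) = s \<cdot>\<^sub>m lift N d i X + t \<cdot>\<^sub>m lift N d i Y"
  using assms(1)
proof (induction d)
  case (Suc d)
  let ?I = "1\<^sub>m N :: real mat"
  show ?case
  proof (cases "i = d")
    case True
    have eq: "lift N (Suc d) i Z = Z \<otimes>\<^sub>K 1\<^sub>m (N ^ d)" for Z
    proof -
      have "kron_prod ((\<lambda>_. ?I)(i := Z)) d = kron_prod (\<lambda>_. ?I) d"
        using True by (intro kron_prod_cong) auto
      then show ?thesis unfolding lift_def using True by (simp add: kron_prod_one)
    qed
    show ?thesis unfolding eq by (rule kronecker_linear(1)[OF assms(2,3) one_carrier_mat one_carrier_mat])
  next
    case False
    have eq: "lift N (Suc d) i Z = ?I \<otimes>\<^sub>K lift N d i Z" for Z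
      unfolding lift_def using False by simp
    show ?thesis unfolding eq using Suc False
      by (simp add: kronecker_linear(2)[OF one_carrier_mat one_carrier_mat lift_carrier[OF assms(2)] lift_carrier[OF assms(3)]])
  qed
qed simp

text \<open>A square root R of X + \<epsilon> 1 lifts to a square root of the lifted X plus
  \<epsilon> times the identity, so the lifted form is nonnegative up to \<epsilon> (v . v) for
  every \<epsilon> > 0. The shift is there because square roots have been constructed for positive
  definite matrices.\<close>

lemma lift_psd:
  assumes i: "i < d" and X: "psd N X"
  shows "psd (N ^ d) (lift N d i X)"
proof -
  note Xd = psdD[OF X]
  note car = lift_carrier[OF Xd(1), of d i]
  have sym: "transpose_mat (lift N d i X) = lift N d i X"
    using lift_transpose[OF Xd(1)] Xd(2) by simp
  have "0 \<le> v \<bullet> (lift N d i X *\<^sub>v v)" if v: "v \<in> carrier_vec (N ^ d)" for v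
  proof -
    have pos: "0 \<le> v \<bullet> (lift N d i X *\<^sub>v v) + \<epsilon> * (v \<bullet> v)" if \<epsilon>: "\<epsilon> > 0" for \<epsilon>
    proof -
      let ?Y = "1 \<cdot>\<^sub>m X + \<epsilon> \<cdot>\<^sub>m 1\<^sub>m N"
      have "spd N ?Y" unfolding spd_iff
      proof (intro conjI ballI impI)
        show "?Y \<in> carrier_mat N N" by simp
        show "transpose_mat ?Y = ?Y" using Xd(1,2)
          by (simp add: transpose_add[of _ N N] transpose_smult_mat)
        fix w :: "real vec" assume w: "w \<in> carrier_vec N" "w \<noteq> 0\<^sub>v N"
        have "w \<bullet> (?Y *\<^sub>v w) = 1 * (w \<bullet> (X *\<^sub>v w)) + \<epsilon> * (w \<bullet> (1\<^sub>m N *\<^sub>v w))"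
          using Xd(1) w(1) by (simp only: form_mat_add(1)[of _ N] form_mat_smult[of _ N] smult_carrier_mat one_carrier_mat)
        then show "0 < w \<bullet> (?Y *\<^sub>v w)"
          using Xd(3)[OF w(1)] scalar_prod_self_pos[OF w] \<epsilon> w(1) by (simp add: add_nonneg_pos)
      qed
      then obtain R where R: "spd N R" "R * R = ?Y" using spd_sqrt_exists by blast
      note Rd = spdD[OF R(1)]
      let ?R = "lift N d i R"
      have Rc: "?R \<in> carrier_mat (N ^ d) (N ^ d)" "transpose_mat ?R = ?R"
        using lift_carrier[OF Rd(1)] lift_transpose[OF Rd(1)] Rd(2) by auto
      have RR: "?R * ?R = 1 \<cdot>\<^sub>m lift N d i X + \<epsilon> \<cdot>\<^sub>m 1\<^sub>m (N ^ d)"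
        using lift_mult[OF Rd(1) Rd(1), of d i] lift_linear[OF i Xd(1) one_carrier_mat, of 1 \<epsilon>] R(2)
        by (simp add: lift_one)
      have Rv: "?R *\<^sub>v v \<in> carrier_vec (N ^ d)" using Rc v by simp
      have "v \<bullet> (lift N d i X *\<^sub>v v) + \<epsilon> * (v \<bullet> v) = v \<bullet> ((?R * ?R) *\<^sub>v v)"
        unfolding RR using car v
        by (simp add: form_mat_add(1)[of _ "N ^ d"] form_mat_smult[of _ "N ^ d"])
      also have "\<dots> = (?R *\<^sub>v v) \<bullet> (?R *\<^sub>v v)"
        using transpose_form[OF Rc v Rv] Rc(1) v by simp
      finally show ?thesis using scalar_prod_self_nonneg[of "?R *\<^sub>v v"] by simp
    qed
    show ?thesis
    proof (rule ccontr)
      let ?f = "v \<bullet> (lift N d i X *\<^sub>v v)" and ?g = "v \<bullet> v"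
      assume "\<not> 0 \<le> ?f"
      then have f: "?f < 0" by simp
      have g: "0 \<le> ?g" by (rule scalar_prod_self_nonneg)
      \<comment> \<open>If f were negative, the value \<epsilon> = -f / (g + 1) would contradict f +
        \<epsilon> g >= 0.\<close>
      have "(- ?f / (?g + 1)) * ?g < - ?f"
        using f g by (simp add: field_simps)
      moreover have "- ?f / (?g + 1) > 0" using f g by (intro divide_pos_pos) auto
      ultimately show False using pos[of "- ?f / (?g + 1)"] by simp
    qed
  qed
  then show ?thesis using car sym by (auto simp: psd_def)
qed

text \<open>Lifting is linear, multiplicative and compatible with transposition, so each matrix in
  \<open>perturbed\<close> is the lift of its one-dimensional counterpart and inherits
  positivity.\<close>

lemma perturbed_lift:
  assumes i: "i < d" and p: "perturbed N C T H"
  shows "perturbed (N ^ d) (lift N d i C) (lift N d i T) (lift N d i H)"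
proof -
  have C: "C \<in> carrier_mat N N" "transpose_mat C = C" and H: "H \<in> carrier_mat N N" "transpose_mat H = H"
    and T: "psd N T" and plus: "psd N (T + 2 \<cdot>\<^sub>m H)" and minus: "psd N (T - 2 \<cdot>\<^sub>m H)"
    and lower: "psd N (C * T - T)" and upper: "psd N ((3 / 2) \<cdot>\<^sub>m (C * T) - C * (T * C))"
    using p by (auto simp: perturbed_def)
  note Tc = psdD(1)[OF T]
  have c: "C * T \<in> carrier_mat N N" "T * C \<in> carrier_mat N N" "C * (T * C) \<in> carrier_mat N N"
    using C(1) Tc by auto
  let ?L = "lift N d i"
  note L = lift_carrier[where d = d and i = i]
  have add: "?L (X + t \<cdot>\<^sub>m Y) = ?L X + t \<cdot>\<^sub>m ?L Y" if "X \<in> carrier_mat N N" "Y \<in> carrier_mat N N" for X Y t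
  proof -
    have "1 \<cdot>\<^sub>m X = X" "1 \<cdot>\<^sub>m ?L X = ?L X" by (intro eq_matI; auto)+
    then show ?thesis using lift_linear[OF i that, of 1 t] by simp
  qed
  have sub: "?L (s \<cdot>\<^sub>m X - t \<cdot>\<^sub>m Y) = s \<cdot>\<^sub>m ?L X - t \<cdot>\<^sub>m ?L Y" if "X \<in> carrier_mat N N" "Y \<in> carrier_mat N N" for X Y s t
  proof -
    have "s \<cdot>\<^sub>m X - t \<cdot>\<^sub>m Y = s \<cdot>\<^sub>m X + (- t) \<cdot>\<^sub>m Y" "s \<cdot>\<^sub>m ?L X - t \<cdot>\<^sub>m ?L Y = s \<cdot>\<^sub>m ?L X + (- t) \<cdot>\<^sub>m ?L Y"
      using that L[OF that(1)] L[OF that(2)] by (intro eq_matI; auto)+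
    then show ?thesis using lift_linear[OF i that, of s "- t"] by simp
  qed
  have one: "1 \<cdot>\<^sub>m X = X" for X :: "real mat" by (intro eq_matI) auto
  have "psd (N ^ d) (?L T + 2 \<cdot>\<^sub>m ?L H)" using lift_psd[OF i plus] add[OF Tc H(1)] by simp
  moreover have "psd (N ^ d) (?L T - 2 \<cdot>\<^sub>m ?L H)"
    using lift_psd[OF i minus] sub[OF Tc H(1), of 1 2] by (simp add: one)
  moreover have "psd (N ^ d) (?L C * ?L T - ?L T)"
    using lift_psd[OF i lower] sub[OF c(1) Tc, of 1 1] lift_mult[OF C(1) Tc] by (simp add: one)
  moreover have "psd (N ^ d) ((3 / 2) \<cdot>\<^sub>m (?L C * ?L T) - ?L C * (?L T * ?L C))"
    using lift_psd[OF i upper] sub[OF c(1,3), of "3 / 2" 1] lift_mult[OF C(1) Tc] lift_mult[OF Tc C(1)]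
      lift_mult[OF C(1) c(2)] by (simp add: one)
  ultimately show ?thesis
    unfolding perturbed_def
    using L[OF C(1)] L[OF H(1)] lift_transpose[OF C(1)] lift_transpose[OF H(1)] C(2) H(2) lift_psd[OF i T]
    by simp
qed

section \<open>Convergence of GMRES from bounds on the field of values\<close>

text \<open>With r as initial residual, k Richardson steps with parameter w multiply it by (1 - w
  A)^k. The accumulated correction z grows by w times the current residual, so it stays in the
  Krylov space.\<close>

lemma richardson_residual_krylov:
  fixes A :: "real mat"
  assumes A: "A \<in> carrier_mat n n" and r: "r \<in> carrier_vec n"
  shows "\<exists>z \<in> krylov A r k. z \<in> carrier_vec n \<and> ((1\<^sub>m n - w \<cdot>\<^sub>m A) ^\<^sub>m k) *\<^sub>v r = r - A *\<^sub>v z"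
proof -
  interpret vec_space "TYPE(real)" n .
  let ?K = "\<lambda>k. (\<lambda>i. (A ^\<^sub>m i) *\<^sub>v r) ` {..<k}"
  have kry: "krylov A r k = span (?K k)" for k using r by (auto simp: krylov_def)
  have K: "?K k \<subseteq> carrier_vec n" for k using A r by (auto intro!: mult_mat_vec_carrier[of _ n n])
  have mono: "span (?K k) \<subseteq> span (?K l)" if "k \<le> l" for k l
    using that by (intro span_is_monotone image_mono) auto
  let ?G = "1\<^sub>m n - w \<cdot>\<^sub>m A"
  have G: "?G \<in> carrier_mat n n" by (intro minus_carrier_mat smult_carrier_mat A)
  have Gv: "?G *\<^sub>v v = v - w \<cdot>\<^sub>v (A *\<^sub>v v)" if "v \<in> carrier_vec n" for v
    using A that by (simp add: minus_mult_distrib_mat_vec[of _ n n] smult_mat_mult_vec[of _ n n])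
  have Gk: "(?G ^\<^sub>m k) \<in> carrier_mat n n" for k using G by (rule pow_carrier_mat)
  have Aj: "(A ^\<^sub>m j) *\<^sub>v r \<in> carrier_vec n" for j
    using A r by (auto intro!: mult_mat_vec_carrier[of _ n n])
  have comm: "A * A ^\<^sub>m j = A ^\<^sub>m j * A" for j
  proof (induction j)
    case (Suc j)
    have "A * A ^\<^sub>m Suc j = (A * A ^\<^sub>m j) * A" using A by (simp add: assoc_mult_mat[of _ n n _ n _ n])
    then show ?case using Suc by simp
  qed (use A in auto)
  have ASuc: "A *\<^sub>v ((A ^\<^sub>m j) *\<^sub>v r) = (A ^\<^sub>m Suc j) *\<^sub>v r" for j
  proof -
    have "A *\<^sub>v ((A ^\<^sub>m j) *\<^sub>v r) = (A * A ^\<^sub>m j) *\<^sub>v r"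
      using A r by (intro assoc_mult_mat_vec[symmetric, of _ n n _ n]) auto
    then show ?thesis by (simp add: comm)
  qed
  \<comment> \<open>Stated for all j because G^(k+1) v = G^k v - w G^k (A v), so the induction on k
    passes from j to j + 1. Only j = 0 is needed afterwards.\<close>
  have step: "(?G ^\<^sub>m k) *\<^sub>v ((A ^\<^sub>m j) *\<^sub>v r) \<in> span (?K (Suc (k + j)))" for k j
  proof (induction k arbitrary: j)
    case 0
    have "(A ^\<^sub>m j) *\<^sub>v r \<in> ?K (Suc j)" by auto
    then have "(A ^\<^sub>m j) *\<^sub>v r \<in> span (?K (Suc j))" using K by (intro in_own_span[THEN subsetD]) auto
    then show ?case using A Aj by simp
  next
    case (Suc k)
    let ?v = "(A ^\<^sub>m j) *\<^sub>v r" and ?v' = "(A ^\<^sub>m Suc j) *\<^sub>v r"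
    have "(?G ^\<^sub>m Suc k) *\<^sub>v ?v = (?G ^\<^sub>m k) *\<^sub>v (?G *\<^sub>v ?v)"
      using Gk[of k] G Aj by (simp del: assoc_mult_mat_vec add: assoc_mult_mat_vec[of _ n n _ n])
    also have "\<dots> = (?G ^\<^sub>m k) *\<^sub>v ?v - w \<cdot>\<^sub>v ((?G ^\<^sub>m k) *\<^sub>v ?v')"
      unfolding Gv[OF Aj] ASuc using Gk[of k] Aj[of j] Aj[of "Suc j"]
      by (simp only: mult_minus_distrib_mat_vec[of _ n n] mult_mat_vec[of _ n n] smult_carrier_vec)
    also have "\<dots> = (?G ^\<^sub>m k) *\<^sub>v ?v + (- w) \<cdot>\<^sub>v ((?G ^\<^sub>m k) *\<^sub>v ?v')"
      using Gk[of k] by (intro eq_vecI) auto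
    finally have eq: "(?G ^\<^sub>m Suc k) *\<^sub>v ?v = (?G ^\<^sub>m k) *\<^sub>v ?v + (- w) \<cdot>\<^sub>v ((?G ^\<^sub>m k) *\<^sub>v ?v')" .
    have "(?G ^\<^sub>m k) *\<^sub>v ?v \<in> span (?K (Suc (Suc k + j)))"
      using Suc.IH[of j] mono[of "Suc (k + j)" "Suc (Suc k + j)"] by auto
    moreover have "(- w) \<cdot>\<^sub>v ((?G ^\<^sub>m k) *\<^sub>v ?v') \<in> span (?K (Suc (Suc k + j)))"
      using Suc.IH[of "Suc j"] K by (intro smult_in_span) auto
    ultimately show ?case unfolding eq using span_add1[OF K] by simp
  qed
  have "\<exists>z \<in> span (?K k). z \<in> carrier_vec n \<and> (?G ^\<^sub>m k) *\<^sub>v r = r - A *\<^sub>v z" for k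
  proof (induction k)
    case 0
    have "0\<^sub>v n \<in> span (?K 0)" using span_zero by (simp add: module_vec_simps)
    moreover have "A *\<^sub>v 0\<^sub>v n = 0\<^sub>v n" using A by auto
    ultimately show ?case using r G by (intro bexI[of _ "0\<^sub>v n"]) (auto simp: carrier_matD)
  next
    case (Suc k)
    then obtain z where z: "z \<in> span (?K k)" "z \<in> carrier_vec n" "(?G ^\<^sub>m k) *\<^sub>v r = r - A *\<^sub>v z" by blast
    let ?p = "(?G ^\<^sub>m k) *\<^sub>v r"
    have p: "?p \<in> carrier_vec n" by (rule mult_mat_vec_carrier[OF Gk r])
    have pK: "?p \<in> span (?K (Suc k))" using step[of k 0] A r by simp
    have GkG: "?G * ?G ^\<^sub>m k = ?G ^\<^sub>m k * ?G"
    proof (induction k)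
      case (Suc k)
      have "?G * ?G ^\<^sub>m Suc k = (?G * ?G ^\<^sub>m k) * ?G"
        using G by (simp only: pow_mat.simps assoc_mult_mat[of _ n n _ n _ n] Gk)
      then show ?case using Suc by simp
    qed (use G A in \<open>auto simp: right_mult_one_mat[OF G]\<close>)
    have "(?G ^\<^sub>m Suc k) *\<^sub>v r = ?G *\<^sub>v ?p"
      unfolding pow_mat.simps GkG[symmetric] by (rule assoc_mult_mat_vec[OF G Gk r])
    also have "\<dots> = ?p - w \<cdot>\<^sub>v (A *\<^sub>v ?p)" by (rule Gv[OF p])
    also have "\<dots> = r - A *\<^sub>v (z + w \<cdot>\<^sub>v ?p)"
    proof -
      have "A *\<^sub>v (z + w \<cdot>\<^sub>v ?p) = A *\<^sub>v z + w \<cdot>\<^sub>v (A *\<^sub>v ?p)"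
        using A z(2) p by (simp only: mult_add_distrib_mat_vec[of _ n n] mult_mat_vec[of _ n n] smult_carrier_vec)
      moreover have "u - x - y = u - (x + y)"
        if "u \<in> carrier_vec n" "x \<in> carrier_vec n" "y \<in> carrier_vec n" for u x y :: "real vec"
        using that by (intro eq_vecI) auto
      ultimately show ?thesis using z(3) A r z(2) p by simp
    qed
    finally have "(?G ^\<^sub>m Suc k) *\<^sub>v r = r - A *\<^sub>v (z + w \<cdot>\<^sub>v ?p)" .
    moreover have "z + w \<cdot>\<^sub>v ?p \<in> span (?K (Suc k))"
      using z(1) mono[of k "Suc k"] smult_in_span[OF K pK] span_add1[OF K] by auto
    ultimately show ?case using z(2) p by (intro bexI[of _ "z + w \<cdot>\<^sub>v ?p"]) auto
  qed
  then show "\<exists>z \<in> krylov A r k. z \<in> carrier_vec n \<and> ((1\<^sub>m n - w \<cdot>\<^sub>m A) ^\<^sub>m k) *\<^sub>v r = r - A *\<^sub>v z"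
    unfolding kry by blast
qed

text \<open>GMRES is at least as good as the Richardson iteration with parameter \<open>\<gamma> / \<Gamma>\<^sup>2\<close>.\<close>

lemma gmres_bound:
  fixes A :: "real mat"
  assumes A: "A \<in> carrier_mat n n" and b: "b \<in> carrier_vec n" and y0: "y0 \<in> carrier_vec n"
    and \<gamma>: "0 < \<gamma>" "\<And>v. v \<in> carrier_vec n \<Longrightarrow> \<gamma> * (v \<bullet> v) \<le> v \<bullet> (A *\<^sub>v v)"
    and \<Gamma>: "0 < \<Gamma>" "\<And>v. v \<in> carrier_vec n \<Longrightarrow> (A *\<^sub>v v) \<bullet> (A *\<^sub>v v) \<le> \<Gamma>\<^sup>2 * (v \<bullet> v)"
    and \<rho>: "1 - \<gamma>\<^sup>2 / \<Gamma>\<^sup>2 \<le> \<rho>\<^sup>2" "0 \<le> \<rho>"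
    and y: "gmres_iterate A b y0 k y"
  shows "l2_norm_vec (b - A *\<^sub>v y) \<le> \<rho> ^ k * l2_norm_vec (b - A *\<^sub>v y0)"
proof -
  \<comment> \<open>The minimizer of 1 - 2 w \<gamma> + w^2 \<Gamma>^2, the factor by which one step
    changes the squared norm at most; the minimum is 1 - \<gamma>^2 / \<Gamma>^2.\<close>
  define w where "w = \<gamma> / \<Gamma>\<^sup>2"
  let ?G = "1\<^sub>m n - w \<cdot>\<^sub>m A" and ?r = "b - A *\<^sub>v y0"
  have r: "?r \<in> carrier_vec n" using A b y0 by simp
  have G: "?G \<in> carrier_mat n n" by (intro minus_carrier_mat smult_carrier_mat A)
  have step: "(?G *\<^sub>v v) \<bullet> (?G *\<^sub>v v) \<le> \<rho>\<^sup>2 * (v \<bullet> v)" if v: "v \<in> carrier_vec n" for v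
  proof -
    let ?a = "A *\<^sub>v v"
    have a: "?a \<in> carrier_vec n" "w \<cdot>\<^sub>v ?a \<in> carrier_vec n" using A v by auto
    have "?G *\<^sub>v v = v - w \<cdot>\<^sub>v ?a"
      using A v by (simp add: minus_mult_distrib_mat_vec[of _ n n] smult_mat_mult_vec[of _ n n])
    then have "(?G *\<^sub>v v) \<bullet> (?G *\<^sub>v v) = v \<bullet> v - 2 * w * (v \<bullet> ?a) + w\<^sup>2 * (?a \<bullet> ?a)"
      using comm_scalar_prod[OF v a(1)] v a
      by (simp add: minus_scalar_prod_distrib[of _ n] scalar_prod_minus_distrib[of _ n] power2_eq_square
          right_diff_distrib mult.assoc)
    also have "\<dots> \<le> v \<bullet> v - 2 * w * (\<gamma> * (v \<bullet> v)) + w\<^sup>2 * (\<Gamma>\<^sup>2 * (v \<bullet> v))"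
      using \<gamma>(2)[OF v] \<Gamma>(2)[OF v] \<gamma>(1) \<Gamma>(1) by (intro add_mono diff_mono mult_left_mono) (auto simp: w_def)
    also have "\<dots> = (1 - \<gamma>\<^sup>2 / \<Gamma>\<^sup>2) * (v \<bullet> v)"
      using \<Gamma>(1) by (simp add: w_def field_simps power2_eq_square)
    also have "\<dots> \<le> \<rho>\<^sup>2 * (v \<bullet> v)" using \<rho>(1) scalar_prod_self_nonneg by (intro mult_right_mono) auto
    finally show ?thesis .
  qed
  have pow: "((?G ^\<^sub>m k) *\<^sub>v v) \<bullet> ((?G ^\<^sub>m k) *\<^sub>v v) \<le> (\<rho> ^ k)\<^sup>2 * (v \<bullet> v)" if "v \<in> carrier_vec n" for v
    using that
  proof (induction k arbitrary: v)
    case 0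
    then show ?case using A by simp
  next
    case (Suc k)
    have Gv: "?G *\<^sub>v v \<in> carrier_vec n" using G Suc.prems by simp
    have "(?G ^\<^sub>m Suc k) *\<^sub>v v = (?G ^\<^sub>m k) *\<^sub>v (?G *\<^sub>v v)"
      unfolding pow_mat.simps by (rule assoc_mult_mat_vec[OF pow_carrier_mat[OF G] G Suc.prems])
    then have "((?G ^\<^sub>m Suc k) *\<^sub>v v) \<bullet> ((?G ^\<^sub>m Suc k) *\<^sub>v v) \<le> (\<rho> ^ k)\<^sup>2 * ((?G *\<^sub>v v) \<bullet> (?G *\<^sub>v v))"
      using Suc.IH[OF Gv] by simp
    also have "\<dots> \<le> (\<rho> ^ k)\<^sup>2 * (\<rho>\<^sup>2 * (v \<bullet> v))"
      using step[OF Suc.prems] by (intro mult_left_mono) auto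
    finally show ?case by (simp add: power_mult_distrib mult_ac)
  qed
  obtain z where z: "z \<in> krylov A ?r k" "z \<in> carrier_vec n" "(?G ^\<^sub>m k) *\<^sub>v ?r = ?r - A *\<^sub>v z"
    using richardson_residual_krylov[OF A r] by blast
  have eq: "b - A *\<^sub>v (y0 + z) = (?G ^\<^sub>m k) *\<^sub>v ?r"
  proof -
    have "A *\<^sub>v (y0 + z) = A *\<^sub>v y0 + A *\<^sub>v z" by (rule mult_add_distrib_mat_vec[OF A y0 z(2)])
    moreover have "u - (x + x') = u - x - x'"
      if "u \<in> carrier_vec n" "x \<in> carrier_vec n" "x' \<in> carrier_vec n" for u x x' :: "real vec"
      using that by (intro eq_vecI) auto
    ultimately show ?thesis using z(2,3) A b y0 by simp
  qed
  have "y0 + z \<in> (\<lambda>z. y0 + z) ` krylov A ?r k" using z(1) by blast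
  then have "\<not> l2_norm_vec (b - A *\<^sub>v (y0 + z)) < l2_norm_vec (b - A *\<^sub>v y)"
    using y unfolding gmres_iterate_def is_arg_min_def by blast
  then have "l2_norm_vec (b - A *\<^sub>v y) \<le> sqrt (((?G ^\<^sub>m k) *\<^sub>v ?r) \<bullet> ((?G ^\<^sub>m k) *\<^sub>v ?r))"
    unfolding eq by (simp add: l2_norm_vec_def)
  also have "\<dots> \<le> sqrt ((\<rho> ^ k)\<^sup>2 * (?r \<bullet> ?r))" using pow[OF r] by simp
  also have "\<dots> = \<rho> ^ k * l2_norm_vec ?r" using \<rho>(2) by (simp add: l2_norm_vec_def real_sqrt_mult)
  finally show ?thesis .
qed

lemma convergence_factor_le:
  fixes e1 e2 :: real
  assumes e: "0 < e1" "e1 \<le> e2"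
  defines "eb \<equiv> (e2 + e1) / 2"
  defines "\<gamma> \<equiv> min (e1 / eb) (1 - sqrt 6 / 4)" and "\<Gamma> \<equiv> max (e2 / eb) (1 + sqrt 6 / 4)"
  shows "sqrt (1 - \<gamma>\<^sup>2 / \<Gamma>\<^sup>2) \<le> Max {sqrt (1 - e1\<^sup>2 / e2\<^sup>2), sqrt (16 * sqrt 6 / (4 + sqrt 6)\<^sup>2),
    sqrt (1 - (e2 + e1)\<^sup>2 * (11 - 4 * sqrt 6) / (32 * e2\<^sup>2)),
    sqrt (1 - 32 * e1\<^sup>2 / ((11 + 4 * sqrt 6) * (e2 + e1)\<^sup>2))}"
proof -
  have eb: "0 < eb" "e2 + e1 = 2 * eb" using e by (auto simp: eb_def)
  define s :: real where "s = sqrt 6"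
  have s: "s\<^sup>2 = 6" "0 < s" by (auto simp: s_def)
  \<comment> \<open>The origin of 11 and 32: the squares use s^2 = 6, and the mean eb = (e2 + e1) /
    2 contributes a further factor 4 to the denominator 8 in the two mixed cases.\<close>
  have sq: "(1 - s / 4)\<^sup>2 = (11 - 4 * s) / 8" "(1 + s / 4)\<^sup>2 = (11 + 4 * s) / 8"
    "(4 + s)\<^sup>2 = 2 * (11 + 4 * s)"
    using s by (auto simp: power2_eq_square algebra_simps)
  have p: "0 < 11 + 4 * s" using s by simp
  have "(e1 / eb)\<^sup>2 / (e2 / eb)\<^sup>2 = e1\<^sup>2 / e2\<^sup>2" using eb by (simp add: power_divide)
  moreover have "1 - (1 - s / 4)\<^sup>2 / (1 + s / 4)\<^sup>2 = 16 * s / (4 + s)\<^sup>2"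
    unfolding sq using p by (simp add: field_simps)
  moreover have "(1 - s / 4)\<^sup>2 / (e2 / eb)\<^sup>2 = (e2 + e1)\<^sup>2 * (11 - 4 * s) / (32 * e2\<^sup>2)"
    unfolding sq eb(2) using eb e by (simp add: power_divide field_simps power_mult_distrib)
  moreover have "(e1 / eb)\<^sup>2 / (1 + s / 4)\<^sup>2 = 32 * e1\<^sup>2 / ((11 + 4 * s) * (e2 + e1)\<^sup>2)"
  proof -
    have "(e1 / eb)\<^sup>2 / (P / 8) = 32 * e1\<^sup>2 / (P * (2 * eb)\<^sup>2)" if "0 < P" for P
      using that eb by (simp add: power_divide power_mult_distrib mult.commute)
    from this[OF p] show ?thesis unfolding sq eb(2) .
  qed
  ultimately have "sqrt (1 - \<gamma>\<^sup>2 / \<Gamma>\<^sup>2) \<in> {sqrt (1 - e1\<^sup>2 / e2\<^sup>2), sqrt (16 * s / (4 + s)\<^sup>2),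
    sqrt (1 - (e2 + e1)\<^sup>2 * (11 - 4 * s) / (32 * e2\<^sup>2)),
    sqrt (1 - 32 * e1\<^sup>2 / ((11 + 4 * s) * (e2 + e1)\<^sup>2))}"
    unfolding \<gamma>_def \<Gamma>_def s_def[symmetric] by (auto simp: min_def max_def)
  then show ?thesis unfolding s_def by (intro Max_ge) auto
qed

section \<open>Weighted sums of matrices\<close>

text \<open>Entrywise, because matrices of all sizes share one type: the size n is then fixed by the
  definition, whatever d and F are.\<close>

definition wsum :: "nat \<Rightarrow> nat \<Rightarrow> (nat \<Rightarrow> real) \<Rightarrow> (nat \<Rightarrow> real mat) \<Rightarrow> real mat" where
  "wsum n d w F = Matrix.mat n n (\<lambda>pq. \<Sum>i<d. w i * F i $$ pq)"

lemma wsum_carrier: "wsum n d w F \<in> carrier_mat n n"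
  by (simp add: wsum_def)

lemma wsum_cong: "(\<And>i. i < d \<Longrightarrow> F i = G i) \<Longrightarrow> wsum n d w F = wsum n d w G"
  by (auto simp: wsum_def intro!: cong_mat sum.cong)

lemma wsum_mult:
  assumes A: "A \<in> carrier_mat n n" and F: "\<And>i. i < d \<Longrightarrow> F i \<in> carrier_mat n n"
  shows "A * wsum n d w F = wsum n d w (\<lambda>i. A * F i)"
    "wsum n d w F * A = wsum n d w (\<lambda>i. F i * A)"
proof -
  have entry: "(X * Y) $$ (p, q) = (\<Sum>k<n. X $$ (p, k) * Y $$ (k, q))"
    if "X \<in> carrier_mat n n" "Y \<in> carrier_mat n n" "p < n" "q < n" for X Y :: "real mat" and p q
    using that by (simp add: scalar_prod_def atLeast0LessThan)
  have w: "wsum n d w G $$ (p, q) = (\<Sum>i<d. w i * G i $$ (p, q))" if "p < n" "q < n" for G p q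
    using that by (simp add: wsum_def)
  show "A * wsum n d w F = wsum n d w (\<lambda>i. A * F i)"
  proof (rule eq_matI)
    fix p q assume "p < dim_row (wsum n d w (\<lambda>i. A * F i))" "q < dim_col (wsum n d w (\<lambda>i. A * F i))"
    then have pq: "p < n" "q < n" by (auto simp: wsum_def)
    have "(A * wsum n d w F) $$ (p, q) = (\<Sum>k<n. \<Sum>i<d. w i * (A $$ (p, k) * F i $$ (k, q)))"
      using entry[OF A wsum_carrier pq] pq by (simp add: w sum_distrib_left mult_ac)
    also have "\<dots> = (\<Sum>i<d. w i * (A * F i) $$ (p, q))"
      by (subst sum.swap) (auto simp: entry[OF A F pq] sum_distrib_left intro!: sum.cong)
    finally show "(A * wsum n d w F) $$ (p, q) = wsum n d w (\<lambda>i. A * F i) $$ (p, q)"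
      by (simp add: w pq)
  qed (use A in \<open>auto simp: wsum_def\<close>)
  show "wsum n d w F * A = wsum n d w (\<lambda>i. F i * A)"
  proof (rule eq_matI)
    fix p q assume "p < dim_row (wsum n d w (\<lambda>i. F i * A))" "q < dim_col (wsum n d w (\<lambda>i. F i * A))"
    then have pq: "p < n" "q < n" by (auto simp: wsum_def)
    have "(wsum n d w F * A) $$ (p, q) = (\<Sum>k<n. \<Sum>i<d. w i * (F i $$ (p, k) * A $$ (k, q)))"
      using entry[OF wsum_carrier A pq] pq by (simp add: w sum_distrib_left mult_ac)
    also have "\<dots> = (\<Sum>i<d. w i * (F i * A) $$ (p, q))"
      by (subst sum.swap) (auto simp: entry[OF F A pq] sum_distrib_left intro!: sum.cong)
    finally show "(wsum n d w F * A) $$ (p, q) = wsum n d w (\<lambda>i. F i * A) $$ (p, q)"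
      by (simp add: w pq)
  qed (use A in \<open>auto simp: wsum_def\<close>)
qed

lemma wsum_form:
  assumes F: "\<And>i. i < d \<Longrightarrow> F i \<in> carrier_mat n n" and x: "x \<in> carrier_vec n" and y: "y \<in> carrier_vec n"
  shows "x \<bullet> (wsum n d w F *\<^sub>v y) = (\<Sum>i<d. w i * (x \<bullet> (F i *\<^sub>v y)))"
proof -
  have "x \<bullet> (wsum n d w F *\<^sub>v y) = (\<Sum>p<n. \<Sum>q<n. \<Sum>i<d. w i * (F i $$ (p, q) * x $ p * y $ q))"
    unfolding form_sum[OF wsum_carrier x y]
    by (intro sum.cong refl) (simp add: wsum_def sum_distrib_right mult.assoc)
  also have "\<dots> = (\<Sum>p<n. \<Sum>i<d. \<Sum>q<n. w i * (F i $$ (p, q) * x $ p * y $ q))"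
    by (intro sum.cong refl sum.swap)
  also have "\<dots> = (\<Sum>i<d. \<Sum>p<n. \<Sum>q<n. w i * (F i $$ (p, q) * x $ p * y $ q))"
    by (rule sum.swap)
  also have "\<dots> = (\<Sum>i<d. w i * (x \<bullet> (F i *\<^sub>v y)))"
    by (intro sum.cong refl) (simp add: form_sum[OF F x y] sum_distrib_left)
  finally show ?thesis .
qed

lemma wsum_sym:
  assumes "\<And>i. i < d \<Longrightarrow> F i \<in> carrier_mat n n" "\<And>i. i < d \<Longrightarrow> transpose_mat (F i) = F i"
  shows "transpose_mat (wsum n d w F) = wsum n d w F"
proof (rule sym_matI[OF wsum_carrier])
  fix p q assume pq: "p < n" "q < n"
  have "F i $$ (p, q) = F i $$ (q, p)" if "i < d" for i
    using assms(1)[OF that] assms(2)[OF that] pq by (metis carrier_matD index_transpose_mat(1))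
  then show "wsum n d w F $$ (p, q) = wsum n d w F $$ (q, p)"
    using pq by (simp add: wsum_def)
qed

text \<open>The Kronecker product of the square roots is a symmetric square root R of the product,
  so the form at v is |R v|^2. The product of the inverses shows that R v = 0 forces v = 0.\<close>

lemma kron_prod_spd:
  assumes A: "\<And>l. l < d \<Longrightarrow> spd N (A l)"
  shows "spd (N ^ d) (kron_prod A d)" "kron_prod (\<lambda>l. inv_mat (A l)) d * kron_prod A d = 1\<^sub>m (N ^ d)"
proof -
  have "\<forall>l. \<exists>R. l < d \<longrightarrow> spd N R \<and> R * R = A l" using A spd_sqrt_exists by metis
  then obtain R where R: "\<And>l. l < d \<Longrightarrow> spd N (R l)" "\<And>l. l < d \<Longrightarrow> R l * R l = A l" by metis
  let ?R = "kron_prod R d" and ?A = "kron_prod A d" and ?C = "kron_prod (\<lambda>l. inv_mat (A l)) d"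
  note Ac = spdD(1)[OF A] and Rc = spdD(1)[OF R(1)] and Cc = spd_inv_mat(1)[OF A]
  have c: "?R \<in> carrier_mat (N ^ d) (N ^ d)" "?A \<in> carrier_mat (N ^ d) (N ^ d)" "?C \<in> carrier_mat (N ^ d) (N ^ d)"
    using Ac Rc Cc by (auto intro!: kron_prod_carrier)
  have "?C * ?A = kron_prod (\<lambda>l. inv_mat (A l) * A l) d" by (rule kron_prod_mult[OF Cc Ac])
  also have "\<dots> = kron_prod (\<lambda>_. 1\<^sub>m N) d" using spd_inv_mat(3)[OF A] by (intro kron_prod_cong)
  finally show CA: "?C * ?A = 1\<^sub>m (N ^ d)" by (simp add: kron_prod_one)
  have "?R * ?R = kron_prod (\<lambda>l. R l * R l) d" by (rule kron_prod_mult[OF Rc Rc])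
  also have "\<dots> = ?A" using R(2) by (intro kron_prod_cong)
  finally have RR: "?R * ?R = ?A" .
  have Rs: "transpose_mat ?R = ?R"
    using kron_prod_transpose[OF Rc] kron_prod_cong[OF spdD(2)[OF R(1)]] by simp
  have As: "transpose_mat ?A = ?A"
    using kron_prod_transpose[OF Ac] kron_prod_cong[OF spdD(2)[OF A]] by simp
  have "0 < v \<bullet> (?A *\<^sub>v v)" if v: "v \<in> carrier_vec (N ^ d)" "v \<noteq> 0\<^sub>v (N ^ d)" for v
  proof -
    have Rv: "?R *\<^sub>v v \<in> carrier_vec (N ^ d)" by (rule mult_mat_vec_carrier[OF c(1) v(1)])
    have Av: "?A *\<^sub>v v = ?R *\<^sub>v (?R *\<^sub>v v)"
      unfolding RR[symmetric] by (rule assoc_mult_mat_vec[OF c(1,1) v(1)])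
    have "?R *\<^sub>v v \<noteq> 0\<^sub>v (N ^ d)"
    proof
      assume z: "?R *\<^sub>v v = 0\<^sub>v (N ^ d)"
      have "v = (?C * ?A) *\<^sub>v v" unfolding CA using v(1) by simp
      also have "\<dots> = ?C *\<^sub>v (?A *\<^sub>v v)" by (rule assoc_mult_mat_vec[OF c(3,2) v(1)])
      also have "?A *\<^sub>v v = 0\<^sub>v (N ^ d)" unfolding Av z using c(1) by auto
      also have "?C *\<^sub>v 0\<^sub>v (N ^ d) = 0\<^sub>v (N ^ d)" using c(3) by auto
      finally show False using v(2) by simp
    qed
    then show ?thesis
      unfolding Av transpose_form[OF c(1) Rs v(1) Rv, symmetric] by (rule scalar_prod_self_pos[OF Rv])
  qed
  then show "spd (N ^ d) ?A" unfolding spd_iff using c As by auto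
qed

text \<open>Under x = Q v the form of P becomes v . v, so bounds relative to P turn into absolute
  ones. The upper bound is assumed for pairs x, y because the preconditioned matrix is not symmetric
  and its norm is wanted.\<close>

lemma preconditioned_bounds:
  assumes P: "spd n P" and A: "A \<in> carrier_mat n n"
  defines "Q \<equiv> inv_mat (spd_sqrt P)"
  shows "Q \<in> carrier_mat n n"
    "(\<And>x. x \<in> carrier_vec n \<Longrightarrow> \<gamma> * (x \<bullet> (P *\<^sub>v x)) \<le> x \<bullet> (A *\<^sub>v x)) \<Longrightarrow>
      v \<in> carrier_vec n \<Longrightarrow> \<gamma> * (v \<bullet> v) \<le> v \<bullet> (Q * A * Q *\<^sub>v v)"
    "(\<And>x y. x \<in> carrier_vec n \<Longrightarrow> y \<in> carrier_vec n \<Longrightarrow>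
        2 * (x \<bullet> (A *\<^sub>v y)) \<le> \<Gamma> * (x \<bullet> (P *\<^sub>v x) + y \<bullet> (P *\<^sub>v y))) \<Longrightarrow> 0 < \<Gamma> \<Longrightarrow>
      v \<in> carrier_vec n \<Longrightarrow> (Q * A * Q *\<^sub>v v) \<bullet> (Q * A * Q *\<^sub>v v) \<le> \<Gamma>\<^sup>2 * (v \<bullet> v)"
proof -
  let ?R = "spd_sqrt P"
  note R = spd_sqrt[OF P]
  note Rd = spdD[OF R(1)]
  have Q: "Q \<in> carrier_mat n n" "transpose_mat Q = Q"
    unfolding Q_def using spd_inv_mat(1)[OF R(1)] sym_inv_mat[OF R(1)] .
  show "Q \<in> carrier_mat n n" by (rule Q)
  have Qv: "Q *\<^sub>v v \<in> carrier_vec n" if "v \<in> carrier_vec n" for v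
    by (rule mult_mat_vec_carrier[OF Q(1) that])
  have P_form: "(Q *\<^sub>v v) \<bullet> (P *\<^sub>v (Q *\<^sub>v v)) = v \<bullet> v" if v: "v \<in> carrier_vec n" for v
  proof -
    have RQ: "?R *\<^sub>v (Q *\<^sub>v v) = v" unfolding Q_def by (rule mult_inv_mat_cancel(1)[OF R(1) v])
    have "P *\<^sub>v (Q *\<^sub>v v) = ?R *\<^sub>v (?R *\<^sub>v (Q *\<^sub>v v))"
      using assoc_mult_mat_vec[OF Rd(1) Rd(1) Qv[OF v]] R(2) by simp
    also have "\<dots> = ?R *\<^sub>v v" unfolding RQ ..
    finally show ?thesis using transpose_form[OF Rd(1,2) Qv[OF v] v] RQ by simp
  qed
  have A_form: "u \<bullet> (Q * A * Q *\<^sub>v v) = (Q *\<^sub>v u) \<bullet> (A *\<^sub>v (Q *\<^sub>v v))"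
    if u: "u \<in> carrier_vec n" and v: "v \<in> carrier_vec n" for u v
  proof -
    have "Q * A * Q *\<^sub>v v = Q *\<^sub>v (A *\<^sub>v (Q *\<^sub>v v))"
      using Q(1) A v Qv[OF v] by (simp add: assoc_mult_mat_vec[of _ n n _ n])
    then show ?thesis
      using transpose_form[OF Q u mult_mat_vec_carrier[OF A Qv[OF v]]] by simp
  qed
  show "\<gamma> * (v \<bullet> v) \<le> v \<bullet> (Q * A * Q *\<^sub>v v)"
    if "\<And>x. x \<in> carrier_vec n \<Longrightarrow> \<gamma> * (x \<bullet> (P *\<^sub>v x)) \<le> x \<bullet> (A *\<^sub>v x)" and v: "v \<in> carrier_vec n"
    using that(1)[OF Qv[OF v]] P_form[OF v] A_form[OF v v] by simp
  show "(Q * A * Q *\<^sub>v v) \<bullet> (Q * A * Q *\<^sub>v v) \<le> \<Gamma>\<^sup>2 * (v \<bullet> v)"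
    if bound: "\<And>x y. x \<in> carrier_vec n \<Longrightarrow> y \<in> carrier_vec n \<Longrightarrow>
        2 * (x \<bullet> (A *\<^sub>v y)) \<le> \<Gamma> * (x \<bullet> (P *\<^sub>v x) + y \<bullet> (P *\<^sub>v y))"
      and \<Gamma>: "0 < \<Gamma>" and v: "v \<in> carrier_vec n"
  proof -
    let ?u = "Q * A * Q *\<^sub>v v"
    have u: "?u \<in> carrier_vec n" using Q(1) A v by (intro mult_mat_vec_carrier[of _ n n]) auto
    \<comment> \<open>Testing the bilinear bound with the image u scaled by 1 / \<Gamma> balances
      its two terms: 2 |u|^2 / \<Gamma> <= |u|^2 / \<Gamma> + \<Gamma> |v|^2.\<close>
    let ?w = "(1 / \<Gamma>) \<cdot>\<^sub>v ?u"
    have w: "?w \<in> carrier_vec n" using u by simp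
    have "2 * (?w \<bullet> ?u) \<le> \<Gamma> * (?w \<bullet> ?w + v \<bullet> v)"
      using bound[OF Qv[OF w] Qv[OF v]] P_form[OF w] P_form[OF v] A_form[OF w v] by simp
    also have "?w \<bullet> ?w = (?u \<bullet> ?u) / \<Gamma>\<^sup>2" using u by (simp add: power2_eq_square)
    also have "?w \<bullet> ?u = (?u \<bullet> ?u) / \<Gamma>" using u by simp
    finally show ?thesis using \<Gamma> by (simp add: field_simps power2_eq_square)
  qed
qed

section \<open>The preconditioned scheme\<close>

context
  fixes D :: riesz_problem
  assumes sizes: "0 < ndirs D" "0 < npts D" "0 < nsteps D"
    and ord: "\<forall>i < ndirs D. 1 < frac_ord D i \<and> frac_ord D i < 2"
    and coef: "\<forall>i < ndirs D. 0 \<le> diff_coef D i"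
    and ends: "\<forall>i < ndirs D. left_end D i < right_end D i"
    and time: "0 < final_time D"
    and e_pos: "\<exists>e\<^sub>0 > 0. \<exists>e\<^sub>1. \<forall>x \<in> Omega D. \<forall>t \<in> {0<..final_time D}.
      e\<^sub>0 \<le> e_fun D x t \<and> e_fun D x t \<le> e\<^sub>1"
begin

section \<open>Positivity of the weights and bounds on the values of e at the grid\<close>

lemma hstep_pos: "i < ndirs D \<Longrightarrow> 0 < hstep D i"
  using ends by (simp add: hstep_def)

lemma eta_nonneg:
  assumes "i < ndirs D"
  shows "0 \<le> eta D i"
proof -
  have "0 \<le> dt D" using time by (simp add: dt_def)
  then show ?thesis using coef assms unfolding eta_def by (intro divide_nonneg_nonneg mult_nonneg_nonneg) auto
qed

lemma grid_in_Omega: "grid_point D (multi_index D p) \<in> Omega D"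
proof -
  have "left_end D i < left_end D i + real (multi_index D p i) * hstep D i \<and>
      left_end D i + real (multi_index D p i) * hstep D i < right_end D i" if i: "i < ndirs D" for i
  proof -
    have j: "1 \<le> multi_index D p i" "multi_index D p i < npts D + 1"
      using sizes(2) by (auto simp: multi_index_def)
    have "real (multi_index D p i) * hstep D i < (real (npts D) + 1) * hstep D i"
      using j hstep_pos[OF i] by (intro mult_strict_right_mono) auto
    also have "\<dots> = right_end D i - left_end D i" by (simp add: hstep_def)
    finally show ?thesis using j hstep_pos[OF i] by (auto intro: mult_pos_pos)
  qed
  then show ?thesis by (auto simp: Omega_def grid_point_def)
qed

lemma t_half_in:
  assumes "m < nsteps D"
  shows "t_half D m \<in> {0<..final_time D}"
proof -
  have "(real m + 1 / 2) * final_time D \<le> real (nsteps D) * final_time D"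
    using assms time by (intro mult_right_mono) auto
  then have "t_half D m \<le> final_time D"
    using sizes by (simp add: t_half_def dt_def field_simps)
  moreover have "0 < t_half D m"
    unfolding t_half_def dt_def using time sizes by (intro mult_pos_pos divide_pos_pos) auto
  ultimately show ?thesis by simp
qed

lemma e_values_finite: "finite (e_values D)" "e_values D \<noteq> {}"
proof -
  have "e_values D = (\<lambda>(p, m). e_fun D (grid_point D (multi_index D p)) (t_half D m)) `
      ({..<ndof D} \<times> {..<nsteps D})"
    by (auto simp: e_values_def)
  moreover have "0 < ndof D" using sizes by (simp add: ndof_def)
  ultimately show "finite (e_values D)" "e_values D \<noteq> {}" using sizes by auto
qed

lemma e_bounds:
  assumes "p < ndof D" "m < nsteps D"
  shows "e_min D \<le> e_fun D (grid_point D (multi_index D p)) (t_half D m)"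
    "e_fun D (grid_point D (multi_index D p)) (t_half D m) \<le> e_max D"
  using assms e_values_finite unfolding e_min_def e_max_def
  by (auto intro!: Min_le Max_ge simp: e_values_def)

lemma e_min_pos: "0 < e_min D" "e_min D \<le> e_max D" "0 < e_bar D"
proof -
  have "e_min D \<in> e_values D" unfolding e_min_def using e_values_finite by (rule Min_in)
  then obtain p m where pm: "m < nsteps D" "e_min D = e_fun D (grid_point D (multi_index D p)) (t_half D m)"
    by (auto simp: e_values_def)
  show "0 < e_min D"
    unfolding pm(2) using e_pos grid_in_Omega[of p] t_half_in[OF pm(1)] by (meson less_le_trans)
  moreover show "e_min D \<le> e_max D"
    using e_values_finite unfolding e_min_def e_max_def by (meson Max_ge Min_in)
  ultimately show "0 < e_bar D" by (simp add: e_bar_def)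
qed

text \<open>E is diagonal with entries between \<open>e_min D\<close> and \<open>e_max D\<close>.
  The last bound is the arithmetic-geometric mean inequality in each entry, multiplied by a positive
  value of e; it has the two-vector form required by \<open>preconditioned_bounds\<close>.\<close>

lemma E_mat_form:
  assumes m: "m < nsteps D" and x: "x \<in> carrier_vec (ndof D)" and y: "y \<in> carrier_vec (ndof D)"
  shows "E_mat D m \<in> carrier_mat (ndof D) (ndof D)"
    "e_min D * (x \<bullet> x) \<le> x \<bullet> (E_mat D m *\<^sub>v x)"
    "2 * (x \<bullet> (E_mat D m *\<^sub>v y)) \<le> e_max D * (x \<bullet> x + y \<bullet> y)"
proof -
  let ?e = "\<lambda>p. e_fun D (grid_point D (multi_index D p)) (t_half D m)"
  show E: "E_mat D m \<in> carrier_mat (ndof D) (ndof D)" by (simp add: E_mat_def mat_diag_def)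
  have form: "u \<bullet> (E_mat D m *\<^sub>v v) = (\<Sum>p<ndof D. ?e p * (u $ p * v $ p))"
    if u: "u \<in> carrier_vec (ndof D)" and v: "v \<in> carrier_vec (ndof D)" for u v
  proof -
    have "(\<Sum>q<ndof D. E_mat D m $$ (p, q) * u $ p * v $ q) = ?e p * (u $ p * v $ p)" if "p < ndof D" for p
    proof -
      have "(\<Sum>q<ndof D. E_mat D m $$ (p, q) * u $ p * v $ q) = (\<Sum>q<ndof D. if q = p then ?e p * (u $ p * v $ p) else 0)"
        using that by (intro sum.cong) (auto simp: E_mat_def mat_diag_def on_grid_def)
      then show ?thesis using that by simp
    qed
    then show ?thesis unfolding form_sum[OF E u v] by simp
  qed
  have sp: "u \<bullet> v = (\<Sum>p<ndof D. u $ p * v $ p)"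
    if "u \<in> carrier_vec (ndof D)" "v \<in> carrier_vec (ndof D)" for u v :: "real vec"
    using that by (simp add: scalar_prod_def atLeast0LessThan)
  have "e_min D * (\<Sum>p<ndof D. x $ p * x $ p) \<le> (\<Sum>p<ndof D. ?e p * (x $ p * x $ p))"
    unfolding sum_distrib_left using e_bounds(1)[OF _ m] by (intro sum_mono mult_right_mono) auto
  then show "e_min D * (x \<bullet> x) \<le> x \<bullet> (E_mat D m *\<^sub>v x)" unfolding form[OF x x] sp[OF x x] .
  have "2 * (?e p * (x $ p * y $ p)) \<le> e_max D * (x $ p * x $ p + y $ p * y $ p)" if p: "p < ndof D" for p
  proof -
    have "0 \<le> (x $ p - y $ p)\<^sup>2" by simp
    then have "2 * (x $ p * y $ p) \<le> x $ p * x $ p + y $ p * y $ p"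
      by (simp add: power2_eq_square algebra_simps)
    then have "?e p * (2 * (x $ p * y $ p)) \<le> ?e p * (x $ p * x $ p + y $ p * y $ p)"
      using e_bounds(1)[OF p m] e_min_pos(1) by (intro mult_left_mono) auto
    also have "\<dots> \<le> e_max D * (x $ p * x $ p + y $ p * y $ p)"
      using e_bounds(2)[OF p m] by (intro mult_right_mono) auto
    finally show ?thesis by simp
  qed
  then have "(\<Sum>p<ndof D. 2 * (?e p * (x $ p * y $ p)))
      \<le> (\<Sum>p<ndof D. e_max D * (x $ p * x $ p + y $ p * y $ p))"
    by (intro sum_mono) auto
  then show "2 * (x \<bullet> (E_mat D m *\<^sub>v y)) \<le> e_max D * (x \<bullet> x + y \<bullet> y)"
    unfolding form[OF x y] sp[OF x x] sp[OF y y]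
    by (simp add: sum_distrib_left[symmetric] sum.distrib)
qed

lemma B1_mat_spd:
  assumes "i < ndirs D"
  shows "spd (npts D) (B1_mat D i)"
  unfolding B1_mat_def using ord assms by (intro averaging_mat_spd) auto

lemma S1_mat_carrier:
  "S1_mat D i \<in> carrier_mat (npts D) (npts D)" "tau_mat (S1_mat D i) \<in> carrier_mat (npts D) (npts D)"
  "tau_hankel (S1_mat D i) \<in> carrier_mat (npts D) (npts D)"
  unfolding S1_mat_def tau_mat_def by (intro toeplitz_carrier minus_carrier_mat)+

section \<open>Splitting the system matrix and the preconditioner into coordinate directions\<close>

definition inv_B_dir :: "nat \<Rightarrow> real mat" where
  "inv_B_dir i = lift (npts D) (ndirs D) i (inv_mat (B1_mat D i))"

definition tau_dir :: "nat \<Rightarrow> real mat" where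
  "tau_dir i = lift (npts D) (ndirs D) i (tau_mat (S1_mat D i))"

definition hankel_dir :: "nat \<Rightarrow> real mat" where
  "hankel_dir i = lift (npts D) (ndirs D) i (tau_hankel (S1_mat D i))"

lemma perturbed_direction:
  assumes i: "i < ndirs D"
  shows "perturbed (ndof D) (inv_B_dir i) (tau_dir i) (hankel_dir i)"
  unfolding inv_B_dir_def tau_dir_def hankel_dir_def ndof_def B1_mat_def S1_mat_def using ord i
  by (intro perturbed_lift perturbed_tau) auto

lemma direction_carrier:
  assumes "i < ndirs D"
  shows "inv_B_dir i * tau_dir i \<in> carrier_mat (ndof D) (ndof D)" "inv_B_dir i * hankel_dir i \<in> carrier_mat (ndof D) (ndof D)"
  using perturbed_direction[OF assms] unfolding perturbed_def
  by (auto dest!: psdD(1) intro!: mult_carrier_mat[of _ _ "ndof D"])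

lemma B_mat_spd: "spd (ndof D) (B_mat D)"
  unfolding B_mat_def ndof_def using B1_mat_spd by (intro kron_prod_spd)

lemma inv_B_mat: "inv_mat (B_mat D) = kron_prod (\<lambda>l. inv_mat (B1_mat D l)) (ndirs D)"
proof (rule inv_mat_eqI[OF spdD(1)[OF B_mat_spd]])
  show "kron_prod (\<lambda>l. inv_mat (B1_mat D l)) (ndirs D) \<in> carrier_mat (ndof D) (ndof D)"
    unfolding ndof_def using spd_inv_mat(1)[OF B1_mat_spd] by (intro kron_prod_carrier)
  show "kron_prod (\<lambda>l. inv_mat (B1_mat D l)) (ndirs D) * B_mat D = 1\<^sub>m (ndof D)"
    unfolding ndof_def B_mat_def using B1_mat_spd by (intro kron_prod_spd(2))
qed

lemma kron_sum_term_carrier: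
  assumes "X \<in> carrier_mat (npts D) (npts D)"
  shows "kron_prod ((B1_mat D)(i := X)) (ndirs D) \<in> carrier_mat (ndof D) (ndof D)"
  unfolding ndof_def using assms spdD(1)[OF B1_mat_spd] by (intro kron_prod_carrier) auto

lemma kron_sum_eq_wsum:
  "kron_sum D X = wsum (ndof D) (ndirs D) (eta D) (\<lambda>i. kron_prod ((B1_mat D)(i := X i)) (ndirs D))"
  by (simp add: kron_sum_def wsum_def)

text \<open>In every direction l other than i the factor is B_l^-1 B_l = 1, so only direction i
  survives.\<close>

lemma inv_B_kron_sum:
  assumes X: "\<And>i. X i \<in> carrier_mat (npts D) (npts D)"
  shows "inv_mat (B_mat D) * kron_sum D X = wsum (ndof D) (ndirs D) (eta D)
    (\<lambda>i. lift (npts D) (ndirs D) i (inv_mat (B1_mat D i) * X i))"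
proof -
  \<comment> \<open>This holds for every i: from \<open>ndirs D\<close> on the update is not seen by
    the product, and both sides are the identity.\<close>
  have "inv_mat (B_mat D) * kron_prod ((B1_mat D)(i := X i)) (ndirs D)
      = lift (npts D) (ndirs D) i (inv_mat (B1_mat D i) * X i)" for i
  proof -
    have "inv_mat (B_mat D) * kron_prod ((B1_mat D)(i := X i)) (ndirs D)
        = kron_prod (\<lambda>l. inv_mat (B1_mat D l) * ((B1_mat D)(i := X i)) l) (ndirs D)"
      unfolding inv_B_mat using spd_inv_mat(1)[OF B1_mat_spd] spdD(1)[OF B1_mat_spd] X
      by (intro kron_prod_mult[of _ _ "npts D"]) auto
    also have "\<dots> = lift (npts D) (ndirs D) i (inv_mat (B1_mat D i) * X i)"
      unfolding lift_def using spd_inv_mat(3)[OF B1_mat_spd] by (intro kron_prod_cong) auto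
    finally show ?thesis .
  qed
  then show ?thesis
    unfolding kron_sum_eq_wsum
    using wsum_mult(1)[OF spd_inv_mat(1)[OF B_mat_spd] kron_sum_term_carrier[OF X]] by simp
qed

text \<open>Each one-dimensional Toeplitz matrix is its tau matrix plus its Hankel part, so
  direction i contributes one \<open>perturbed\<close> triple with weight
  \<open>eta D i\<close>.\<close>

lemma A_tilde_eq:
  "A_tilde D m = E_mat D m + wsum (ndof D) (ndirs D) (eta D) (\<lambda>i. inv_B_dir i * tau_dir i + inv_B_dir i * hankel_dir i)"
proof -
  have "lift (npts D) (ndirs D) i (inv_mat (B1_mat D i) * S1_mat D i) = inv_B_dir i * tau_dir i + inv_B_dir i * hankel_dir i"
    if i: "i < ndirs D" for i
  proof -
    let ?C = "inv_mat (B1_mat D i)" and ?T = "tau_mat (S1_mat D i)" and ?H = "tau_hankel (S1_mat D i)"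
    note C = spd_inv_mat(1)[OF B1_mat_spd[OF i]]
    have one: "1 \<cdot>\<^sub>m X = X" for X :: "real mat" by (intro eq_matI) auto
    have "S1_mat D i = ?T + ?H"
      unfolding tau_mat_def using S1_mat_carrier[of i] by (intro eq_matI) auto
    then have "?C * S1_mat D i = ?C * ?T + ?C * ?H"
      using mult_add_distrib_mat[OF C S1_mat_carrier(2,3), of i i] by simp
    then have "lift (npts D) (ndirs D) i (?C * S1_mat D i)
        = lift (npts D) (ndirs D) i (?C * ?T) + lift (npts D) (ndirs D) i (?C * ?H)"
      using lift_linear[OF i mult_carrier_mat[OF C S1_mat_carrier(2)] mult_carrier_mat[OF C S1_mat_carrier(3)], of 1 i 1 i]
      by (simp add: one)
    then show ?thesis
      unfolding inv_B_dir_def tau_dir_def hankel_dir_def lift_mult[OF C S1_mat_carrier(2)] lift_mult[OF C S1_mat_carrier(3)] .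
  qed
  then show ?thesis
    unfolding A_tilde_def S_mat_def using inv_B_kron_sum[of "S1_mat D", OF S1_mat_carrier(1)]
    by (simp cong: wsum_cong)
qed

lemma tau_B1_commute:
  assumes "i < ndirs D"
  shows "tau_mat (S1_mat D i) * B1_mat D i = B1_mat D i * tau_mat (S1_mat D i)"
  unfolding S1_mat_def B1_mat_def averaging_mat_eq using ord assms by (intro tau_tridiag_commute) auto

text \<open>Checked factor by factor: in direction i the tau matrix commutes with B_i, and in the
  other directions both factors are the same matrix.\<close>

lemma tau_S_B_commute: "tau_S_mat D * B_mat D = B_mat D * tau_S_mat D"
proof -
  let ?T = "\<lambda>i. tau_mat (S1_mat D i)"
  let ?F = "\<lambda>i. kron_prod ((B1_mat D)(i := ?T i)) (ndirs D)"
  note B1 = spdD(1)[OF B1_mat_spd]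
  have "?F i * B_mat D = B_mat D * ?F i" for i
  proof -
    have "?F i * B_mat D = kron_prod (\<lambda>l. ((B1_mat D)(i := ?T i)) l * B1_mat D l) (ndirs D)"
      unfolding B_mat_def using B1 S1_mat_carrier by (intro kron_prod_mult[of _ _ "npts D"]) auto
    also have "\<dots> = kron_prod (\<lambda>l. B1_mat D l * ((B1_mat D)(i := ?T i)) l) (ndirs D)"
      using tau_B1_commute by (intro kron_prod_cong) auto
    also have "\<dots> = B_mat D * ?F i"
      unfolding B_mat_def using B1 S1_mat_carrier
      by (intro kron_prod_mult[of _ _ "npts D", symmetric]) auto
    finally show ?thesis .
  qed
  then show ?thesis
    unfolding tau_S_mat_def kron_sum_eq_wsum
    using wsum_mult[OF spdD(1)[OF B_mat_spd] kron_sum_term_carrier[OF S1_mat_carrier(2)]] by simp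
qed

text \<open>tau(S) commutes with B, hence with its square root and with the inverse of that root.
  The two outer factors therefore merge into B^-1, which brings P to the same sum over directions as
  the system matrix without the Hankel terms.\<close>

lemma P_mat_eq:
  "P_mat D = e_bar D \<cdot>\<^sub>m 1\<^sub>m (ndof D) + wsum (ndof D) (ndirs D) (eta D) (\<lambda>i. inv_B_dir i * tau_dir i)"
proof -
  let ?n = "ndof D" and ?R = "spd_sqrt (B_mat D)" and ?Q = "B_inv_sqrt D" and ?S = "tau_S_mat D"
  note R = spd_sqrt[OF B_mat_spd]
  note Rc = spdD(1)[OF R(1)]
  note Q = spd_inv_mat[OF R(1), folded B_inv_sqrt_def]
  have S: "?S \<in> carrier_mat ?n ?n" by (simp add: tau_S_mat_def kron_sum_def)
  have SR: "?S * ?R = ?R * ?S"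
    using tau_S_B_commute R(2) by (intro commute_sqrt_if_commute[OF R(1) S]) simp
  have SQ: "?S * ?Q = ?Q * ?S"
  proof -
    have "?S * ?Q = (?Q * ?R) * (?S * ?Q)" using Q S by (simp del: assoc_mult_mat)
    also have "\<dots> = ?Q * ((?R * ?S) * ?Q)" using Q(1) Rc S by (simp add: assoc_mult_mat[of _ ?n ?n _ ?n _ ?n])
    also have "\<dots> = (?Q * ?S) * (?R * ?Q)" unfolding SR[symmetric] using Q(1) Rc S by (simp add: assoc_mult_mat[of _ ?n ?n _ ?n _ ?n])
    also have "\<dots> = ?Q * ?S" using Q S by (simp del: assoc_mult_mat)
    finally show ?thesis .
  qed
  have "?Q * ?Q = inv_mat (B_mat D)"
  proof (rule inv_mat_eqI[OF spdD(1)[OF B_mat_spd], symmetric])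
    show "?Q * ?Q \<in> carrier_mat ?n ?n" using Q by simp
    have "?Q * ?Q * B_mat D = ?Q * ?Q * (?R * ?R)" using R(2) by simp
    also have "\<dots> = ?Q * ((?Q * ?R) * ?R)"
      using Q(1) Rc by (simp add: assoc_mult_mat[of _ ?n ?n _ ?n _ ?n] del: R(2))
    also have "\<dots> = 1\<^sub>m ?n" using Q Rc by (simp del: assoc_mult_mat)
    finally show "?Q * ?Q * B_mat D = 1\<^sub>m ?n" .
  qed
  then have "inv_mat (B_mat D) * ?S = ?Q * (?S * ?Q)"
    using assoc_mult_mat[OF Q(1) Q(1) S] SQ by simp
  also have "\<dots> = ?Q * ?S * ?Q" by (rule assoc_mult_mat[OF Q(1) S Q(1), symmetric])
  finally have "?Q * ?S * ?Q = inv_mat (B_mat D) * ?S" ..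
  also have "\<dots> = wsum ?n (ndirs D) (eta D) (\<lambda>i. lift (npts D) (ndirs D) i (inv_mat (B1_mat D i) * tau_mat (S1_mat D i)))"
    unfolding tau_S_mat_def by (rule inv_B_kron_sum[OF S1_mat_carrier(2)])
  also have "\<dots> = wsum ?n (ndirs D) (eta D) (\<lambda>i. inv_B_dir i * tau_dir i)"
    unfolding inv_B_dir_def tau_dir_def
    by (intro wsum_cong lift_mult[symmetric] spd_inv_mat(1)[OF B1_mat_spd] S1_mat_carrier(2))
  finally show ?thesis unfolding P_mat_def by simp
qed

section \<open>Comparison of the system matrix with the preconditioner\<close>

lemma P_mat_form:
  assumes x: "x \<in> carrier_vec (ndof D)" and y: "y \<in> carrier_vec (ndof D)"
  shows "x \<bullet> (P_mat D *\<^sub>v y) = e_bar D * (x \<bullet> y) + (\<Sum>i<ndirs D. eta D i * (x \<bullet> (inv_B_dir i * tau_dir i *\<^sub>v y)))"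
  unfolding P_mat_eq using x y
  by (simp add: form_mat_add(1)[of _ "ndof D"] wsum_carrier form_mat_smult[of _ "ndof D"]
      wsum_form[OF direction_carrier(1)])

lemma P_mat_spd: "spd (ndof D) (P_mat D)"
  unfolding spd_iff
proof (intro conjI ballI impI)
  let ?n = "ndof D"
  note CT = perturbed_psd[OF perturbed_direction]
  show "P_mat D \<in> carrier_mat ?n ?n" unfolding P_mat_eq by (simp add: wsum_carrier)
  have "transpose_mat (wsum ?n (ndirs D) (eta D) (\<lambda>i. inv_B_dir i * tau_dir i)) = wsum ?n (ndirs D) (eta D) (\<lambda>i. inv_B_dir i * tau_dir i)"
    by (rule wsum_sym[OF psdD(1,2)[OF CT]])
  then show "transpose_mat (P_mat D) = P_mat D"
    unfolding P_mat_eq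
    by (simp add: transpose_add[of _ ?n ?n] wsum_carrier transpose_smult_mat)
  fix v :: "real vec" assume v: "v \<in> carrier_vec ?n" "v \<noteq> 0\<^sub>v ?n"
  have "0 \<le> (\<Sum>i<ndirs D. eta D i * (v \<bullet> (inv_B_dir i * tau_dir i *\<^sub>v v)))"
    using eta_nonneg psdD(3)[OF CT v(1)] by (intro sum_nonneg mult_nonneg_nonneg) auto
  then show "0 < v \<bullet> (P_mat D *\<^sub>v v)"
    unfolding P_mat_form[OF v(1) v(1)] using scalar_prod_self_pos[OF v] e_min_pos(3)
    by (simp add: add_pos_nonneg)
qed

lemma A_tilde_carrier: "A_tilde D m \<in> carrier_mat (ndof D) (ndof D)"
  unfolding A_tilde_eq by (simp add: E_mat_def mat_diag_def wsum_carrier)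

lemma A_tilde_form:
  assumes m: "m < nsteps D" and x: "x \<in> carrier_vec (ndof D)" and y: "y \<in> carrier_vec (ndof D)"
  shows "x \<bullet> (A_tilde D m *\<^sub>v y) = x \<bullet> (E_mat D m *\<^sub>v y) +
    (\<Sum>i<ndirs D. eta D i * (x \<bullet> (inv_B_dir i * tau_dir i *\<^sub>v y) + x \<bullet> (inv_B_dir i * hankel_dir i *\<^sub>v y)))"
proof -
  have c: "inv_B_dir i * tau_dir i + inv_B_dir i * hankel_dir i \<in> carrier_mat (ndof D) (ndof D)" if "i < ndirs D" for i
    using direction_carrier[OF that] by simp
  have "x \<bullet> (A_tilde D m *\<^sub>v y) = x \<bullet> (E_mat D m *\<^sub>v y) +
    (\<Sum>i<ndirs D. eta D i * (x \<bullet> ((inv_B_dir i * tau_dir i + inv_B_dir i * hankel_dir i) *\<^sub>v y)))"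
    unfolding A_tilde_eq form_mat_add(1)[OF E_mat_form(1)[OF m x y] wsum_carrier x y]
    by (simp only: wsum_form[OF c x y])
  also have "(\<Sum>i<ndirs D. eta D i * (x \<bullet> ((inv_B_dir i * tau_dir i + inv_B_dir i * hankel_dir i) *\<^sub>v y)))
      = (\<Sum>i<ndirs D. eta D i * (x \<bullet> (inv_B_dir i * tau_dir i *\<^sub>v y) + x \<bullet> (inv_B_dir i * hankel_dir i *\<^sub>v y)))"
    by (intro sum.cong refl) (simp only: form_mat_add(1)[OF direction_carrier x y] lessThan_iff)
  finally show ?thesis .
qed

text \<open>The Cauchy-Schwarz products a b are replaced by (a + b)^2 / 4, because sums, unlike
  products, can be added up over the directions.\<close>

lemma direction_bounds:
  assumes i: "i < ndirs D" and x: "x \<in> carrier_vec (ndof D)" and y: "y \<in> carrier_vec (ndof D)"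
  shows "0 \<le> x \<bullet> (inv_B_dir i * tau_dir i *\<^sub>v x)"
    "2 * \<bar>x \<bullet> (inv_B_dir i * hankel_dir i *\<^sub>v y)\<bar> \<le> sqrt 6 / 4 * (x \<bullet> (inv_B_dir i * tau_dir i *\<^sub>v x) + y \<bullet> (inv_B_dir i * tau_dir i *\<^sub>v y))"
    "2 * (x \<bullet> (inv_B_dir i * tau_dir i *\<^sub>v y)) \<le> x \<bullet> (inv_B_dir i * tau_dir i *\<^sub>v x) + y \<bullet> (inv_B_dir i * tau_dir i *\<^sub>v y)"
proof -
  let ?a = "x \<bullet> (inv_B_dir i * tau_dir i *\<^sub>v x)" and ?b = "y \<bullet> (inv_B_dir i * tau_dir i *\<^sub>v y)"
  note p = perturbed_direction[OF i]
  note CT = perturbed_psd[OF p]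
  show a: "0 \<le> ?a" by (rule psdD(3)[OF CT x])
  have b: "0 \<le> ?b" by (rule psdD(3)[OF CT y])
  have amgm: "4 * (?a * ?b) \<le> (?a + ?b)\<^sup>2"
    using zero_le_power2[of "?a - ?b"] by (simp add: power2_eq_square algebra_simps)
  have root: "\<bar>2 * h\<bar> \<le> t * (?a + ?b)" if "h\<^sup>2 \<le> t\<^sup>2 * (?a * ?b)" "0 \<le> t" for h t :: real
  proof -
    have "t\<^sup>2 * (4 * (?a * ?b)) \<le> t\<^sup>2 * (?a + ?b)\<^sup>2" using amgm by (intro mult_left_mono) auto
    then have "(2 * h)\<^sup>2 \<le> (t * (?a + ?b))\<^sup>2" using that(1) by (simp add: power_mult_distrib)
    then have "\<bar>2 * h\<bar> \<le> \<bar>t * (?a + ?b)\<bar>" by (simp only: abs_le_square_iff)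
    also have "\<dots> = t * (?a + ?b)" using a b that(2) by (intro abs_of_nonneg) simp
    finally show ?thesis .
  qed
  \<comment> \<open>This identifies sqrt 6 / 4 as the square root of the constant in
    \<open>perturbed_form_le\<close>.\<close>
  have "(sqrt 6 / 4)\<^sup>2 = (3 / 8 :: real)" by (simp add: power_divide)
  then have "(x \<bullet> (inv_B_dir i * hankel_dir i *\<^sub>v y))\<^sup>2 \<le> (sqrt 6 / 4)\<^sup>2 * (?a * ?b)"
    using perturbed_form_le[OF p x y] by (simp only:)
  then have "\<bar>2 * (x \<bullet> (inv_B_dir i * hankel_dir i *\<^sub>v y))\<bar> \<le> sqrt 6 / 4 * (?a + ?b)"
    by (rule root) simp
  then show "2 * \<bar>x \<bullet> (inv_B_dir i * hankel_dir i *\<^sub>v y)\<bar> \<le> sqrt 6 / 4 * (?a + ?b)" by (simp add: abs_mult)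
  have "\<bar>2 * (x \<bullet> (inv_B_dir i * tau_dir i *\<^sub>v y))\<bar> \<le> 1 * (?a + ?b)"
    using psd_cauchy_schwarz[OF CT x y] by (intro root) auto
  moreover note abs_ge_self[of "2 * (x \<bullet> (inv_B_dir i * tau_dir i *\<^sub>v y))"]
  ultimately show "2 * (x \<bullet> (inv_B_dir i * tau_dir i *\<^sub>v y)) \<le> ?a + ?b" by simp
qed

text \<open>Compared term by term: E against \<open>e_bar D\<close> times the identity, and each
  direction against its own tau part, where the Hankel term costs at most the fraction sqrt 6 / 4.
  The two conditions on \<gamma> correspond to these two kinds of terms.\<close>

lemma A_tilde_lower:
  assumes m: "m < nsteps D" and x: "x \<in> carrier_vec (ndof D)"
    and \<gamma>: "\<gamma> \<le> e_min D / e_bar D" "\<gamma> \<le> 1 - sqrt 6 / 4"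
  shows "\<gamma> * (x \<bullet> (P_mat D *\<^sub>v x)) \<le> x \<bullet> (A_tilde D m *\<^sub>v x)"
proof -
  have "\<gamma> * e_bar D \<le> e_min D" using \<gamma>(1) e_min_pos(3) by (simp add: field_simps)
  then have "\<gamma> * e_bar D * (x \<bullet> x) \<le> e_min D * (x \<bullet> x)"
    using scalar_prod_self_nonneg by (rule mult_right_mono)
  also have "\<dots> \<le> x \<bullet> (E_mat D m *\<^sub>v x)" by (rule E_mat_form(2)[OF m x x])
  finally have E: "\<gamma> * e_bar D * (x \<bullet> x) \<le> x \<bullet> (E_mat D m *\<^sub>v x)" .
  have "\<gamma> * (eta D i * (x \<bullet> (inv_B_dir i * tau_dir i *\<^sub>v x)))
      \<le> eta D i * (x \<bullet> (inv_B_dir i * tau_dir i *\<^sub>v x) + x \<bullet> (inv_B_dir i * hankel_dir i *\<^sub>v x))" if i: "i < ndirs D" for i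
  proof -
    note b = direction_bounds[OF i x x]
    have "\<gamma> * (x \<bullet> (inv_B_dir i * tau_dir i *\<^sub>v x)) \<le> (1 - sqrt 6 / 4) * (x \<bullet> (inv_B_dir i * tau_dir i *\<^sub>v x))"
      using \<gamma>(2) b(1) by (rule mult_right_mono)
    also have "\<dots> \<le> x \<bullet> (inv_B_dir i * tau_dir i *\<^sub>v x) + x \<bullet> (inv_B_dir i * hankel_dir i *\<^sub>v x)"
      using b(2) by (simp add: left_diff_distrib)
    finally have "eta D i * (\<gamma> * (x \<bullet> (inv_B_dir i * tau_dir i *\<^sub>v x)))
        \<le> eta D i * (x \<bullet> (inv_B_dir i * tau_dir i *\<^sub>v x) + x \<bullet> (inv_B_dir i * hankel_dir i *\<^sub>v x))"
      using eta_nonneg[OF i] by (rule mult_left_mono)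
    then show ?thesis by (simp add: mult_ac)
  qed
  then have "\<gamma> * (\<Sum>i<ndirs D. eta D i * (x \<bullet> (inv_B_dir i * tau_dir i *\<^sub>v x)))
      \<le> (\<Sum>i<ndirs D. eta D i * (x \<bullet> (inv_B_dir i * tau_dir i *\<^sub>v x) + x \<bullet> (inv_B_dir i * hankel_dir i *\<^sub>v x)))"
    unfolding sum_distrib_left by (intro sum_mono) auto
  then show ?thesis
    unfolding P_mat_form[OF x x] A_tilde_form[OF m x x] using E by (simp add: distrib_left)
qed

text \<open>The same termwise comparison from above, for two vectors: the tau part contributes the
  factor 1 and the Hankel part sqrt 6 / 4.\<close>

lemma A_tilde_upper:
  assumes m: "m < nsteps D" and x: "x \<in> carrier_vec (ndof D)" and y: "y \<in> carrier_vec (ndof D)"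
    and \<Gamma>: "e_max D / e_bar D \<le> \<Gamma>" "1 + sqrt 6 / 4 \<le> \<Gamma>"
  shows "2 * (x \<bullet> (A_tilde D m *\<^sub>v y)) \<le> \<Gamma> * (x \<bullet> (P_mat D *\<^sub>v x) + y \<bullet> (P_mat D *\<^sub>v y))"
proof -
  have "2 * (x \<bullet> (E_mat D m *\<^sub>v y)) \<le> e_max D * (x \<bullet> x + y \<bullet> y)"
    by (rule E_mat_form(3)[OF m x y])
  also have "\<dots> \<le> \<Gamma> * e_bar D * (x \<bullet> x + y \<bullet> y)"
    using \<Gamma>(1) e_min_pos(3) scalar_prod_self_nonneg
    by (intro mult_right_mono add_nonneg_nonneg) (auto simp: field_simps)
  finally have E: "2 * (x \<bullet> (E_mat D m *\<^sub>v y)) \<le> \<Gamma> * e_bar D * (x \<bullet> x + y \<bullet> y)" .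
  have "2 * (eta D i * (x \<bullet> (inv_B_dir i * tau_dir i *\<^sub>v y) + x \<bullet> (inv_B_dir i * hankel_dir i *\<^sub>v y)))
      \<le> \<Gamma> * (eta D i * (x \<bullet> (inv_B_dir i * tau_dir i *\<^sub>v x) + y \<bullet> (inv_B_dir i * tau_dir i *\<^sub>v y)))" if i: "i < ndirs D" for i
  proof -
    note b = direction_bounds[OF i x y] and b' = direction_bounds(1)[OF i y y]
    let ?s = "x \<bullet> (inv_B_dir i * tau_dir i *\<^sub>v x) + y \<bullet> (inv_B_dir i * tau_dir i *\<^sub>v y)"
    have "2 * (x \<bullet> (inv_B_dir i * tau_dir i *\<^sub>v y) + x \<bullet> (inv_B_dir i * hankel_dir i *\<^sub>v y)) \<le> ?s + sqrt 6 / 4 * ?s"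
      using b(2,3) abs_ge_self[of "x \<bullet> (inv_B_dir i * hankel_dir i *\<^sub>v y)"] unfolding distrib_left[of 2] by argo
    also have "\<dots> = (1 + sqrt 6 / 4) * ?s" by (simp add: distrib_right)
    also have "\<dots> \<le> \<Gamma> * ?s" using \<Gamma>(2) b(1) b' by (intro mult_right_mono) auto
    finally have "eta D i * (2 * (x \<bullet> (inv_B_dir i * tau_dir i *\<^sub>v y) + x \<bullet> (inv_B_dir i * hankel_dir i *\<^sub>v y))) \<le> eta D i * (\<Gamma> * ?s)"
      using eta_nonneg[OF i] by (rule mult_left_mono)
    then show ?thesis by (simp only: mult_ac)
  qed
  then have "2 * (\<Sum>i<ndirs D. eta D i * (x \<bullet> (inv_B_dir i * tau_dir i *\<^sub>v y) + x \<bullet> (inv_B_dir i * hankel_dir i *\<^sub>v y)))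
      \<le> \<Gamma> * (\<Sum>i<ndirs D. eta D i * (x \<bullet> (inv_B_dir i * tau_dir i *\<^sub>v x) + y \<bullet> (inv_B_dir i * tau_dir i *\<^sub>v y)))"
    unfolding sum_distrib_left by (intro sum_mono) auto
  then show ?thesis
    unfolding P_mat_form[OF x x] P_mat_form[OF y y] A_tilde_form[OF m x y]
    using E by (simp add: distrib_left sum.distrib)
qed

end

theorem theorem3p7:
  fixes D :: riesz_problem
    and u y r :: "nat \<Rightarrow> real vec"
    and A :: "real mat" and b :: "real vec"
    and m k :: nat and c :: real
  assumes "0 < ndirs D" and "0 < npts D" and "0 < nsteps D"
    and "\<forall>i < ndirs D. 1 < frac_ord D i \<and> frac_ord D i < 2"
    and "\<forall>i < ndirs D. 0 \<le> diff_coef D i"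
    and "(\<Sum>i<ndirs D. diff_coef D i) \<noteq> 0"
    and "\<forall>i < ndirs D. left_end D i < right_end D i"
    and "0 < final_time D"
    and "\<exists>e\<^sub>0 > 0. \<exists>e\<^sub>1. \<forall>x \<in> Omega D. \<forall>t \<in> {0<..final_time D}. e\<^sub>0 \<le> e_fun D x t \<and> e_fun D x t \<le> e\<^sub>1"
    and "scheme_solution D u"
    and "m < nsteps D"
    and "A = P_inv_sqrt D * A_tilde D m * P_inv_sqrt D"
    and "b = P_inv_sqrt D *\<^sub>v b_tilde D m (u m)"
    and "y 0 \<in> carrier_vec (ndof D)"
    and "\<forall>n \<ge> 1. gmres_iterate A b (y 0) n (y n)"
    and "\<forall>n. r n = b - A *\<^sub>v y n"
    and "r 0 \<noteq> 0\<^sub>v (ndof D)"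
    and "c = Max {sqrt (1 - (e_min D)\<^sup>2 / (e_max D)\<^sup>2),
                  sqrt (16 * sqrt 6 / (4 + sqrt 6)\<^sup>2),
                  sqrt (1 - (e_max D + e_min D)\<^sup>2 * (11 - 4 * sqrt 6) / (32 * (e_max D)\<^sup>2)),
                  sqrt (1 - 32 * (e_min D)\<^sup>2 / ((11 + 4 * sqrt 6) * (e_max D + e_min D)\<^sup>2))}"
    and "1 \<le> k"
  shows "l2_norm_vec (r k) / l2_norm_vec (r 0) \<le> (2 + c) * c ^ k"
proof -
  let ?n = "ndof D"
  note prob = assms(1-5,7-9) and m = assms(11)
  define \<gamma> where "\<gamma> = min (e_min D / e_bar D) (1 - sqrt 6 / 4)"
  define \<Gamma> where "\<Gamma> = max (e_max D / e_bar D) (1 + sqrt 6 / 4)"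
  have e: "0 < e_min D" "e_min D \<le> e_max D" "0 < e_bar D" using e_min_pos[OF prob] .
  \<comment> \<open>The Hankel perturbation is smaller than the tau part, so coercivity
    survives.\<close>
  have "sqrt 6 < (4 :: real)" by (rule real_less_lsqrt) auto
  then have \<gamma>: "0 < \<gamma>" using e by (simp add: \<gamma>_def)
  have "0 < 1 + sqrt 6 / (4 :: real)" by (simp add: add_pos_nonneg)
  then have \<Gamma>: "0 < \<Gamma>" by (simp add: \<Gamma>_def less_max_iff_disj)
  note bounds = preconditioned_bounds[OF P_mat_spd[OF prob] A_tilde_carrier[OF prob], folded P_inv_sqrt_def]
  have A: "A \<in> carrier_mat ?n ?n"
    unfolding assms(12) by (intro mult_carrier_mat[of _ _ ?n] bounds(1) A_tilde_carrier[OF prob])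
  have b: "b \<in> carrier_vec ?n"
    unfolding assms(13) using bounds(1) by (metis carrier_matD(1) carrier_vecI dim_mult_mat_vec)
  have r: "r 0 \<in> carrier_vec ?n" using assms(14,16) A b by simp
  have "sqrt (1 - \<gamma>\<^sup>2 / \<Gamma>\<^sup>2) \<le> c"
    unfolding assms(18) \<gamma>_def \<Gamma>_def e_bar_def by (rule convergence_factor_le[OF e(1,2)])
  moreover have "0 \<le> c"
  proof -
    have "0 \<le> sqrt (16 * sqrt 6 / (4 + sqrt 6)\<^sup>2)" by simp
    also have "\<dots> \<le> c" unfolding assms(18) by (intro Max_ge) auto
    finally show ?thesis .
  qed
  ultimately have c: "1 - \<gamma>\<^sup>2 / \<Gamma>\<^sup>2 \<le> c\<^sup>2" "0 \<le> c"
    using sqrt_le_D by auto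
  have lower: "\<gamma> * (v \<bullet> v) \<le> v \<bullet> (A *\<^sub>v v)" if "v \<in> carrier_vec ?n" for v
    unfolding assms(12) using that
    by (intro bounds(2) A_tilde_lower[OF prob m]) (auto simp: \<gamma>_def)
  have upper: "(A *\<^sub>v v) \<bullet> (A *\<^sub>v v) \<le> \<Gamma>\<^sup>2 * (v \<bullet> v)" if "v \<in> carrier_vec ?n" for v
    unfolding assms(12) using that \<Gamma>
    by (intro bounds(3) A_tilde_upper[OF prob m]) (auto simp: \<Gamma>_def)
  have "l2_norm_vec (r k) \<le> c ^ k * l2_norm_vec (r 0)"
    using gmres_bound[OF A b assms(14) \<gamma> lower \<Gamma> upper c] assms(15,16,19) by simp
  moreover have "0 < l2_norm_vec (r 0)"
    using scalar_prod_self_pos[OF r assms(17)] by (simp add: l2_norm_vec_def)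
  ultimately have "l2_norm_vec (r k) / l2_norm_vec (r 0) \<le> 1 * c ^ k" by (simp add: field_simps)
  \<comment> \<open>The comparison with Richardson has given the factor c^k, and 2 + c >= 1.\<close>
  also have "\<dots> \<le> (2 + c) * c ^ k" using c(2) by (intro mult_right_mono) auto
  finally show ?thesis .
qed

end
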